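(* Let $G$ be a finite non-cyclic group, and let $\Gamma_G$ be its non-cyclic graph. Then $\Gamma_G$ has nonorientable genus one, i.e. $\overline{\gamma}(\Gamma_G)=1$, if and only if $G$ is isomorphic to $\mathbb{Z}_2\times \mathbb{Z}_4$ or $D_8$.
   Context: For a finite non-cyclic group $G$, the cyclicizer of $G$ is $\mathrm{Cyc}(G)=\{a\in G: \langle a,b\rangle \text{ is cyclic for each } b\in G\}$. The non-cyclic graph $\Gamma_G$ is the simple undirected graph with vertex set $G\setminus \mathrm{Cyc}(G)$, in which two distinct vertices $x,y$ are adjacent if and only if $\langle x,y\rangle$ is not cyclic. The nonorientable genus $\overline{\gamma}(\Gamma)$ of a graph $\Gamma$ is the smallest non-negative integer $k$ such that $\Gamma$ can be embedded (drawn with no two edges crossing) in $\mathbb{N}_k$, the sphere with $k$ crosscaps ($\mathbb{N}_0$ is the sphere, $\mathbb{N}_1$ is the projective plane). $\mathbb{Z}_n$ denotes the cyclic group of order $n$ and $D_{2n}$ the dihedral group of order $2n$ (so $D_8$ has order $8$). *)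

theory Defs
  imports "HOL-Analysis.Analysis" "HOL-Algebra.Elementary_Groups" "HOL-Library.Extended_Nat"
begin

section \<open>Quotient spaces\<close>

definition quotient_topology :: "'a topology \<Rightarrow> ('a \<times> 'a) set \<Rightarrow> 'a set topology" where
  "quotient_topology X r =
     topology (\<lambda>U. U \<subseteq> topspace X // r \<and> openin X {x \<in> topspace X. r `` {x} \<in> U})"

lemma openin_quotient_topology:
  "openin (quotient_topology X r) U \<longleftrightarrow>
     U \<subseteq> topspace X // r \<and> openin X {x \<in> topspace X. r `` {x} \<in> U}"
proof -
  have "istopology (\<lambda>U. U \<subseteq> topspace X // r \<and> openin X {x \<in> topspace X. r `` {x} \<in> U})"
    unfolding istopology_def
  proof (intro conjI allI impI)
    fix S T
    assume S: "S \<subseteq> topspace X // r \<and> openin X {x \<in> topspace X. r `` {x} \<in> S}"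
      and T: "T \<subseteq> topspace X // r \<and> openin X {x \<in> topspace X. r `` {x} \<in> T}"
    show "S \<inter> T \<subseteq> topspace X // r" using S by blast
    have "{x \<in> topspace X. r `` {x} \<in> S \<inter> T} =
        {x \<in> topspace X. r `` {x} \<in> S} \<inter> {x \<in> topspace X. r `` {x} \<in> T}" by blast
    then show "openin X {x \<in> topspace X. r `` {x} \<in> S \<inter> T}" using S T by auto
  next
    fix K
    assume K: "\<forall>S\<in>K. S \<subseteq> topspace X // r \<and> openin X {x \<in> topspace X. r `` {x} \<in> S}"
    then show "\<Union>K \<subseteq> topspace X // r" by blast
    have "{x \<in> topspace X. r `` {x} \<in> \<Union>K} = (\<Union>S\<in>K. {x \<in> topspace X. r `` {x} \<in> S})" by blast
    then show "openin X {x \<in> topspace X. r `` {x} \<in> \<Union>K}" using K by auto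
  qed
  then show ?thesis by (simp add: quotient_topology_def)
qed

lemma topspace_quotient_topology [simp]: "topspace (quotient_topology X r) = topspace X // r"
proof -
  have "{x \<in> topspace X. r `` {x} \<in> topspace X // r} = topspace X"
    by (auto intro: quotientI)
  then have "openin (quotient_topology X r) (topspace X // r)"
    by (simp add: openin_quotient_topology)
  then show ?thesis
    by (meson openin_quotient_topology openin_subset openin_topspace subset_antisym)
qed

lemma quotient_map_quotient_topology:
  "quotient_map X (quotient_topology X r) (\<lambda>x. r `` {x})"
  unfolding quotient_map_def by (auto simp: openin_quotient_topology quotient_def)


section \<open>The sphere with k crosscaps\<close>

text \<open>
  From the unit sphere we remove k open round caps with pairwise disjoint closures, and on each
  of the k boundary circles we identify antipodal points. The caps have angular radius
  pi / (2 k) and are centred at equally spaced points of the equator. So no caps are removed for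
  k = 0, and for k = 1 the cap is an open hemisphere.
\<close>

definition cap_centre :: "nat \<Rightarrow> nat \<Rightarrow> real^3" where
  "cap_centre k i = vector [cos (2 * pi * real i / real k), sin (2 * pi * real i / real k), 0]"

definition cap_height :: "nat \<Rightarrow> real" where
  "cap_height k = cos (pi / (2 * real k))"

definition holed_sphere :: "nat \<Rightarrow> (real^3) set" where
  "holed_sphere k = {x \<in> sphere 0 1. \<forall>i<k. x \<bullet> cap_centre k i \<le> cap_height k}"

text \<open>The circle where \<open>x \<bullet> c = h\<close>, for a unit vector c, has centre \<open>h *\<^sub>R c\<close>, so the point of
  the circle opposite to x is \<open>2 * h *\<^sub>R c - x\<close>.\<close>

definition crosscap_rel :: "nat \<Rightarrow> ((real^3) \<times> (real^3)) set" where
  "crosscap_rel k = {(x, y). x \<in> holed_sphere k \<and> y \<in> holed_sphere k \<and>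
     (x = y \<or> (\<exists>i<k. x \<bullet> cap_centre k i = cap_height k \<and>
                     y = (2 * cap_height k) *\<^sub>R cap_centre k i - x))}"

definition crosscap_surface :: "nat \<Rightarrow> (real^3) set topology" where
  "crosscap_surface k = quotient_topology (top_of_set (holed_sphere k)) (crosscap_rel k)"

lemma inner_cap_centre:
  "cap_centre k i \<bullet> cap_centre k j = cos (2 * pi * (real i - real j) / real k)"
  by (simp add: cap_centre_def inner_vec_def sum_3 right_diff_distrib diff_divide_distrib cos_diff)

lemma norm_cap_centre [simp]: "norm (cap_centre k i) = 1"
  by (simp add: norm_eq_sqrt_inner inner_cap_centre)

lemma inner_cap_centre_le:
  assumes "i < k" "j < k" "i \<noteq> j"
  shows "cap_centre k i \<bullet> cap_centre k j \<le> cos (2 * pi / real k)"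
proof -
  have *: "cos (2 * pi * real m / real k) \<le> cos (2 * pi / real k)" if "1 \<le> m" "m < k" for m
  proof (cases "2 * real m \<le> real k")
    case True
    then show ?thesis
      using that by (intro cos_monotone_0_pi_le) (auto simp: field_simps)
  next
    case False
    have "cos (2 * pi * real m / real k) = cos (2 * pi - 2 * pi * real m / real k)"
      by (simp add: cos_diff)
    also have "2 * pi - 2 * pi * real m / real k = 2 * pi * (real k - real m) / real k"
      using that by (simp add: field_simps)
    also have "cos \<dots> \<le> cos (2 * pi / real k)"
    proof (rule cos_monotone_0_pi_le)
      have "real k - real m \<ge> 1" using that by linarith
      then show "2 * pi / real k \<le> 2 * pi * (real k - real m) / real k"
        using that by (intro divide_right_mono) auto
      have "pi * (2 * (real k - real m)) \<le> pi * real k"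
        using False by (intro mult_left_mono) auto
      then show "2 * pi * (real k - real m) / real k \<le> pi"
        using that by (simp add: field_simps)
    qed simp
    finally show ?thesis .
  qed
  show ?thesis
  proof (cases "i < j")
    case True
    have "cos (2 * pi * (real i - real j) / real k) = cos (- (2 * pi * (real i - real j) / real k))"
      by (simp only: cos_minus)
    also have "- (2 * pi * (real i - real j) / real k) = 2 * pi * real (j - i) / real k"
      using True by (simp add: of_nat_diff minus_divide_left algebra_simps del: divide_minus_left)
    finally show ?thesis
      using *[of "j - i"] True assms by (simp add: inner_cap_centre)
  next
    case False
    then show ?thesis
      using *[of "i - j"] assms by (simp add: inner_cap_centre of_nat_diff)
  qed
qed

text \<open>The closed caps are pairwise disjoint.\<close>

lemma caps_disjoint:
  assumes x: "norm x = 1" and "i < k" "j < k"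
    and "x \<bullet> cap_centre k i \<ge> cap_height k" "x \<bullet> cap_centre k j \<ge> cap_height k"
  shows "i = j"
proof (rule ccontr)
  assume ne: "i \<noteq> j"
  define c d a where "c = cap_centre k i" and "d = cap_centre k j" and "a = pi / (2 * real k)"
  have k: "k \<ge> 2" using ne assms by linarith
  have a: "0 < a" "2 * a \<le> pi / 2" "2 * a \<le> pi" using k by (auto simp: a_def field_simps)
  have c0: "cos (2 * a) \<ge> 0" using a by (intro cos_ge_zero) auto
  have lt: "cos (2 * a) < cos a" using a by (intro cos_monotone_0_pi) auto
  have "2 * cos a \<le> x \<bullet> (c + d)"
    using assms by (simp add: c_def d_def a_def cap_height_def inner_add_right)
  also have "\<dots> \<le> norm x * norm (c + d)" by (rule norm_cauchy_schwarz)
  finally have le: "2 * cos a \<le> norm (c + d)" using x by simp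
  have "(norm (c + d))\<^sup>2 = 2 + 2 * (c \<bullet> d)"
    using norm_cap_centre[of k i] norm_cap_centre[of k j]
    by (simp add: power2_norm_eq_inner inner_add_left inner_add_right inner_commute[of d c]
        norm_eq_1 flip: c_def d_def)
  also have "\<dots> \<le> 2 + 2 * cos (2 * (2 * a))"
    using inner_cap_centre_le[OF assms(2,3) ne] k by (simp add: c_def d_def a_def)
  also have "\<dots> = (2 * cos (2 * a))\<^sup>2"
    unfolding cos_double_cos[of "2 * a"] by (simp only: power_mult_distrib) simp
  finally have "norm (c + d) \<le> 2 * cos (2 * a)" by (rule power2_le_imp_le) (use c0 in simp)
  then show False using le lt by linarith
qed

text \<open>The antipodal identification is defined on all of each boundary circle.\<close>

lemma antipode_in_holed_sphere:
  assumes "x \<in> holed_sphere k" "i < k" "x \<bullet> cap_centre k i = cap_height k"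
  defines "y \<equiv> (2 * cap_height k) *\<^sub>R cap_centre k i - x"
  shows "y \<in> holed_sphere k" "y \<bullet> cap_centre k i = cap_height k"
proof -
  have cc: "cap_centre k i \<bullet> cap_centre k i = 1" by (simp add: inner_cap_centre)
  have xx: "x \<bullet> x = 1" using assms(1) by (simp add: holed_sphere_def norm_eq_1)
  show y: "y \<bullet> cap_centre k i = cap_height k"
    using assms(3) cc by (simp add: y_def inner_diff_left)
  have "y \<bullet> y = 1"
    using assms(3) cc xx
    by (simp add: y_def inner_diff_left inner_diff_right inner_commute[of "cap_centre k i" x])
  then have n: "norm y = 1" by (simp add: norm_eq_1)
  have "y \<bullet> cap_centre k j \<le> cap_height k" if "j < k" for j
    using caps_disjoint[OF n \<open>i < k\<close> that] y by force
  then show "y \<in> holed_sphere k" using n by (simp add: holed_sphere_def)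
qed

lemma equiv_crosscap_rel: "equiv (holed_sphere k) (crosscap_rel k)"
proof (rule equivI)
  show "crosscap_rel k \<subseteq> holed_sphere k \<times> holed_sphere k" by (auto simp: crosscap_rel_def)
  show "refl_on (holed_sphere k) (crosscap_rel k)"
    by (auto simp: refl_on_def crosscap_rel_def)
  show "sym (crosscap_rel k)"
  proof (rule symI)
    fix x y assume xy: "(x, y) \<in> crosscap_rel k"
    show "(y, x) \<in> crosscap_rel k"
    proof (cases "x = y")
      case False
      then obtain i where "i < k" "x \<bullet> cap_centre k i = cap_height k"
        "y = (2 * cap_height k) *\<^sub>R cap_centre k i - x" "x \<in> holed_sphere k" "y \<in> holed_sphere k"
        using xy by (auto simp: crosscap_rel_def)
      then show ?thesis
        using antipode_in_holed_sphere[of x k i] by (auto simp: crosscap_rel_def)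
    qed (use xy in simp)
  qed
  show "trans (crosscap_rel k)"
  proof (rule transI)
    fix x y z assume xy: "(x, y) \<in> crosscap_rel k" and yz: "(y, z) \<in> crosscap_rel k"
    show "(x, z) \<in> crosscap_rel k"
    proof (cases "x = y \<or> y = z")
      case False
      then obtain i j where i: "i < k" "x \<bullet> cap_centre k i = cap_height k"
          "y = (2 * cap_height k) *\<^sub>R cap_centre k i - x"
        and j: "j < k" "y \<bullet> cap_centre k j = cap_height k"
          "z = (2 * cap_height k) *\<^sub>R cap_centre k j - y"
        using xy yz by (auto simp: crosscap_rel_def)
      have S: "x \<in> holed_sphere k" "y \<in> holed_sphere k"
        using xy by (auto simp: crosscap_rel_def)
      have "y \<bullet> cap_centre k i = cap_height k"
        using antipode_in_holed_sphere(2)[OF S(1) i(1,2)] i(3) by simp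
      then have "i = j"
        using caps_disjoint[of y i k j] i(1) j(1,2) S by (simp add: holed_sphere_def)
      then have "z = x" using i(3) j(3) by simp
      then show ?thesis using S by (simp add: crosscap_rel_def)
    qed (use xy yz in auto)
  qed
qed


section \<open>Graph embeddings and nonorientable genus\<close>

text \<open>An undirected graph is a vertex set with a set of edges, each edge being a two-element set
  of vertices.\<close>

type_synonym 'a ugraph = "'a set \<times> 'a set set"

text \<open>
  A drawing without crossings: vertices are distinct points, and every edge is a simple arc that
  joins its two end vertices and whose interior meets no vertex and no other edge.
\<close>

definition is_embedding ::
    "'a ugraph \<Rightarrow> 'b topology \<Rightarrow> ('a \<Rightarrow> 'b) \<Rightarrow> ('a set \<Rightarrow> real \<Rightarrow> 'b) \<Rightarrow> bool" where
  "is_embedding = (\<lambda>(V, E) X p \<gamma>.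
     inj_on p V \<and> p ` V \<subseteq> topspace X \<and>
     (\<forall>e\<in>E. pathin X (\<gamma> e) \<and> inj_on (\<gamma> e) {0..1} \<and> {\<gamma> e 0, \<gamma> e 1} = p ` e \<and>
             \<gamma> e ` {0<..<1} \<inter> p ` V = {}) \<and>
     (\<forall>e\<in>E. \<forall>f\<in>E. e \<noteq> f \<longrightarrow> \<gamma> e ` {0<..<1} \<inter> \<gamma> f ` {0<..<1} = {}))"

definition embeddable_in :: "'a ugraph \<Rightarrow> 'b topology \<Rightarrow> bool" where
  "embeddable_in \<Gamma> X \<longleftrightarrow> (\<exists>p \<gamma>. is_embedding \<Gamma> X p \<gamma>)"

text \<open>Extended naturals avoid a junk value for a graph that embeds in none of the surfaces.\<close>

definition nonorientable_genus :: "'a ugraph \<Rightarrow> enat" where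
  "nonorientable_genus \<Gamma> = Inf {enat k |k. embeddable_in \<Gamma> (crosscap_surface k)}"


section \<open>The non-cyclic graph of a group\<close>

definition cyclicizer :: "('a, 'b) monoid_scheme \<Rightarrow> 'a set" where
  "cyclicizer G = {a \<in> carrier G. \<forall>b\<in>carrier G. cyclic_group (subgroup_generated G {a, b})}"

definition noncyclic_graph :: "('a, 'b) monoid_scheme \<Rightarrow> 'a ugraph" where
  "noncyclic_graph G =
     (let V = carrier G - cyclicizer G
      in (V, {{x, y} |x y. x \<in> V \<and> y \<in> V \<and> x \<noteq> y \<and>
                           \<not> cyclic_group (subgroup_generated G {x, y})}))"


section \<open>Dihedral groups\<close>

text \<open>
  The dihedral group of order 2 n, for positive n. With a rotation r and a reflection f satisfying
  \<open>f r = r\<inverse> f\<close>, the pair (i, s) stands for \<open>r\<^sup>i f\<close> if s is true and for \<open>r\<^sup>i\<close> otherwise.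
\<close>

definition dihedral_group :: "nat \<Rightarrow> (int \<times> bool) monoid" where
  "dihedral_group n =
     \<lparr>carrier = {0..<int n} \<times> UNIV,
      mult = (\<lambda>(i, s) (j, t). ((if s then i - j else i + j) mod int n, s \<noteq> t)),
      one = (0, False)\<rparr>"

lemma group_dihedral_group:
  assumes "n > 0"
  shows "group (dihedral_group n)"
proof (rule groupI)
  fix x assume "x \<in> carrier (dihedral_group n)"
  then obtain i s where x: "x = (i, s)" "0 \<le> i" "i < int n"
    by (auto simp: dihedral_group_def)
  show "\<exists>y\<in>carrier (dihedral_group n). y \<otimes>\<^bsub>dihedral_group n\<^esub> x = \<one>\<^bsub>dihedral_group n\<^esub>"
    using assms x
    by (intro bexI[of _ "if s then (i, True) else ((- i) mod int n, False)"])
       (auto simp: dihedral_group_def mod_simps)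
qed (use assms in \<open>auto simp: dihedral_group_def mod_simps algebra_simps\<close>)

lemma order_dihedral_group: "order (dihedral_group n) = 2 * n"
  by (simp add: order_def dihedral_group_def card_cartesian_product)

end

theory Submission
  imports Defs "HOL-Algebra.Multiplicative_Group"
begin

text \<open>
  The sphere double covers the projective plane, so a graph drawn in the projective plane lifts to an
  antipodally symmetric drawing on the sphere, in which every edge has a sign: it joins the chosen
  lifts of its ends, or a lift to the antipode of the other. A subgraph without cycles of negative
  sign lifts to two disjoint copies. If a theta graph lifts in this way, then a further vertex adjacent
  to the interiors of all three of its paths would give a connected set, disjoint from a theta curve in
  the sphere, whose closure meets the interior of all three arcs; the Jordan curve theorem forbids
  this. A pigeonhole argument on signs then shows that K(3,5), K(4,4) and K(7) do not embed in the
  projective plane.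

  Let g have maximal order m in G. The generators of a maximal cyclic subgroup are adjacent to
  everything outside it, and together with a count of elements this yields one of the three forbidden
  subgraphs unless (m, |G|) is (2,4), (3,6) or (4,8). In the first two cases and for the quaternion
  group the graph is planar, with an explicit straight drawing. The remaining groups of order 8 are
  Z2 x Z4 and D8. Their graphs contain K(3,3), and have at most 7 vertices, three of which are
  independent; such a graph is a subgraph of the one formed by the vertices and the face centres
  of a cube modulo antipodes.
\<close>

section \<open>Theta curves in the sphere\<close>

text \<open>Euler's formula would exclude all three graphs: in the projective plane a bipartite
  graph has at most 2 V - 2 edges and any graph at most 3 V - 3. But edges are arbitrary continuous
  arcs here, and counting faces presupposes that the faces are discs. Connected sets on the double
  cover ask for nothing beyond the Jordan curve theorem. The obstacle is that a closed curve in the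
  projective plane need not separate; the signs single out the theta graphs that behave as on the
  sphere.

  On the group side K(3,5) is the default, with two or three generators of <g> in the small part.
  Its count falls short for order 9, and for order 12 when an element of order 4 is present: there
  g, another element y and their inverses are one half of a K(4,4). The elementary abelian group of
  order 8 has only seven vertices, too few for either, but they are pairwise adjacent, whence K(7).
  The cube pattern has 18 = 3 * 7 - 3 edges, so it is edge-maximal.\<close>

lemma arc_homeomorphic_image:
  fixes c :: "real \<Rightarrow> 'a::topological_space" and \<phi> :: "'a \<Rightarrow> 'b::topological_space"
  assumes "arc c" "path_image c \<subseteq> A" "homeomorphism A B \<phi> \<psi>"
  shows "arc (\<phi> \<circ> c)"
  unfolding arc_def
proof
  have "continuous_on (path_image c) \<phi>"
    using assms(2,3) continuous_on_subset unfolding homeomorphism_def by blast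
  then show "path (\<phi> \<circ> c)"
    using assms(1) by (intro path_continuous_image) (simp add: arc_imp_path)
  have "inj_on \<phi> A"
    using homeomorphism_apply1[OF assms(3)] by (rule inj_on_inverseI)
  then have "inj_on \<phi> (c ` {0..1})"
    using assms(2) unfolding path_image_def by (rule inj_on_subset)
  then show "inj_on (\<phi> \<circ> c) {0..1}"
    using arc_imp_inj_on[OF assms(1)] by (rule comp_inj_on[rotated])
qed

text \<open>Stereographic projection from \<open>w\<close>. The plane is taken to be
  \<open>complex\<close>, where the Jordan curve theorem is applied.\<close>

lemma punctured_sphere_homeomorphism:
  fixes w :: "real^3"
  assumes "w \<in> sphere 0 1"
  obtains \<phi> :: "real^3 \<Rightarrow> complex" and \<psi> where "homeomorphism (sphere 0 1 - {w}) UNIV \<phi> \<psi>"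
proof -
  have "rel_frontier (cball (0::real^3) 1) = sphere 0 1"
    by (simp add: rel_frontier_nonempty_interior)
  moreover have "rel_frontier (cball (0::real^3) 1) - {w} homeomorphic (UNIV :: complex set)"
    using assms calculation
    by (intro homeomorphic_punctured_sphere_affine_gen) (auto simp: aff_dim_cball)
  ultimately show ?thesis
    using that unfolding homeomorphic_def by auto
qed

text \<open>Projection from \<open>t\<close> sends \<open>t\<close> to infinity, so \<open>T\<close>
  is the bounded side of a Jordan curve. It is described as a clopen part of the complement because
  a connected set avoiding the curve is then either inside \<open>T\<close> or disjoint from
  it.\<close>

lemma sphere_simple_closed_curve_region:
  fixes c d :: "real \<Rightarrow> real^3"
  assumes c: "arc c" "path_image c \<subseteq> sphere 0 1" "pathstart c = a" "pathfinish c = b"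
    and d: "arc d" "path_image d \<subseteq> sphere 0 1" "pathstart d = a" "pathfinish d = b"
    and cd: "path_image c \<inter> path_image d = {a, b}"
    and t: "t \<in> sphere 0 1" "t \<notin> path_image c \<union> path_image d"
  obtains w T where "w \<in> T" "t \<notin> T"
    "openin (top_of_set (sphere 0 1 - (path_image c \<union> path_image d))) T"
    "closedin (top_of_set (sphere 0 1 - (path_image c \<union> path_image d))) T"
proof -
  let ?S = "sphere 0 1 :: (real^3) set"
  let ?C = "path_image c \<union> path_image d"
  obtain \<phi> :: "real^3 \<Rightarrow> complex" and \<psi> where h: "homeomorphism (?S - {t}) UNIV \<phi> \<psi>"
    using punctured_sphere_homeomorphism[OF t(1)] .
  have C: "?C \<subseteq> ?S - {t}" using c d t by auto
  let ?g = "(\<phi> \<circ> c) +++ reversepath (\<phi> \<circ> d)"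
  have \<phi>\<psi>: "\<phi> (\<psi> z) = z" "\<psi> z \<in> ?S - {t}" for z
    using h unfolding homeomorphism_def by blast+
  have \<psi>\<phi>: "\<psi> (\<phi> x) = x" if "x \<in> ?S - {t}" for x
    using homeomorphism_apply1[OF h that] .
  have inj: "inj_on \<phi> (?S - {t})" using \<psi>\<phi> by (rule inj_on_inverseI)
  have cont: "continuous_on (?S - {t}) \<phi>" using h by (simp add: homeomorphism_def)
  have cont': "continuous_on UNIV \<psi>" using h by (simp add: homeomorphism_def)
  have ac: "arc (\<phi> \<circ> c)" "arc (\<phi> \<circ> d)"
    using c(1) d(1) C h by (auto intro: arc_homeomorphic_image)
  have img: "path_image ?g = \<phi> ` ?C"
    using c d by (simp add: path_image_join pathstart_compose pathfinish_compose path_image_compose image_Un)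
  have int: "path_image (\<phi> \<circ> c) \<inter> path_image (\<phi> \<circ> d) = {\<phi> a, \<phi> b}"
  proof -
    have "\<phi> ` path_image c \<inter> \<phi> ` path_image d = \<phi> ` (path_image c \<inter> path_image d)"
      using C by (intro inj_on_image_Int[OF inj, symmetric]) auto
    then show ?thesis using cd by (simp add: path_image_compose)
  qed
  have sp: "simple_path ?g"
    using ac int c d
    by (subst simple_path_join_loop_eq) (auto simp: arc_reversepath pathstart_compose pathfinish_compose)
  have cl: "pathfinish ?g = pathstart ?g" using c d by (simp add: pathstart_compose pathfinish_compose)
  define D where "D = inside (path_image ?g)"
  have D: "D \<noteq> {}" "open D" "bounded D" "D \<inter> outside (path_image ?g) = {}" "frontier D = path_image ?g"
    using Jordan_inside_outside[OF sp cl] by (auto simp: D_def)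
  have Dd: "D \<inter> path_image ?g = {}" by (simp add: D_def inside_no_overlap)
  have clD: "closure D = D \<union> \<phi> ` ?C"
    using D(5) img closure_Un_frontier by blast
  have T1: "\<psi> ` D = (?S - {t}) \<inter> \<phi> -` D"
    proof (intro equalityI subsetI)
      fix x assume "x \<in> (?S - {t}) \<inter> \<phi> -` D"
      then have "x = \<psi> (\<phi> x)" "\<phi> x \<in> D" using \<psi>\<phi> by auto
      then show "x \<in> \<psi> ` D" by (rule image_eqI)
    qed (use \<phi>\<psi> in auto)
  have "openin (top_of_set (?S - {t})) (\<psi> ` D)"
    unfolding T1 using cont D(2) by (rule continuous_openin_preimage_gen)
  then have op: "openin (top_of_set ?S) (\<psi> ` D)"
    by (rule openin_trans) (simp add: openin_delete)
  have dis: "\<psi> ` D \<inter> ?C = {}"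
  proof -
    have "\<psi> z \<notin> ?C" if "z \<in> D" for z
    proof
      assume "\<psi> z \<in> ?C"
      then have "\<phi> (\<psi> z) \<in> \<phi> ` ?C" by (rule imageI)
      then show False using that Dd unfolding \<phi>\<psi>(1) img by blast
    qed
    then show ?thesis by blast
  qed
  have sub: "\<psi> ` D \<subseteq> ?S - ?C" using T1 dis by auto
  have "\<psi> ` closure D = \<psi> ` D \<union> ?C"
  proof -
    have "\<psi> ` \<phi> ` ?C = ?C"
    proof -
      have "(\<lambda>x. \<psi> (\<phi> x)) ` ?C = (\<lambda>x. x) ` ?C"
        using C by (intro image_cong refl \<psi>\<phi>) blast
      then show ?thesis by (simp only: image_image image_ident)
    qed
    then show ?thesis by (simp add: clD image_Un)
  qed
  \<comment> \<open>Relative closedness: taking the compact closure of \<open>D\<close> adds only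
    points of the curve.\<close>
  then have "\<psi> ` D = (?S - ?C) \<inter> \<psi> ` closure D" using sub by auto
  moreover have "compact (\<psi> ` closure D)"
    using D(3) cont' by (intro compact_continuous_image) (auto intro: continuous_on_subset)
  ultimately have cls: "closedin (top_of_set (?S - ?C)) (\<psi> ` D)"
    using closedin_closed_Int[OF compact_imp_closed] by metis
  have op': "openin (top_of_set (?S - ?C)) (\<psi> ` D)"
    using op sub by (meson Diff_subset openin_subset_trans)
  show ?thesis
    using that[of _ "\<psi> ` D"] D(1) T1 op' cls by blast
qed

lemma connected_subset_clopen:
  assumes "connected C" "C \<subseteq> X" "openin (top_of_set X) T" "closedin (top_of_set X) T" "C \<inter> T \<noteq> {}"
  shows "C \<subseteq> T"
proof -
  have "openin (top_of_set C) (C \<inter> T)" "closedin (top_of_set C) (C \<inter> T)"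
    using assms(2-4) by (auto intro: openin_subtopology_Int_subset closedin_subtopology_Int_closedin
        simp: Int_commute openin_subtopology_Int2 closedin_closed openin_open)
  then show ?thesis
    using assms(1,5) connected_clopen by blast
qed

text \<open>With the puncture on the side of the closed curve \<open>g1\<close>, \<open>g2\<close>
  that does not contain \<open>t3\<close>, the arc \<open>g3\<close> becomes a chord of a Jordan
  disc and cuts it in two. As \<open>K\<close> accumulates at \<open>t3\<close>, it enters the disc
  and stays in one half. But \<open>t2\<close> is not in the closure of one half, and
  \<open>t1\<close> not in that of the other.\<close>

lemma theta_curve_sphere:
  fixes g1 g2 g3 :: "real \<Rightarrow> real^3"
  assumes g1: "arc g1" "path_image g1 \<subseteq> sphere 0 1" "pathstart g1 = u" "pathfinish g1 = v"
    and g2: "arc g2" "path_image g2 \<subseteq> sphere 0 1" "pathstart g2 = u" "pathfinish g2 = v"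
    and g3: "arc g3" "path_image g3 \<subseteq> sphere 0 1" "pathstart g3 = u" "pathfinish g3 = v"
    and g12: "path_image g1 \<inter> path_image g2 = {u, v}"
    and g13: "path_image g1 \<inter> path_image g3 = {u, v}"
    and g23: "path_image g2 \<inter> path_image g3 = {u, v}"
    and K: "connected K" "K \<subseteq> sphere 0 1" "K \<inter> (path_image g1 \<union> path_image g2 \<union> path_image g3) = {}"
    and t1: "t1 \<in> path_image g1 - {u, v}" "t1 \<in> closure K"
    and t2: "t2 \<in> path_image g2 - {u, v}" "t2 \<in> closure K"
    and t3: "t3 \<in> path_image g3 - {u, v}" "t3 \<in> closure K"
  shows False
proof -
  let ?S = "sphere 0 1 :: (real^3) set"
  let ?C = "path_image g1 \<union> path_image g2"
  let ?T = "path_image g1 \<union> path_image g2 \<union> path_image g3"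
  have t3C: "t3 \<in> ?S" "t3 \<notin> ?C" using t3 g3 g13 g23 by blast+
  obtain w T where w: "w \<in> T" "t3 \<notin> T"
    and T: "openin (top_of_set (?S - ?C)) T" "closedin (top_of_set (?S - ?C)) T"
    using sphere_simple_closed_curve_region[OF g1 g2 g12 t3C] .
  have TS: "T \<subseteq> ?S - ?C" using T(1) openin_imp_subset by blast
  \<comment> \<open>Otherwise the open arc \<open>g3\<close>, connected and disjoint from the other
    two arcs, would lie in \<open>T\<close> and bring \<open>t3\<close> with it.\<close>
  have "w \<notin> path_image g3"
  proof
    assume "w \<in> path_image g3"
    moreover have "connected (path_image g3 - {u, v})"
      using connected_simple_path_endless[OF arc_imp_simple_path[OF g3(1)]] g3 by simp
    moreover have "w \<notin> {u, v}" using w TS g12 by blast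
    moreover have "path_image g3 - {u, v} \<subseteq> ?S - ?C" using g3 g13 g23 by blast
    ultimately have "path_image g3 - {u, v} \<subseteq> T"
      using w by (intro connected_subset_clopen[OF _ _ T]) auto
    then show False using t3 w by blast
  qed
  then have wT: "w \<in> ?S" "w \<notin> ?T" using w TS by auto
  obtain \<phi> :: "real^3 \<Rightarrow> complex" and \<psi> where h: "homeomorphism (?S - {w}) UNIV \<phi> \<psi>"
    using punctured_sphere_homeomorphism[OF wT(1)] .
  have \<phi>\<psi>: "\<phi> (\<psi> z) = z" "\<psi> z \<in> ?S - {w}" for z
    using h unfolding homeomorphism_def by blast+
  have \<psi>\<phi>: "\<psi> (\<phi> x) = x" if "x \<in> ?S - {w}" for x
    using homeomorphism_apply1[OF h that] .
  have inj: "inj_on \<phi> (?S - {w})" using \<psi>\<phi> by (rule inj_on_inverseI)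
  have cont: "continuous_on (?S - {w}) \<phi>" using h by (simp add: homeomorphism_def)
  have cont': "continuous_on A \<psi>" for A
    using h continuous_on_subset by (auto simp: homeomorphism_def)
  have sub: "path_image g1 \<subseteq> ?S - {w}" "path_image g2 \<subseteq> ?S - {w}" "path_image g3 \<subseteq> ?S - {w}"
    "?C \<subseteq> ?S - {w}" "{u, v} \<subseteq> ?S - {w}"
    using g1(2) g2(2) g3(2) g12 wT by blast+
  have tS: "t1 \<in> ?S - {w}" "t2 \<in> ?S - {w}" "t3 \<in> ?S - {w}"
    using t1 t2 t3 sub by blast+
  define c1 c2 c3 where "c1 = \<phi> \<circ> g1" and "c2 = \<phi> \<circ> g2" and "c3 = \<phi> \<circ> g3"
  note c_def = c1_def c2_def c3_def
  have arcs: "arc c1" "arc c2" "arc c3"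
    using g1(1) g2(1) g3(1) sub h by (auto simp: c_def intro: arc_homeomorphic_image)
  have ends: "pathstart c1 = \<phi> u" "pathfinish c1 = \<phi> v" "pathstart c2 = \<phi> u" "pathfinish c2 = \<phi> v"
    "pathstart c3 = \<phi> u" "pathfinish c3 = \<phi> v"
    using g1 g2 g3 by (simp_all add: c_def pathstart_compose pathfinish_compose)
  have im: "path_image c1 = \<phi> ` path_image g1" "path_image c2 = \<phi> ` path_image g2"
    "path_image c3 = \<phi> ` path_image g3"
    by (simp_all add: c_def path_image_compose)
  have int: "path_image c1 \<inter> path_image c2 = {\<phi> u, \<phi> v}" "path_image c1 \<inter> path_image c3 = {\<phi> u, \<phi> v}"
    "path_image c2 \<inter> path_image c3 = {\<phi> u, \<phi> v}"
    unfolding im using g12 g13 g23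
    by (simp_all add: inj_on_image_Int[OF inj, symmetric] sub)
  have uv: "\<phi> u \<noteq> \<phi> v" using arc_distinct_ends[OF arcs(1)] ends by simp
  have loop: "simple_path (p +++ reversepath q)" "pathfinish (p +++ reversepath q) = pathstart (p +++ reversepath q)"
      "path_image (p +++ reversepath q) = path_image p \<union> path_image q"
    if "arc p" "arc q" "pathstart p = \<phi> u" "pathfinish p = \<phi> v" "pathstart q = \<phi> u" "pathfinish q = \<phi> v"
      "path_image p \<inter> path_image q = {\<phi> u, \<phi> v}" for p q
    using that by (simp_all add: simple_path_join_loop_eq arc_reversepath path_image_join)
  note J12 = Jordan_inside_outside[OF loop(1,2)[OF arcs(1,2) ends(1-4) int(1)], unfolded loop(3)[OF arcs(1,2) ends(1-4) int(1)]]
  note J13 = Jordan_inside_outside[OF loop(1,2)[OF arcs(1,3) ends(1,2,5,6) int(2)], unfolded loop(3)[OF arcs(1,3) ends(1,2,5,6) int(2)]]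
  note J23 = Jordan_inside_outside[OF loop(1,2)[OF arcs(2,3) ends(3-6) int(3)], unfolded loop(3)[OF arcs(2,3) ends(3-6) int(3)]]
  define D12 D13 D23 where "D12 = inside (path_image c1 \<union> path_image c2)"
    and "D13 = inside (path_image c1 \<union> path_image c3)" and "D23 = inside (path_image c2 \<union> path_image c3)"
  define Out where "Out = outside (path_image c1 \<union> path_image c2)"
  have Out: "connected Out" "\<not> bounded Out" "D12 \<inter> Out = {}" "D12 \<union> Out = - (path_image c1 \<union> path_image c2)"
    using J12 by (auto simp: Out_def D12_def)
  have D: "open D12" "open D13" "open D23" "bounded D12" "bounded D13" "bounded D23"
     "frontier D12 = path_image c1 \<union> path_image c2" "frontier D13 = path_image c1 \<union> path_image c3"
     "frontier D23 = path_image c2 \<union> path_image c3"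
    using J12 J13 J23 by (auto simp: D12_def D13_def D23_def)
  have pull_open: "openin (top_of_set ?S) (\<psi> ` A)" if "open A" for A
  proof -
    have "\<psi> ` A = (?S - {w}) \<inter> \<phi> -` A"
    proof (intro equalityI subsetI)
      fix x assume "x \<in> (?S - {w}) \<inter> \<phi> -` A"
      then have "x = \<psi> (\<phi> x)" "\<phi> x \<in> A" using \<psi>\<phi> by auto
      then show "x \<in> \<psi> ` A" by (rule image_eqI)
    qed (use \<phi>\<psi> in auto)
    then have "openin (top_of_set (?S - {w})) (\<psi> ` A)"
      using cont that by (simp add: continuous_openin_preimage_gen)
    then show ?thesis by (rule openin_trans) (simp add: openin_delete)
  qed
  have pull_closed: "closed (\<psi> ` closure A)" if "bounded A" for A
    using that cont' by (intro compact_imp_closed compact_continuous_image) auto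
  \<comment> \<open>If \<open>t3\<close> were mapped to the outside: the outside is unbounded, so
    its preimage \<open>Q\<close> accumulates at the puncture \<open>w\<close>. Then
    \<open>Q\<close> with \<open>w\<close> added is connected, hence contained in \<open>T\<close>,
    and \<open>t3\<close> would be in \<open>T\<close>.\<close>
  have inD: "\<phi> t3 \<in> D12"
  proof (rule ccontr)
    assume "\<phi> t3 \<notin> D12"
    moreover have "\<phi> t3 \<notin> path_image c1 \<union> path_image c2"
      unfolding im image_Un[symmetric] inj_on_image_mem_iff[OF inj tS(3) sub(4)] by (rule t3C(2))
    ultimately have "\<phi> t3 \<in> Out" using Out by blast
    define Q where "Q = \<psi> ` Out"
    have "connected Q" unfolding Q_def using Out cont' connected_continuous_image by blast
    moreover have "w \<in> closure Q"
    proof (rule ccontr)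
      assume "w \<notin> closure Q"
      moreover have QS: "Q \<subseteq> ?S" using \<phi>\<psi>(2) by (auto simp: Q_def)
      then have "closure Q \<subseteq> ?S" by (simp add: closure_minimal)
      ultimately have "closure Q \<subseteq> ?S - {w}" by blast
      moreover have "compact (closure Q)"
        using QS bounded_subset[OF bounded_sphere] by (simp add: compact_closure)
      ultimately have "compact (\<phi> ` closure Q)"
        using cont continuous_on_subset compact_continuous_image by blast
      moreover have "Out \<subseteq> \<phi> ` closure Q"
      proof
        fix z assume "z \<in> Out"
        then have "\<psi> z \<in> closure Q" using closure_subset[of Q] by (auto simp: Q_def)
        then show "z \<in> \<phi> ` closure Q" using \<phi>\<psi>(1)[of z] by (metis image_eqI)
      qed
      ultimately show False using Out(2) compact_imp_bounded bounded_subset by blast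
    qed
    ultimately have "connected (insert w Q)"
      using closure_subset[of Q] by (blast intro: connected_intermediate_closure[of Q])
    moreover have "insert w Q \<subseteq> ?S - ?C"
    proof -
      have "\<psi> z \<notin> ?C" if "z \<in> Out" for z
      proof
        assume "\<psi> z \<in> ?C"
        then have "\<phi> (\<psi> z) \<in> \<phi> ` ?C" by (rule imageI)
        then have "z \<in> path_image c1 \<union> path_image c2" unfolding \<phi>\<psi>(1) im by (simp add: image_Un)
        then show False using that Out(4) by blast
      qed
      then show ?thesis using \<phi>\<psi>(2) wT by (auto simp: Q_def)
    qed
    ultimately have "insert w Q \<subseteq> T" using w(1) by (intro connected_subset_clopen[OF _ _ T]) auto
    moreover have "t3 \<in> Q" 
      using imageI[OF \<open>\<phi> t3 \<in> Out\<close>, of \<psi>] unfolding Q_def \<psi>\<phi>[OF tS(3)] .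
    ultimately show False using w by blast
  qed
  obtain split: "D13 \<inter> D23 = {}" "D13 \<union> D23 \<union> (path_image c3 - {\<phi> u, \<phi> v}) = D12"
    using split_inside_simple_closed_curve[OF arc_imp_simple_path[OF arcs(1)] ends(1,2)
        arc_imp_simple_path[OF arcs(2)] ends(3,4) arc_imp_simple_path[OF arcs(3)] ends(5,6) uv int] inD t3 im(3)
    unfolding D12_def D13_def D23_def by blast
  have no: "D12 \<inter> (path_image c1 \<union> path_image c2) = {}"
     "D13 \<inter> (path_image c1 \<union> path_image c3) = {}" "D23 \<inter> (path_image c2 \<union> path_image c3) = {}"
    unfolding D12_def D13_def D23_def by (simp_all only: inside_no_overlap)
  have cl: "closure D12 = D12 \<union> path_image c1 \<union> path_image c2" "closure D13 = D13 \<union> path_image c1 \<union> path_image c3"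
    "closure D23 = D23 \<union> path_image c2 \<union> path_image c3"
    using D closure_Un_frontier by blast+
  have nin: "\<phi> t1 \<notin> closure D23" "\<phi> t2 \<notin> closure D13"
  proof -
    have "\<phi> t1 \<in> path_image c1 - {\<phi> u, \<phi> v}" "\<phi> t2 \<in> path_image c2 - {\<phi> u, \<phi> v}"
      using t1 t2 inj_on_image_mem_iff[OF inj tS(1) sub(5)] inj_on_image_mem_iff[OF inj tS(2) sub(5)]
      unfolding im by auto
    then show "\<phi> t1 \<notin> closure D23" "\<phi> t2 \<notin> closure D13"
      unfolding cl using split no int by blast+
  qed
  have KS: "K \<subseteq> ?S - ?T" using K by blast
  have avoid: False if "K \<subseteq> \<psi> ` closure A" "bounded A" "t \<in> closure K" "t \<in> ?S - {w}" "\<phi> t \<notin> closure A" for A t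
  proof -
    have "t \<in> \<psi> ` closure A"
      using closure_minimal[OF that(1) pull_closed[OF that(2)]] that(3) by blast
    then show False using that(5) \<phi>\<psi>(1) by auto
  qed
  have dis: "K \<subseteq> \<psi> ` closure D12 \<or> K \<inter> \<psi> ` D12 = {}"
  proof (cases "K \<inter> \<psi> ` D12 = {}")
    case False
    have eq: "\<psi> ` D12 - ?T = (?S - ?T) \<inter> \<psi> ` closure D12"
    proof -
      have "\<psi> ` (path_image c1 \<union> path_image c2) = ?C"
      proof -
        have "(\<lambda>x. \<psi> (\<phi> x)) ` ?C = (\<lambda>x. x) ` ?C"
          using sub(4) by (intro image_cong refl \<psi>\<phi>) blast
        then show ?thesis unfolding im image_Un[symmetric] by (simp only: image_image image_ident)
      qed
      then have "\<psi> ` closure D12 = \<psi> ` D12 \<union> ?C" unfolding cl by (simp add: image_Un Un_assoc)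
      then show ?thesis using \<phi>\<psi>(2) by blast
    qed
    have "closedin (top_of_set (?S - ?T)) (\<psi> ` D12 - ?T)"
      unfolding eq using closedin_closed_Int[OF pull_closed[OF D(4)]] .
    moreover have "openin (top_of_set (?S - ?T)) (\<psi> ` D12 - ?T)"
      using pull_open[OF D(1)] \<phi>\<psi>(2) unfolding openin_open by blast
    ultimately have "K \<subseteq> \<psi> ` D12 - ?T"
      using False K by (intro connected_subset_clopen[OF K(1) KS]) auto
    then show ?thesis using closure_subset by blast
  qed simp
  \<comment> \<open>The point \<open>t3\<close> lies both in the open disc and in the closure of
    \<open>K\<close>.\<close>
  have "K \<inter> \<psi> ` D12 \<noteq> {}"
  proof -
    obtain U where U: "open U" "\<psi> ` D12 = ?S \<inter> U"
      using pull_open[OF D(1)] unfolding openin_open by blast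
    have "t3 \<in> \<psi> ` D12" 
      using imageI[OF inD, of \<psi>] unfolding \<psi>\<phi>[OF tS(3)] .
    then have "U \<inter> closure K \<noteq> {}" using U t3(2) by blast
    then have "U \<inter> K \<noteq> {}" using open_Int_closure_eq_empty[OF U(1)] by blast
    then show ?thesis using U K by blast
  qed
  then have KD: "K \<subseteq> \<psi> ` closure D12" using dis by blast
  have KD': "K \<subseteq> \<psi> ` D13 \<union> \<psi> ` D23"
  proof
    fix x assume x: "x \<in> K"
    then obtain z where z: "x = \<psi> z" "z \<in> closure D12" using KD by blast
    have "z \<notin> path_image c1 \<union> path_image c2 \<union> path_image c3"
    proof
      assume "z \<in> path_image c1 \<union> path_image c2 \<union> path_image c3"
      then obtain y where y: "y \<in> ?T" "z = \<phi> y" unfolding im by blast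
      then have "x = y" using z(1) \<psi>\<phi>[of y] sub by blast
      then show False using y(1) x K(3) by blast
    qed
    then show "x \<in> \<psi> ` D13 \<union> \<psi> ` D23" using z split cl by blast
  qed
  obtain U V where U: "open U" "\<psi> ` D13 = ?S \<inter> U" and V: "open V" "\<psi> ` D23 = ?S \<inter> V"
    using pull_open[OF D(2)] pull_open[OF D(3)] unfolding openin_open by blast
  have "\<psi> ` D13 \<inter> \<psi> ` D23 = \<psi> ` (D13 \<inter> D23)"
    using \<phi>\<psi>(1) by (intro image_Int[symmetric] inj_on_inverseI[of _ \<phi>]) auto
  then have "U \<inter> V \<inter> K = {}" using split(1) U V K(2) by blast
  moreover have "K \<subseteq> U \<union> V" using KD' U V by blast
  ultimately have "U \<inter> K = {} \<or> V \<inter> K = {}" by (rule connectedD[OF K(1) U(1) V(1)])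
  then have "K \<subseteq> \<psi> ` D13 \<or> K \<subseteq> \<psi> ` D23" using KD' U V by blast
  then show False
    using avoid[of D13 t2] avoid[of D23 t1] nin D closure_subset[of D13] closure_subset[of D23] t1 t2 sub by blast
qed

section \<open>Stars attached to a theta curve\<close>

lemma arc_minus_finish:
  fixes c :: "real \<Rightarrow> 'a::t2_space"
  assumes "arc c"
  shows "connected (path_image c - {pathfinish c})" "pathfinish c \<in> closure (path_image c - {pathfinish c})"
    "pathstart c \<in> path_image c - {pathfinish c}"
proof -
  have cont: "continuous_on {0..1} c" and inj: "inj_on c {0..1}"
    using assms by (auto simp: arc_def path_def)
  have eq: "path_image c - {pathfinish c} = c ` {0..<1}"
  proof (intro equalityI subsetI)
    fix x assume x: "x \<in> path_image c - {pathfinish c}"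
    then obtain r where r: "r \<in> {0..1}" "x = c r" by (auto simp: path_image_def)
    moreover have "r \<noteq> 1" using x r by (auto simp: pathfinish_def)
    ultimately show "x \<in> c ` {0..<1}" by auto
  next
    fix x assume "x \<in> c ` {0..<1}"
    then obtain r where r: "r \<in> {0..<1}" "x = c r" by auto
    then have "c r \<noteq> c 1" using inj_onD[OF inj, of r 1] by auto
    then show "x \<in> path_image c - {pathfinish c}" using r by (auto simp: path_image_def pathfinish_def)
  qed
  show "connected (path_image c - {pathfinish c})"
    unfolding eq by (intro connected_continuous_image continuous_on_subset[OF cont]) auto
  have "c ` closure {0..<1} \<subseteq> closure (c ` {0..<1})"
    by (intro image_closure_subset closure_subset closed_closure) (use cont in simp)
  then show "pathfinish c \<in> closure (path_image c - {pathfinish c})"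
    unfolding eq by (auto simp: pathfinish_def)
  show "pathstart c \<in> path_image c - {pathfinish c}" using arc_distinct_ends[OF assms] by auto
qed

text \<open>For sets that touch only in the limit, such as a star without its tips and a curve that
  contains one of the tips.\<close>

lemma connected_Un_closure:
  assumes "closure A \<inter> B \<noteq> {}" "connected A" "connected B"
  shows "connected (A \<union> B)"
proof -
  obtain x where x: "x \<in> closure A" "x \<in> B" using assms(1) by blast
  have "connected (insert x A)"
    using x closure_subset[of A] by (blast intro: connected_intermediate_closure[OF assms(2)])
  then have "connected (insert x A \<union> B)" using assms(3) x by (intro connected_Un) auto
  then show ?thesis using x by (simp add: insert_absorb)
qed

text \<open>A theta curve seen as a drawing of K(2,3): path i leads from \<open>u\<close> through
  the middle vertex \<open>t i\<close> to \<open>v\<close>, and is cut at \<open>t i\<close> into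
  halves \<open>A i\<close> and \<open>B i\<close>, both directed towards \<open>t i\<close>. The
  points \<open>t i\<close> are those that a third vertex has to reach.\<close>

locale theta_arcs =
  fixes A B :: "nat \<Rightarrow> real \<Rightarrow> real^3" and u v :: "real^3" and t :: "nat \<Rightarrow> real^3"
  assumes A: "\<And>i. i < 3 \<Longrightarrow> arc (A i) \<and> path_image (A i) \<subseteq> sphere 0 1 \<and> pathstart (A i) = u \<and> pathfinish (A i) = t i"
    and B: "\<And>i. i < 3 \<Longrightarrow> arc (B i) \<and> path_image (B i) \<subseteq> sphere 0 1 \<and> pathstart (B i) = v \<and> pathfinish (B i) = t i"
    and AB: "\<And>i. i < 3 \<Longrightarrow> path_image (A i) \<inter> path_image (B i) = {t i}"
    and disj: "\<And>i j. \<lbrakk>i < 3; j < 3; i \<noteq> j\<rbrakk> \<Longrightarrow> path_image (A i) \<inter> path_image (A j) = {u} \<and>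
        path_image (B i) \<inter> path_image (B j) = {v} \<and> path_image (A i) \<inter> path_image (B j) = {}"
begin

definition theta_image where "theta_image = (\<Union>i<3. path_image (A i) \<union> path_image (B i))"

lemma connected_touching_False:
  assumes K: "connected K" "K \<subseteq> sphere 0 1" "K \<inter> theta_image = {}"
    and t: "\<And>i. i < 3 \<Longrightarrow> t i \<in> closure K"
  shows False
proof -
  define g where "g = (\<lambda>i. A i +++ reversepath (B i))"
  have im: "path_image (g i) = path_image (A i) \<union> path_image (B i)" if "i < 3" for i
    using A[OF that] B[OF that] by (simp add: g_def path_image_join)
  have g: "arc (g i)" "path_image (g i) \<subseteq> sphere 0 1" "pathstart (g i) = u" "pathfinish (g i) = v" if "i < 3" for i
    using A[OF that] B[OF that] AB[OF that] unfolding im[OF that]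
    by (auto simp: g_def arc_reversepath intro!: arc_join)
  have ends: "u \<in> path_image (A i)" "t i \<in> path_image (A i)" "v \<in> path_image (B i)"
    "t i \<in> path_image (B i)" if "i < 3" for i
    using A[OF that] B[OF that] pathstart_in_path_image pathfinish_in_path_image by metis+
  have int: "path_image (g i) \<inter> path_image (g j) = {u, v}" if "i < 3" "j < 3" "i \<noteq> j" for i j
    unfolding im[OF that(1)] im[OF that(2)] using disj[OF that] disj[OF that(2,1)] that(3) by blast
  have tg: "t i \<in> path_image (g i) - {u, v}" if "i < 3" for i
  proof -
    have "t i \<noteq> u" "t i \<noteq> v" using arc_distinct_ends A[OF that] B[OF that] by metis+
    then show ?thesis using ends[OF that] im[OF that] by auto
  qed
  have "path_image (g i) \<subseteq> theta_image" if "i < 3" for i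
    using that by (auto simp: im theta_image_def)
  from this[of 0] this[of 1] this[of 2]
  have "K \<inter> (path_image (g 0) \<union> path_image (g 1) \<union> path_image (g 2)) = {}"
    using K(3) by (simp add: disjoint_iff subset_iff) blast
  then show False
    using theta_curve_sphere[OF g[of 0] g[of 1] g[of 2] int[of 0 1] int[of 0 2] int[of 1 2] K(1,2) _
        tg[of 0] t[of 0] tg[of 1] t[of 1] tg[of 2] t[of 2]] by simp
qed

text \<open>The three spokes at \<open>z\<close> without their tips form a connected set that avoids
  the theta curve and accumulates at every \<open>t i\<close>.\<close>

lemma no_K33_sphere:
  assumes Z: "\<And>i. i < 3 \<Longrightarrow> arc (Z i) \<and> path_image (Z i) \<subseteq> sphere 0 1 \<and> pathstart (Z i) = z \<and> pathfinish (Z i) = t i"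
    and ZT: "\<And>i. i < 3 \<Longrightarrow> path_image (Z i) \<inter> theta_image \<subseteq> {t i}"
  shows False
proof -
  define K where "K = (\<Union>i<3. path_image (Z i) - {t i})"
  have Z': "connected (path_image (Z i) - {t i})" "t i \<in> closure (path_image (Z i) - {t i})"
    "z \<in> path_image (Z i) - {t i}" if "i < 3" for i
    using arc_minus_finish[of "Z i"] Z[OF that] by auto
  have "connected K"
  proof -
    have "z \<in> (\<Inter>i<3. path_image (Z i) - {t i})" using Z'(3) by blast
    then show ?thesis unfolding K_def using Z'(1) by (intro connected_Union) blast+
  qed
  moreover have "K \<subseteq> sphere 0 1" using Z by (auto simp: K_def)
  moreover have "K \<inter> theta_image = {}"
    unfolding K_def using ZT by blast
  moreover have "t i \<in> closure K" if "i < 3" for i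
    using closure_mono[of "path_image (Z i) - {t i}" K] Z'(2)[OF that] that by (auto simp: K_def)
  ultimately show False by (rule connected_touching_False)
qed

text \<open>The sign \<open>s i\<close> tells whether spoke i ends on the theta curve or on its
  antipode. If all signs agree, the star at \<open>z\<close> or its antipode touches all three
  paths. If they differ, the star and its antipode both touch the antipodal theta curve, which joins
  them to one connected set, and each \<open>t i\<close> is approached by one of the two
  stars.\<close>

lemma no_balanced_K33_antipodal:
  fixes s :: "nat \<Rightarrow> real"
  assumes Z: "\<And>i. i < 3 \<Longrightarrow> arc (Z i) \<and> path_image (Z i) \<subseteq> sphere 0 1 \<and> pathstart (Z i) = z \<and> pathfinish (Z i) = s i *\<^sub>R t i"
    and s: "\<And>i. i < 3 \<Longrightarrow> s i = 1 \<or> s i = - 1"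
    and anti: "theta_image \<inter> uminus ` theta_image = {}"
    and ZT: "\<And>i. i < 3 \<Longrightarrow> path_image (Z i) \<inter> (theta_image \<union> uminus ` theta_image) \<subseteq> {s i *\<^sub>R t i}"
  shows False
proof -
  define K where "K = (\<Union>i<3. path_image (Z i) - {s i *\<^sub>R t i})"
  have Z': "connected (path_image (Z i) - {s i *\<^sub>R t i})" "s i *\<^sub>R t i \<in> closure (path_image (Z i) - {s i *\<^sub>R t i})"
    "z \<in> path_image (Z i) - {s i *\<^sub>R t i}" if "i < 3" for i
    using arc_minus_finish[of "Z i"] Z[OF that] by auto
  have K: "connected K"
  proof -
    have "z \<in> (\<Inter>i<3. path_image (Z i) - {s i *\<^sub>R t i})" using Z'(3) by blast
    then show ?thesis unfolding K_def using Z'(1) by (intro connected_Union) blast+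
  qed
  have clK: "s i *\<^sub>R t i \<in> closure K" if "i < 3" for i
    using closure_mono[of "path_image (Z i) - {s i *\<^sub>R t i}" K] Z'(2)[OF that] that by (auto simp: K_def)
  have neg: "connected (uminus ` X)" "closure (uminus ` X) = uminus ` closure X" if "connected X" for X :: "(real^3) set"
    using that by (auto intro!: connected_continuous_image continuous_intros closure_injective_linear_image[symmetric]
        simp: linear_iff inj_on_def)
  have KS: "K \<subseteq> sphere 0 1" using Z by (auto simp: K_def)
  have KT: "K \<inter> (theta_image \<union> uminus ` theta_image) = {}" unfolding K_def using ZT by blast
  have nK: "(uminus ` K) \<inter> theta_image = {}"
    using KT by (auto simp: disjoint_iff image_iff) (metis minus_minus)
  have nKc: "- (s i *\<^sub>R t i) \<in> closure (uminus ` K)" if "i < 3" for i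
    using neg(2)[OF K] clK[OF that] by auto
  have tT: "t i \<in> theta_image" if "i < 3" for i
    using A[OF that] pathfinish_in_path_image[of "A i"] that by (auto simp: theta_image_def)
  have TS: "theta_image \<subseteq> sphere 0 1" unfolding theta_image_def using A B by blast
  note main = connected_touching_False
  consider "\<forall>i<3. s i = 1" | "\<forall>i<3. s i = -1" | i j where "i < 3" "j < 3" "s i = 1" "s j = -1"
    using s by blast
  then show False
  proof cases
    case 1
    then show False using main[of K] K KS KT clK by fastforce
  next
    case 2
    have "uminus ` K \<subseteq> sphere 0 1" using KS by auto
    then show False using main[of "uminus ` K"] neg(1)[OF K] nK nKc 2 by fastforce
  next
    case (3 i j)
    have cT: "connected theta_image"
    proof -
      have "connected (path_image (A i) \<union> path_image (B i))" if "i < 3" for i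
        using A[OF that] B[OF that] AB[OF that]
        by (intro connected_Un connected_path_image) (auto simp: arc_imp_path)
      moreover have "u \<in> path_image (A i)" if "i < 3" for i
        using A[OF that] pathstart_in_path_image[of "A i"] by auto
      ultimately have "u \<in> (\<Inter>i<3. path_image (A i) \<union> path_image (B i))"
        and "\<And>X. X \<in> (\<lambda>i. path_image (A i) \<union> path_image (B i)) ` {..<3} \<Longrightarrow> connected X" by blast+
      then show ?thesis unfolding theta_image_def by (intro connected_Union) blast+
    qed
    define L where "L = K \<union> uminus ` theta_image"
    have "closure K \<inter> uminus ` theta_image \<noteq> {}"
      using clK[OF 3(2)] tT[OF 3(2)] 3(4) by auto
    then have L: "connected L"
      unfolding L_def by (intro connected_Un_closure K neg(1)[OF cT])
    define M where "M = uminus ` K \<union> uminus ` theta_image"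
    have "closure (uminus ` K) \<inter> uminus ` theta_image \<noteq> {}"
      using nKc[OF 3(1)] tT[OF 3(1)] 3(3) by auto
    then have M: "connected M"
      unfolding M_def by (intro connected_Un_closure neg(1)[OF K] neg(1)[OF cT])
    have "L \<inter> M \<noteq> {}" using tT[of 0] by (auto simp: L_def M_def)
    then have "connected (L \<union> M)" using L M by (rule connected_Un[rotated 2])
    moreover have "L \<union> M \<subseteq> sphere 0 1" using KS TS by (auto simp: L_def M_def)
    moreover have "(L \<union> M) \<inter> theta_image = {}" using nK KT anti by (auto simp: L_def M_def)
    moreover have "t i \<in> closure (L \<union> M)" if "i < 3" for i
    proof -
      have "t i \<in> closure K \<or> t i \<in> closure (uminus ` K)"
        using s[OF that] clK[OF that] nKc[OF that] by auto
      moreover have "K \<subseteq> L \<union> M" "uminus ` K \<subseteq> L \<union> M" by (auto simp: L_def M_def)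
      ultimately show ?thesis using closure_mono by blast
    qed
    ultimately show False by (rule main)
  qed
qed

end

section \<open>Antipodally symmetric drawings\<close>

text \<open>The last conjunct keeps the arc injective after antipodal points are identified: it is
  one of the two lifts of an arc in the projective plane.\<close>

definition lifted_arc :: "(real^3) set \<Rightarrow> real^3 \<Rightarrow> real^3 \<Rightarrow> (real \<Rightarrow> real^3) \<Rightarrow> bool" where
  "lifted_arc X p q h \<longleftrightarrow> arc h \<and> path_image h \<subseteq> X \<and> pathstart h = p \<and> pathfinish h = q \<and>
     path_image h \<inter> uminus ` path_image h = {}"

lemma lifted_arcD:
  assumes "lifted_arc X p q h"
  shows "arc h" "path_image h \<subseteq> X" "pathstart h = p" "pathfinish h = q"
    "path_image h \<inter> uminus ` path_image h = {}"
  using assms by (simp_all add: lifted_arc_def)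

text \<open>\<open>P\<close> chooses one of the two lifts of each vertex, and \<open>s\<close> is
  the sign of the edge with respect to this choice. \<open>S e\<close> stands for the full preimage
  of the drawn edge, both lifts included.\<close>

definition lifted_edge :: "('a set \<Rightarrow> (real^3) set) \<Rightarrow> ('a \<Rightarrow> real^3) \<Rightarrow> real \<Rightarrow> 'a \<Rightarrow> 'a \<Rightarrow> bool" where
  "lifted_edge S P s u v \<longleftrightarrow> (s = 1 \<or> s = -1) \<and> (\<exists>h. lifted_arc (S {u, v}) (P u) (s *\<^sub>R P v) h)"

lemma lifted_arc_scale:
  assumes h: "lifted_arc X p q h" and X: "uminus ` X \<subseteq> X" and c: "c = 1 \<or> c = -1"
  shows "lifted_arc X (c *\<^sub>R p) (c *\<^sub>R q) ((\<lambda>x. c *\<^sub>R x) \<circ> h)"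
proof -
  let ?g = "(\<lambda>x. c *\<^sub>R x) \<circ> h"
  note h = lifted_arcD[OF h]
  have "linear (\<lambda>x::real^3. c *\<^sub>R x)" "inj (\<lambda>x::real^3. c *\<^sub>R x)"
    using c by (auto simp: linear_iff scaleR_add_right inj_on_def)
  then have "arc ?g" using h(1) arc_linear_image_eq by blast
  moreover have im: "path_image ?g = path_image h \<or> path_image ?g = uminus ` path_image h"
    using c by (auto simp: path_image_compose)
  have "uminus ` path_image h \<subseteq> X" using h(2) X by blast
  then have "path_image ?g \<subseteq> X" using im h(2) by (elim disjE) simp_all
  moreover have "path_image ?g \<inter> uminus ` path_image ?g = {}"
    using im h(5) by (elim disjE) (simp_all add: image_image Int_commute)
  ultimately show ?thesis
    using h(3,4) by (simp add: lifted_arc_def pathstart_compose pathfinish_compose)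
qed

text \<open>Edges are symmetric point sets instead of arcs. No direction or lift is fixed in
  advance, and a path can later take the place of an edge as a union of such sets.\<close>

locale antipodal_drawing =
  fixes E :: "'a set set" and P :: "'a \<Rightarrow> real^3" and S :: "'a set \<Rightarrow> (real^3) set"
  assumes edge_sphere: "e \<in> E \<Longrightarrow> S e \<subseteq> sphere 0 1"
    and edge_uminus: "\<lbrakk>e \<in> E; x \<in> S e\<rbrakk> \<Longrightarrow> - x \<in> S e"
    and edge_meet: "\<lbrakk>e \<in> E; f \<in> E; e \<noteq> f; x \<in> S e; x \<in> S f\<rbrakk> \<Longrightarrow> \<exists>w\<in>e \<inter> f. x = P w \<or> x = - P w"
    and edge_lift: "\<lbrakk>{u, v} \<in> E; u \<noteq> v\<rbrakk> \<Longrightarrow> \<exists>s. lifted_edge S P s u v"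
begin

text \<open>Two edges share at most the two lifts of a common end, and a piece that contains the
  lift \<open>q\<close> misses the other one, being disjoint from its own antipode.\<close>

lemma pieces_meet:
  assumes "e \<in> E" "f \<in> E" "e \<noteq> f" "e \<inter> f \<subseteq> {w}" "J \<subseteq> S e" "J' \<subseteq> S f"
    and "q \<in> J" "q = P w \<or> q = - P w" "J \<inter> uminus ` J = {}"
  shows "J \<inter> J' \<subseteq> {q}"
proof
  fix x assume x: "x \<in> J \<inter> J'"
  then have "x = P w \<or> x = - P w" using edge_meet[of e f x] assms by blast
  then have "x = q \<or> x = - q" using assms(8) by auto
  moreover have "x \<noteq> - q" using x assms(7,9) by force
  ultimately show "x \<in> {q}" by simp
qed

lemma pieces_disjoint:
  assumes "e \<in> E" "f \<in> E" "e \<inter> f = {}" "e \<noteq> f" "J \<subseteq> S e" "J' \<subseteq> S f"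
  shows "J \<inter> J' = {}"
  using edge_meet[of e f] assms by blast

lemma uminus_piece:
  assumes "e \<in> E" "J \<subseteq> S e"
  shows "uminus ` J \<subseteq> S e"
  using edge_uminus[OF assms(1)] assms(2) by blast

text \<open>By \<open>pieces_meet\<close> only \<open>q\<close> could be common; but
  \<open>q\<close> is in \<open>J'\<close>, so it is not in the antipode of
  \<open>J'\<close>.\<close>

lemma pieces_antipodal:
  assumes "e \<in> E" "f \<in> E" "e \<noteq> f" "e \<inter> f \<subseteq> {w}" "J \<subseteq> S e" "J' \<subseteq> S f"
    and "q \<in> J" "q \<in> J'" "q = P w \<or> q = - P w" "J \<inter> uminus ` J = {}" "J' \<inter> uminus ` J' = {}"
  shows "J \<inter> uminus ` J' = {}"
proof -
  have "J \<inter> uminus ` J' \<subseteq> {q}"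
    using assms by (intro pieces_meet[of e f w J] uminus_piece)
  moreover have "q \<notin> uminus ` J'" using assms(8,11) by blast
  ultimately show ?thesis by blast
qed

lemma lifted_star:
  fixes t :: "nat \<Rightarrow> 'a" and n :: nat
  assumes E: "\<And>i. i < n \<Longrightarrow> {x, t i} \<in> E" and l: "\<And>i. i < n \<Longrightarrow> lifted_edge S P (s i) x (t i)"
    and c: "c = 1 \<or> c = -1"
  obtains A where "\<forall>i<n. lifted_arc (S {x, t i}) (c *\<^sub>R P x) (c *\<^sub>R s i *\<^sub>R P (t i)) (A i)"
proof -
  have "\<exists>h. lifted_arc (S {x, t i}) (c *\<^sub>R P x) (c *\<^sub>R s i *\<^sub>R P (t i)) h" if i: "i < n" for i
    using l[OF i] lifted_arc_scale[OF _ uminus_piece[OF E[OF i] subset_refl] c] unfolding lifted_edge_def by blast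
  then show ?thesis using that by metis
qed

text \<open>A theta graph all of whose cycles lift to closed curves lifts to two disjoint copies,
  exchanged by the antipodal map. The three edges at z then connect one copy, possibly via the
  other one, to a set that touches all three of its paths.\<close>

lemma balanced_theta_spokes_False:
  fixes t :: "nat \<Rightarrow> 'a"
  assumes xyz: "x \<noteq> y" "x \<noteq> z" "y \<noteq> z"
    and t: "\<And>i. i < 3 \<Longrightarrow> t i \<noteq> x \<and> t i \<noteq> y \<and> t i \<noteq> z"
    and inj: "\<And>i j. \<lbrakk>i < 3; j < 3; i \<noteq> j\<rbrakk> \<Longrightarrow> t i \<noteq> t j"
    and E: "\<And>i. i < 3 \<Longrightarrow> {x, t i} \<in> E \<and> {y, t i} \<in> E \<and> {z, t i} \<in> E"
    and lx: "\<And>i. i < 3 \<Longrightarrow> lifted_edge S P (\<sigma> i) x (t i)"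
    and ly: "\<And>i. i < 3 \<Longrightarrow> lifted_edge S P (c * \<sigma> i) y (t i)"
  shows False
proof -
  have \<sigma>: "\<sigma> i = 1 \<or> \<sigma> i = -1" if "i < 3" for i
    using lx[OF that] by (simp add: lifted_edge_def)
  have c: "c = 1 \<or> c = -1"
    using \<sigma>[of 0] ly[of 0] by (auto simp: lifted_edge_def)
  have "\<forall>i\<in>{..<3}. \<exists>\<rho>. lifted_edge S P \<rho> z (t i)" using edge_lift E t by fastforce
  then obtain \<rho> where lz: "\<And>i. i < 3 \<Longrightarrow> lifted_edge S P (\<rho> i) z (t i)"
    unfolding bchoice_iff by auto
  have \<rho>: "\<rho> i = 1 \<or> \<rho> i = -1" if "i < 3" for i
    using lz[OF that] by (simp add: lifted_edge_def)
  obtain A where "\<forall>i<3. lifted_arc (S {x, t i}) (1 *\<^sub>R P x) (1 *\<^sub>R \<sigma> i *\<^sub>R P (t i)) (A i)"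
    by (rule lifted_star[of 3 x t \<sigma> 1]) (use E lx in auto)
  then have "lifted_arc (S {x, t i}) (P x) (\<sigma> i *\<^sub>R P (t i)) (A i)" if "i < 3" for i using that by simp
  note A = lifted_arcD[OF this]
  \<comment> \<open>The signs at \<open>y\<close> are \<open>c * \<sigma> i\<close>. Starting at the
    lift \<open>c *\<^sub>R P y\<close> makes these arcs end at the same lifts of the
    \<open>t i\<close> as the arcs from \<open>x\<close>.\<close>
  obtain B where "\<forall>i<3. lifted_arc (S {y, t i}) (c *\<^sub>R P y) (c *\<^sub>R (c * \<sigma> i) *\<^sub>R P (t i)) (B i)"
    by (rule lifted_star[of 3 y t "\<lambda>i. c * \<sigma> i" c]) (use E ly c in auto)
  moreover have "c * (c * a) = a" for a using c by auto
  ultimately have "lifted_arc (S {y, t i}) (c *\<^sub>R P y) (\<sigma> i *\<^sub>R P (t i)) (B i)" if "i < 3" for i using that by simp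
  note B = lifted_arcD[OF this]
  obtain Z where "\<forall>i<3. lifted_arc (S {z, t i}) (1 *\<^sub>R P z) (1 *\<^sub>R \<rho> i *\<^sub>R P (t i)) (Z i)"
    by (rule lifted_star[of 3 z t \<rho> 1]) (use E lz in auto)
  then have "lifted_arc (S {z, t i}) (P z) (\<rho> i *\<^sub>R P (t i)) (Z i)" if "i < 3" for i using that by simp
  note Z = lifted_arcD[OF this]
  \<comment> \<open>\<open>T i\<close> is the lift of \<open>t i\<close> where the two halves of
    path i meet, and \<open>s i\<close> is the sign of spoke i relative to this lift.\<close>
  define T where "T i = \<sigma> i *\<^sub>R P (t i)" for i
  define s where "s i = \<rho> i * \<sigma> i" for i
  have s: "s i = 1 \<or> s i = -1" "\<rho> i *\<^sub>R P (t i) = s i *\<^sub>R T i" if "i < 3" for i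
    using \<sigma>[OF that] \<rho>[OF that] by (auto simp: s_def T_def)
  have TP: "T i = P (t i) \<or> T i = - P (t i)" "s i *\<^sub>R T i = P (t i) \<or> s i *\<^sub>R T i = - P (t i)" if "i < 3" for i
    using \<sigma>[OF that] s[OF that] by (auto simp: T_def)
  have cP: "c *\<^sub>R P y = P y \<or> c *\<^sub>R P y = - P y" using c by auto
  have ends: "P x \<in> path_image (A i)" "T i \<in> path_image (A i)" "c *\<^sub>R P y \<in> path_image (B i)"
    "T i \<in> path_image (B i)" "s i *\<^sub>R T i \<in> path_image (Z i)" if "i < 3" for i
    using A(3,4)[OF that] B(3,4)[OF that] Z(4)[OF that] s(2)[OF that]
      pathstart_in_path_image pathfinish_in_path_image unfolding T_def by metis+
  have e: "{x, t i} \<in> E" "{y, t i} \<in> E" "{z, t i} \<in> E" if "i < 3" for i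
    using E[OF that] by auto
  have ne: "{x, t i} \<noteq> {y, t j}" "{x, t i} \<noteq> {z, t j}" "{y, t i} \<noteq> {z, t j}" if "i < 3" "j < 3" for i j
    using t[OF that(1)] t[OF that(2)] xyz by (auto simp: doubleton_eq_iff)
  have ne': "{w, t i} \<noteq> {w, t j}" if "i < 3" "j < 3" "i \<noteq> j" for i j w
    using inj[OF that] by (auto simp: doubleton_eq_iff)
  have sm: "{x, t i} \<inter> {y, t i} \<subseteq> {t i}" "{z, t i} \<inter> {x, t i} \<subseteq> {t i}" "{z, t i} \<inter> {y, t i} \<subseteq> {t i}" if "i < 3" for i
    using t[OF that] xyz by auto
  have sm': "{w, t i} \<inter> {w, t j} \<subseteq> {w}" if "i < 3" "j < 3" "i \<noteq> j" for i j w
    using inj[OF that] by auto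
  have dj: "{x, t i} \<inter> {y, t j} = {}" "{z, t i} \<inter> {x, t j} = {}" "{z, t i} \<inter> {y, t j} = {}" if "i < 3" "j < 3" "i \<noteq> j" for i j
    using inj[OF that] t[OF that(1)] t[OF that(2)] xyz by auto
  have AB: "path_image (A i) \<inter> path_image (B i) = {T i}" "path_image (A i) \<inter> uminus ` path_image (B i) = {}" if "i < 3" for i
    using pieces_meet[OF e(1,2)[OF that] ne(1)[OF that that] sm(1)[OF that] A(2)[OF that] B(2)[OF that] ends(2)[OF that] TP(1)[OF that] A(5)[OF that]]
      pieces_antipodal[OF e(1,2)[OF that] ne(1)[OF that that] sm(1)[OF that] A(2)[OF that] B(2)[OF that] ends(2,4)[OF that] TP(1)[OF that] A(5)[OF that] B(5)[OF that]]
      ends(2,4)[OF that] by blast+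
  have AA: "path_image (A i) \<inter> path_image (A j) = {P x}" "path_image (A i) \<inter> uminus ` path_image (A j) = {}" if "i < 3" "j < 3" "i \<noteq> j" for i j
    using pieces_meet[OF e(1)[OF that(1)] e(1)[OF that(2)] ne'[OF that] sm'[OF that] A(2)[OF that(1)] A(2)[OF that(2)] ends(1)[OF that(1)] _ A(5)[OF that(1)]]
      pieces_antipodal[OF e(1)[OF that(1)] e(1)[OF that(2)] ne'[OF that] sm'[OF that] A(2)[OF that(1)] A(2)[OF that(2)] ends(1)[OF that(1)] ends(1)[OF that(2)] _ A(5)[OF that(1)] A(5)[OF that(2)]]
      ends(1)[OF that(1)] ends(1)[OF that(2)] by blast+
  have BB: "path_image (B i) \<inter> path_image (B j) = {c *\<^sub>R P y}" "path_image (B i) \<inter> uminus ` path_image (B j) = {}" if "i < 3" "j < 3" "i \<noteq> j" for i j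
    using pieces_meet[OF e(2)[OF that(1)] e(2)[OF that(2)] ne'[OF that] sm'[OF that] B(2)[OF that(1)] B(2)[OF that(2)] ends(3)[OF that(1)] cP B(5)[OF that(1)]]
      pieces_antipodal[OF e(2)[OF that(1)] e(2)[OF that(2)] ne'[OF that] sm'[OF that] B(2)[OF that(1)] B(2)[OF that(2)] ends(3)[OF that(1)] ends(3)[OF that(2)] cP B(5)[OF that(1)] B(5)[OF that(2)]]
      ends(3)[OF that(1)] ends(3)[OF that(2)] by blast+
  have AB': "path_image (A i) \<inter> path_image (B j) = {}" "path_image (A i) \<inter> uminus ` path_image (B j) = {}" if "i < 3" "j < 3" "i \<noteq> j" for i j
    using pieces_disjoint[OF e(1)[OF that(1)] e(2)[OF that(2)] dj(1)[OF that] ne(1)[OF that(1,2)] A(2)[OF that(1)]]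
      B(2)[OF that(2)] uminus_piece[OF e(2) B(2)] that(2) by blast+
  define TT where "TT = (\<Union>i<3. path_image (A i) \<union> path_image (B i))"
  have neg: "X \<inter> uminus ` Y = {} \<longleftrightarrow> Y \<inter> uminus ` X = {}" for X Y :: "(real^3) set"
    by (force simp: disjoint_iff)
  have an: "(path_image (A i) \<union> path_image (B i)) \<inter> uminus ` (path_image (A j) \<union> path_image (B j)) = {}" if "i < 3" "j < 3" for i j
  proof (cases "i = j")
    case True
    then show ?thesis
      using A(5)[OF that(1)] B(5)[OF that(1)] AB(2)[OF that(1)] neg[of "path_image (A i)" "path_image (B i)"]
      by (simp add: image_Un Int_Un_distrib Int_Un_distrib2)
  next
    case False
    then show ?thesis
      using AA(2)[OF that False] BB(2)[OF that False] AB'(2)[OF that False] AB'(2)[OF that(2,1) False[symmetric]]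
        neg[of "path_image (A j)" "path_image (B i)"]
      by (simp add: image_Un Int_Un_distrib Int_Un_distrib2)
  qed
  have anti: "TT \<inter> uminus ` TT = {}" using an unfolding TT_def by blast
  have ZT: "path_image (Z i) \<inter> (TT \<union> uminus ` TT) \<subseteq> {s i *\<^sub>R T i}" if i: "i < 3" for i
  proof -
    \<comment> \<open>As \<open>S f\<close> is symmetric, a half path and its antipode are treated
      at once.\<close>
    have "path_image (Z i) \<inter> (D \<union> uminus ` D) \<subseteq> {s i *\<^sub>R T i}" if jD: "j < 3" "D = path_image (A j) \<or> D = path_image (B j)" for j D
    proof -
      obtain f where f: "f = {x, t j} \<or> f = {y, t j}" "D \<subseteq> S f" "f \<in> E"
        using jD A(2)[OF jD(1)] B(2)[OF jD(1)] e[OF jD(1)] by blast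
      have D: "D \<union> uminus ` D \<subseteq> S f" using f uminus_piece by blast
      show ?thesis
      proof (cases "i = j")
        case True
        show ?thesis
          using f(1) sm(2,3)[OF i] ne(2,3)[OF i i] ends(5)[OF i] TP(2)[OF i] True
          by (intro pieces_meet[OF e(3)[OF i] f(3) _ _ Z(2)[OF i] D _ _ Z(5)[OF i], where w = "t i"]) auto
      next
        case False
        have "path_image (Z i) \<inter> (D \<union> uminus ` D) = {}"
          using f(1) dj(2,3)[OF i that(1) False] ne(2,3)[OF that(1) i]
          by (intro pieces_disjoint[OF e(3)[OF i] f(3) _ _ Z(2)[OF i] D]) auto
        then show ?thesis by simp
      qed
    qed
    then show ?thesis unfolding TT_def by blast
  qed
  have sph: "path_image (A i) \<subseteq> sphere 0 1" "path_image (B i) \<subseteq> sphere 0 1" "path_image (Z i) \<subseteq> sphere 0 1" if "i < 3" for i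
    using A(2)[OF that] B(2)[OF that] Z(2)[OF that] e[OF that] edge_sphere by blast+
  interpret theta_arcs A B "P x" "c *\<^sub>R P y" T
    by unfold_locales (use A B sph AB AA BB AB' in \<open>simp_all add: T_def[symmetric]\<close>)
  show False
    by (rule no_balanced_K33_antipodal[of Z "P z" s])
      (use Z s anti ZT sph in \<open>simp_all add: TT_def theta_image_def\<close>)
qed

end

text \<open>The reversed arc runs from \<open>s *\<^sub>R P v\<close> to \<open>P u\<close>.
  Multiplication by \<open>s\<close> moves its start to \<open>P v\<close> and its end to
  \<open>s *\<^sub>R P u\<close>, so the sign is independent of the direction.\<close>

lemma lifted_edge_commute:
  assumes "lifted_edge S P s u v" "uminus ` S {u, v} \<subseteq> S {u, v}"
  shows "lifted_edge S P s v u"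
proof -
  obtain h where "lifted_arc (S {u, v}) (P u) (s *\<^sub>R P v) h" and s: "s = 1 \<or> s = -1"
    using assms(1) unfolding lifted_edge_def by blast
  then have "lifted_arc (S {u, v}) (s *\<^sub>R P v) (P u) (reversepath h)"
    by (simp add: lifted_arc_def arc_reversepath)
  from lifted_arc_scale[OF this assms(2) s]
  have "lifted_arc (S {v, u}) (s *\<^sub>R s *\<^sub>R P v) (s *\<^sub>R P u) ((\<lambda>x. s *\<^sub>R x) \<circ> reversepath h)"
    by (simp only: insert_commute)
  moreover have "s *\<^sub>R s *\<^sub>R P v = P v" using s by auto
  ultimately have "lifted_arc (S {v, u}) (P v) (s *\<^sub>R P u) ((\<lambda>x. s *\<^sub>R x) \<circ> reversepath h)"
    by simp
  then show ?thesis using s unfolding lifted_edge_def by blast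
qed

section \<open>Signs of paths and the excluded complete graphs\<close>

context antipodal_drawing
begin

lemma lifted_edge_sym:
  assumes "lifted_edge S P s u v" "{u, v} \<in> E"
  shows "lifted_edge S P s v u"
  using lifted_edge_commute[OF assms(1) uminus_piece[OF assms(2) subset_refl]] .

text \<open>Signs multiply along a path: the lift of the second edge that continues the first one
  starts at \<open>s *\<^sub>R P w\<close>.\<close>

lemma lifted_edge_trans:
  assumes "lifted_edge S P s u w" "lifted_edge S P r w v" "{u, w} \<in> E" "{w, v} \<in> E" "u \<noteq> v" "u \<noteq> w" "v \<noteq> w"
  shows "lifted_edge (S({u, v} := S {u, w} \<union> S {w, v})) P (s * r) u v"
proof -
  obtain h where "lifted_arc (S {u, w}) (P u) (s *\<^sub>R P w) h" and s: "s = 1 \<or> s = -1"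
    using assms(1) unfolding lifted_edge_def by blast
  note h = lifted_arcD[OF this(1)]
  obtain g where g: "lifted_arc (S {w, v}) (P w) (r *\<^sub>R P v) g" and r: "r = 1 \<or> r = -1"
    using assms(2) unfolding lifted_edge_def by blast
  let ?g = "(\<lambda>p. s *\<^sub>R p) \<circ> g"
  note g' = lifted_arcD[OF lifted_arc_scale[OF g uminus_piece[OF assms(4) subset_refl] s]]
  have q: "s *\<^sub>R P w \<in> path_image h" "s *\<^sub>R P w \<in> path_image ?g"
    using h(4) g'(3) pathfinish_in_path_image pathstart_in_path_image by metis+
  have qP: "s *\<^sub>R P w = P w \<or> s *\<^sub>R P w = - P w" using s by auto
  have ne: "{u, w} \<noteq> {w, v}" "{u, w} \<inter> {w, v} \<subseteq> {w}" using assms by (auto simp: doubleton_eq_iff)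
  have int: "path_image h \<inter> path_image ?g \<subseteq> {s *\<^sub>R P w}"
    by (rule pieces_meet[OF assms(3,4) ne h(2) g'(2) q(1) qP h(5)])
  have an: "path_image h \<inter> uminus ` path_image ?g = {}"
    by (rule pieces_antipodal[OF assms(3,4) ne h(2) g'(2) q qP h(5) g'(5)])
  then have an': "path_image ?g \<inter> uminus ` path_image h = {}"
    by (force simp: disjoint_iff)
  have "arc (h +++ ?g)"
    using h(1,4) g'(1) g'(3) int by (intro arc_join) auto
  moreover have "path_image (h +++ ?g) = path_image h \<union> path_image ?g"
    using h(4) g'(3) by (simp add: path_image_join)
  moreover have "(path_image h \<union> path_image ?g) \<inter> uminus ` (path_image h \<union> path_image ?g) = {}"
    using h(5) g'(5) an an' by (simp add: image_Un Int_Un_distrib Int_Un_distrib2)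
  moreover have "path_image h \<union> path_image ?g \<subseteq> S {u, w} \<union> S {w, v}"
    using h(2) g'(2) by blast
  ultimately show ?thesis
    unfolding lifted_edge_def lifted_arc_def using s r h(3) g'(4)
    by (intro conjI exI[of _ "h +++ ?g"]) auto
qed

text \<open>Suppressing the middle vertex \<open>w\<close> of a path provides theta graphs whose
  paths have more than two edges. The edges in \<open>F\<close> avoid \<open>w\<close>, since an
  edge ending there would meet the new edge in a point that is not a lift of a common end; and
  \<open>{u, v}\<close> is not in \<open>F\<close> because its entry in \<open>S\<close> is
  overwritten.\<close>

lemma antipodal_drawing_smooth:
  assumes "lifted_edge S P s u w" "lifted_edge S P r w v" "{u, w} \<in> E" "{w, v} \<in> E" "u \<noteq> v" "u \<noteq> w" "v \<noteq> w"
    and F: "F \<subseteq> E" "\<And>e. e \<in> F \<Longrightarrow> w \<notin> e" "{u, v} \<notin> F"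
  shows "antipodal_drawing (insert {u, v} F) P (S({u, v} := S {u, w} \<union> S {w, v}))"
proof
  let ?S = "S({u, v} := S {u, w} \<union> S {w, v})"
  have F': "e \<noteq> {u, v}" "e \<in> E" "e \<noteq> {u, w}" "e \<noteq> {w, v}" if "e \<in> F" for e
    using F that by auto
  fix e assume e: "e \<in> insert {u, v} F"
  show "?S e \<subseteq> sphere 0 1"
    using e F' edge_sphere assms(3,4) by (cases "e = {u, v}") auto
  show "- x \<in> ?S e" if "x \<in> ?S e" for x
    using e F' that edge_uminus assms(3,4) by (cases "e = {u, v}") auto
  have new: "\<exists>w'\<in>{u, v} \<inter> f. x = P w' \<or> x = - P w'" if "f \<in> F" "x \<in> S {u, w} \<union> S {w, v}" "x \<in> S f" for f x
  proof -
    have "\<exists>w'\<in>({u, w} \<union> {w, v}) \<inter> f. x = P w' \<or> x = - P w'"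
      using edge_meet[OF assms(3) F'(2)[OF that(1)], of x] edge_meet[OF assms(4) F'(2)[OF that(1)], of x]
        F'(3,4)[OF that(1)] that by blast
    then show ?thesis using F(2)[OF that(1)] by auto
  qed
  show "\<exists>w\<in>e \<inter> f. x = P w \<or> x = - P w" if f: "f \<in> insert {u, v} F" "e \<noteq> f" "x \<in> ?S e" "x \<in> ?S f" for f x
  proof -
    consider "e = {u, v}" "f \<in> F" | "f = {u, v}" "e \<in> F" | "e \<in> F" "f \<in> F" "e \<noteq> {u, v}" "f \<noteq> {u, v}"
      using e f F(3) by blast
    then show ?thesis
    proof cases
      case 1
      then show ?thesis using new[of f x] f F'(1)[of f] by auto
    next
      case 2
      then have "\<exists>w'\<in>{u, v} \<inter> e. x = P w' \<or> x = - P w'" using new[of e x] f F'(1)[of e] by auto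
      then show ?thesis using 2 by blast
    next
      case 3
      then show ?thesis using edge_meet[of e f x] F' f by auto
    qed
  qed
next
  let ?S = "S({u, v} := S {u, w} \<union> S {w, v})"
  fix a b assume ab: "{a, b} \<in> insert {u, v} F" "a \<noteq> b"
  show "\<exists>s. lifted_edge ?S P s a b"
  proof (cases "{a, b} = {u, v}")
    case True
    have L: "lifted_edge ?S P (s * r) u v" by (rule lifted_edge_trans[OF assms(1-7)])
    moreover have "lifted_edge ?S P (s * r) v u"
      by (rule lifted_edge_commute[OF L]) (use edge_uminus[OF assms(3)] edge_uminus[OF assms(4)] in auto)
    moreover have "a = u \<and> b = v \<or> a = v \<and> b = u" using True by (auto simp: doubleton_eq_iff)
    ultimately show ?thesis by blast
  next
    case False
    then obtain s where "lifted_edge S P s a b" using ab edge_lift F(1) by blast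
    then have "lifted_edge ?S P s a b" using False unfolding lifted_edge_def by simp
    then show ?thesis by blast
  qed
qed

text \<open>Three of the five paths from x to y through T have the same sign.\<close>

lemma common_neighbours_False:
  assumes xy: "x \<noteq> y" and T: "5 \<le> card T" "x \<notin> T" "y \<notin> T"
    and E: "\<And>t. t \<in> T \<Longrightarrow> {x, t} \<in> E \<and> {y, t} \<in> E"
    and z: "\<And>T'. \<lbrakk>T' \<subseteq> T; card T' = 3\<rbrakk> \<Longrightarrow> \<exists>z. z \<notin> T' \<and> z \<noteq> x \<and> z \<noteq> y \<and> (\<forall>t\<in>T'. {z, t} \<in> E)"
  shows False
proof -
  have fin: "finite T" using T(1) card.infinite by fastforce
  have "\<forall>t\<in>T. \<exists>\<sigma>. lifted_edge S P \<sigma> x t" "\<forall>t\<in>T. \<exists>\<rho>. lifted_edge S P \<rho> y t"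
    using edge_lift E T by metis+
  then obtain \<sigma> \<rho> where \<sigma>: "\<And>t. t \<in> T \<Longrightarrow> lifted_edge S P (\<sigma> t) x t" and \<rho>: "\<And>t. t \<in> T \<Longrightarrow> lifted_edge S P (\<rho> t) y t"
    unfolding bchoice_iff by auto
  define c where "c t = \<rho> t * \<sigma> t" for t
  have sg: "\<sigma> t = 1 \<or> \<sigma> t = -1" "\<rho> t = 1 \<or> \<rho> t = -1" if "t \<in> T" for t
    using \<sigma>[OF that] \<rho>[OF that] by (auto simp: lifted_edge_def)
  have c: "c t = 1 \<or> c t = -1" "\<rho> t = c t * \<sigma> t" if "t \<in> T" for t
    using sg[OF that] by (auto simp: c_def)
  have "T = {t \<in> T. c t = 1} \<union> {t \<in> T. c t = -1}" using c(1) by auto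
  then have "5 \<le> card {t \<in> T. c t = 1} + card {t \<in> T. c t = -1}"
    using T(1) card_Un_le[of "{t \<in> T. c t = 1}" "{t \<in> T. c t = -1}"] by simp
  then have "3 \<le> card {t \<in> T. c t = 1} \<or> 3 \<le> card {t \<in> T. c t = -1}" by linarith
  then obtain k where "3 \<le> card {t \<in> T. c t = k}" by blast
  then obtain T' where T': "T' \<subseteq> {t \<in> T. c t = k}" "card T' = 3"
    by (rule obtain_subset_with_card_n)
  obtain z where z: "z \<notin> T'" "z \<noteq> x" "z \<noteq> y" "\<forall>t\<in>T'. {z, t} \<in> E" using z[of T'] T' by auto
  have "finite T'" using T' fin finite_subset by fastforce
  then obtain t where t: "bij_betw t {0..<3::nat} T'" using ex_bij_betw_nat_finite T'(2) by metis
  have tT: "t i \<in> T'" if "i < 3" for i using bij_betwE[OF t] that by auto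
  have inj: "t i \<noteq> t j" if "i < 3" "j < 3" "i \<noteq> j" for i j
    using bij_betw_imp_inj_on[OF t] that by (auto simp: inj_on_def)
  show False
  proof (rule balanced_theta_spokes_False[of x y z t "\<lambda>i. \<sigma> (t i)" k])
    fix i :: nat assume i: "i < 3"
    have "t i \<in> T" "c (t i) = k" using tT[OF i] T' by auto
    then show "lifted_edge S P (k * \<sigma> (t i)) y (t i)" "lifted_edge S P (\<sigma> (t i)) x (t i)"
      "{x, t i} \<in> E \<and> {y, t i} \<in> E \<and> {z, t i} \<in> E" "t i \<noteq> x \<and> t i \<noteq> y \<and> t i \<noteq> z"
      using \<rho> \<sigma> c(2) E z tT[OF i] T by metis+
  qed (use xy z inj in auto)
qed

text \<open>Two vertices of \<open>A\<close> are the ends of the five paths, the third one is the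
  centre of the spokes.\<close>

lemma no_K35:
  assumes "3 \<le> card A" "5 \<le> card B" "A \<inter> B = {}" "\<And>a b. \<lbrakk>a \<in> A; b \<in> B\<rbrakk> \<Longrightarrow> {a, b} \<in> E"
  shows False
proof -
  obtain A' where "A' \<subseteq> A" "card A' = 3" 
    using assms(1) by (rule obtain_subset_with_card_n)
  then obtain x y z where "{x, y, z} \<subseteq> A" "x \<noteq> y" "y \<noteq> z" "x \<noteq> z" by (auto simp: card_3_iff)
  then show False
    using assms by (intro common_neighbours_False[of x y B]) (auto intro!: exI[of _ z])
qed

text \<open>Any two vertices have five paths of length two between them. Three of these are used, so
  one of the two remaining middle vertices can be the centre of the spokes.\<close>

lemma no_K7:
  assumes "7 \<le> card A" "\<And>a b. \<lbrakk>a \<in> A; b \<in> A; a \<noteq> b\<rbrakk> \<Longrightarrow> {a, b} \<in> E"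
  shows False
proof -
  have fin: "finite A" using assms(1) card.infinite by fastforce
  obtain A' where A': "A' \<subseteq> A" "card A' = 2" 
    by (rule obtain_subset_with_card_n[of 2 A]) (use assms(1) in simp)
  then obtain x y where xy: "A' = {x, y}" "x \<noteq> y" by (auto simp: card_2_iff)
  have card: "5 \<le> card (A - {x, y})"
    using assms(1) A' xy fin by (simp add: card_Diff_subset)
  show False
  proof (rule common_neighbours_False[of x y "A - {x, y}"])
    fix T' assume T': "T' \<subseteq> A - {x, y}" "card T' = 3"
    then have "T' \<noteq> A - {x, y}" using card by auto
    then obtain z where "z \<in> A - {x, y}" "z \<notin> T'" using T' by blast
    then show "\<exists>z. z \<notin> T' \<and> z \<noteq> x \<and> z \<noteq> y \<and> (\<forall>t\<in>T'. {z, t} \<in> E)"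
      using T'(1) assms(2) by (intro exI[of _ z]) (auto simp: subset_iff)
  qed (use card xy A' assms(2) in auto)
qed

text \<open>Every pair of vertices a, a' on the left splits the right side into two pairs, according
  to the sign of the path a - b - a'. The third path of the balanced theta graph below is
  a2 - b4 - a3 - b3 - a1.\<close>

lemma no_K44:
  assumes "card A = 4" "card B = 4" "A \<inter> B = {}" "\<And>a b. \<lbrakk>a \<in> A; b \<in> B\<rbrakk> \<Longrightarrow> {a, b} \<in> E"
  shows False
proof -
  have "\<forall>a\<in>A. \<forall>b\<in>B. \<exists>\<sigma>. lifted_edge S P \<sigma> a b" using edge_lift assms(3,4) by blast
  then obtain \<sigma> where \<sigma>: "\<And>a b. \<lbrakk>a \<in> A; b \<in> B\<rbrakk> \<Longrightarrow> lifted_edge S P (\<sigma> a b) a b"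
    unfolding bchoice_iff by metis
  have sg: "\<sigma> a b = 1 \<or> \<sigma> a b = -1" if "a \<in> A" "b \<in> B" for a b
    using \<sigma>[OF that] by (simp add: lifted_edge_def)
  define c where "c a a' b = \<sigma> a b * \<sigma> a' b" for a a' b
  have c: "c a a' b = 1 \<or> c a a' b = -1" if "a \<in> A" "a' \<in> A" "b \<in> B" for a a' b
    using sg[OF that(1,3)] sg[OF that(2,3)] by (auto simp: c_def)
  obtain a1 a2 a3 a4 where A: "A = {a1, a2, a3, a4}" and da: "distinct [a1, a2, a3, a4]"
    using assms(1) by (auto simp: card_Suc_eq numeral_eq_Suc)
  \<comment> \<open>Three equal signs at one pair from \<open>A\<close> give a balanced theta graph,
    with any further vertex of \<open>A\<close> as centre.\<close>
  have split: False if "a \<in> A" "a' \<in> A" "a \<noteq> a'" "{b1, b2, b3} \<subseteq> B" "distinct [b1, b2, b3]"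
    "c a a' b1 = c a a' b2" "c a a' b1 = c a a' b3" for a a' b1 b2 b3
  proof -
    have "card {a, a'} < card A" using that assms(1) by simp
    then obtain z where z: "z \<in> A" "z \<noteq> a" "z \<noteq> a'"
      by (metis card_mono finite.emptyI finite_insert insert_iff leD subsetI)
    define t where "t i = [b1, b2, b3] ! i" for i
    have t: "t i \<in> B" "c a a' (t i) = c a a' b1" if "i < 3" for i
      using \<open>{b1, b2, b3} \<subseteq> B\<close> \<open>c a a' b1 = c a a' b2\<close> \<open>c a a' b1 = c a a' b3\<close> that
      by (auto simp: t_def less_Suc_eq numeral_3_eq_3)
    show False
    proof (rule balanced_theta_spokes_False[of a a' z t "\<lambda>i. \<sigma> a (t i)" "c a a' b1"])
      fix i :: nat assume i: "i < 3"
      have "\<sigma> a' (t i) = c a a' b1 * \<sigma> a (t i)"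
        using sg[OF \<open>a \<in> A\<close> t(1)[OF i]] t(2)[OF i] by (auto simp: c_def)
      then show "lifted_edge S P (c a a' b1 * \<sigma> a (t i)) a' (t i)"
        using \<sigma>[OF \<open>a' \<in> A\<close> t(1)[OF i]] by simp
      show "lifted_edge S P (\<sigma> a (t i)) a (t i)" using \<sigma>[OF \<open>a \<in> A\<close> t(1)[OF i]] .
      show "{a, t i} \<in> E \<and> {a', t i} \<in> E \<and> {z, t i} \<in> E" "t i \<noteq> a \<and> t i \<noteq> a' \<and> t i \<noteq> z"
        using assms(3,4) t(1)[OF i] that z by auto
    next
      fix i j :: nat assume "i < 3" "j < 3" "i \<noteq> j"
      then show "t i \<noteq> t j" using \<open>distinct [b1, b2, b3]\<close> unfolding t_def by (simp add: nth_eq_iff_index_eq)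
    qed (use that z in auto)
  qed
  \<comment> \<open>Four signs without three equal ones split two to two; the numbering puts
    \<open>b1\<close> and \<open>b2\<close> on the same side.\<close>
  obtain b1 b2 b3 b4 where B: "B = {b1, b2, b3, b4}" and db: "distinct [b1, b2, b3, b4]"
    and c12: "c a1 a2 b2 = c a1 a2 b1" "c a1 a2 b3 = - c a1 a2 b1" "c a1 a2 b4 = - c a1 a2 b1"
  proof -
    obtain d1 d2 d3 d4 where d: "B = {d1, d2, d3, d4}" "distinct [d1, d2, d3, d4]"
      using assms(2) by (auto simp: card_Suc_eq numeral_eq_Suc)
    have cc: "c a1 a2 d1 = 1 \<or> c a1 a2 d1 = -1" "c a1 a2 d2 = 1 \<or> c a1 a2 d2 = -1"
      "c a1 a2 d3 = 1 \<or> c a1 a2 d3 = -1" "c a1 a2 d4 = 1 \<or> c a1 a2 d4 = -1"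
      using c[of a1 a2] A d by auto
    have sp: "\<not> (c a1 a2 p = c a1 a2 q \<and> c a1 a2 p = c a1 a2 r)" if "{p, q, r} \<subseteq> B" "distinct [p, q, r]" for p q r
      using split[of a1 a2 p q r] that A da by auto
    consider "c a1 a2 d2 = c a1 a2 d1" | "c a1 a2 d3 = c a1 a2 d1" | "c a1 a2 d4 = c a1 a2 d1"
      using cc sp[of d2 d3 d4] d by auto
    then show ?thesis
    proof cases
      case 1
      then show ?thesis using that[of d1 d2 d3 d4] cc sp[of d1 d2 d3] sp[of d1 d2 d4] d by auto
    next
      case 2
      moreover have "{d1, d2, d3, d4} = {d1, d3, d2, d4}" by blast
      ultimately show ?thesis using that[of d1 d3 d2 d4] cc sp[of d1 d3 d2] sp[of d1 d3 d4] d by auto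
    next
      case 3
      moreover have "{d1, d2, d3, d4} = {d1, d4, d3, d2}" by blast
      ultimately show ?thesis using that[of d1 d4 d3 d2] cc sp[of d1 d4 d3] sp[of d1 d4 d2] d by auto
    qed
  qed
  have mul: "c a2 a3 b = c a1 a2 b * c a1 a3 b" if "b \<in> B" for b
    using sg[of a1 b] that A by (auto simp: c_def)
  \<comment> \<open>If these agreed, \<open>b1\<close> would have the opposite sign for the pair
    \<open>a1\<close>, \<open>a3\<close>, and the products \<open>c a2 a3\<close> would coincide on
    \<open>b1\<close>, \<open>b3\<close>, \<open>b4\<close>.\<close>
  have ne: "c a1 a3 b3 \<noteq> c a1 a3 b4"
  proof
    assume eq: "c a1 a3 b3 = c a1 a3 b4"
    have "c a1 a3 b1 \<noteq> c a1 a3 b3"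
      using split[of a1 a3 b3 b4 b1] A B da db eq by auto
    then have "c a1 a3 b1 = - c a1 a3 b3"
      using c[of a1 a3 b1] c[of a1 a3 b3] A B by auto
    then have "c a2 a3 b1 = c a2 a3 b3" "c a2 a3 b4 = c a2 a3 b3"
      using mul B c12 eq by auto
    then show False using split[of a2 a3 b1 b3 b4] A B da db by simp
  qed
  have AE: "{a, b} \<in> E" if "a \<in> {a1, a2, a3, a4}" "b \<in> {b1, b2, b3, b4}" for a b
    using that assms(4) A B by blast
  have AB: "a \<noteq> b" if "a \<in> {a1, a2, a3, a4}" "b \<in> {b1, b2, b3, b4}" for a b
    using that assms(3) A B by blast
  \<comment> \<open>The path b4 - a3 - b3 becomes an edge b4 b3, and then a2 - b4 - b3 takes the
    place of the edge a2 b3. This uses up a3 and b4; a4 is left as the centre.\<close>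
  define S1 where "S1 = S({b4, b3} := S {b4, a3} \<union> S {a3, b3})"
  define F1 where "F1 = {{a, b} |a b. a \<in> {a1, a2, a4} \<and> b \<in> {b1, b2, b3, b4}}"
  have l1: "lifted_edge S P (\<sigma> a3 b4) b4 a3" "lifted_edge S P (\<sigma> a3 b3) a3 b3"
    using \<sigma>[of a3 b4] \<sigma>[of a3 b3] lifted_edge_sym AE[of a3 b4] A B by auto
  have e1: "{b4, a3} \<in> E" "{a3, b3} \<in> E" using AE[of a3 b4] AE[of a3 b3] by (auto simp: insert_commute)
  have d1: "b4 \<noteq> b3" "b4 \<noteq> a3" "b3 \<noteq> a3" using db AB[of a3 b4] AB[of a3 b3] by auto
  have L1: "lifted_edge S1 P (\<sigma> a3 b4 * \<sigma> a3 b3) b4 b3"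
    unfolding S1_def by (rule lifted_edge_trans[OF l1 e1 d1])
  have F1: "F1 \<subseteq> E" "\<And>e. e \<in> F1 \<Longrightarrow> a3 \<notin> e" "{b4, b3} \<notin> F1"
  proof -
    have *: "{a, b} \<in> E \<and> a3 \<notin> {a, b} \<and> {b4, b3} \<noteq> {a, b}" if "a \<in> {a1, a2, a4}" "b \<in> {b1, b2, b3, b4}" for a b
      using that AE[of a b] AB[of a3 b] AB[of a b4] AB[of a b3] da by (simp add: doubleton_eq_iff) blast
    show "F1 \<subseteq> E" "\<And>e. e \<in> F1 \<Longrightarrow> a3 \<notin> e" "{b4, b3} \<notin> F1"
      unfolding F1_def using * by blast+
  qed
  interpret D1: antipodal_drawing "insert {b4, b3} F1" P S1
    unfolding S1_def by (rule antipodal_drawing_smooth[OF l1 e1 d1 F1])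
  define S2 where "S2 = S1({a2, b3} := S1 {a2, b4} \<union> S1 {b4, b3})"
  \<comment> \<open>The direct edge a2 b3 is dropped, as its entry now holds the path.\<close>
  define F2 where "F2 = {{a, b} |a b. a \<in> {a1, a2, a4} \<and> b \<in> {b1, b2, b3}} - {{a2, b3}}"
  have S1: "lifted_edge S1 P (\<sigma> a b) a b" if "a \<in> {a1, a2, a3, a4}" "b \<in> {b1, b2, b3, b4}" for a b
  proof -
    have "{a, b} \<noteq> {b4, b3}" using that AB[of a b4] AB[of a b3] by (auto simp: doubleton_eq_iff)
    then show ?thesis using \<sigma>[of a b] that A B unfolding lifted_edge_def S1_def by auto
  qed
  have e2: "{a2, b4} \<in> insert {b4, b3} F1" "{b4, b3} \<in> insert {b4, b3} F1" by (auto simp: F1_def)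
  have d2: "a2 \<noteq> b3" "a2 \<noteq> b4" "b3 \<noteq> b4" using db AB[of a2 b4] AB[of a2 b3] by auto
  have L2: "lifted_edge S2 P (\<sigma> a2 b4 * (\<sigma> a3 b4 * \<sigma> a3 b3)) a2 b3"
    unfolding S2_def by (rule D1.lifted_edge_trans[OF S1[of a2 b4] L1 e2 d2]) auto
  have F2: "F2 \<subseteq> insert {b4, b3} F1" "\<And>e. e \<in> F2 \<Longrightarrow> b4 \<notin> e" "{a2, b3} \<notin> F2"
  proof -
    show "F2 \<subseteq> insert {b4, b3} F1" "{a2, b3} \<notin> F2" unfolding F2_def F1_def by blast+
    have "b4 \<notin> {a, b}" if "a \<in> {a1, a2, a4}" "b \<in> {b1, b2, b3}" for a b
      using that AB[of a b4] db by auto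
    then show "b4 \<notin> e" if "e \<in> F2" for e using that unfolding F2_def by blast
  qed
  interpret D2: antipodal_drawing "insert {a2, b3} F2" P S2
    unfolding S2_def by (rule D1.antipodal_drawing_smooth[OF S1[of a2 b4] L1 e2 d2 F2]) auto
  have S2: "lifted_edge S2 P (\<sigma> a b) a b" if "a \<in> {a1, a2, a4}" "b \<in> {b1, b2, b3}" "a \<noteq> a2 \<or> b \<noteq> b3" for a b
  proof -
    have "{a, b} \<noteq> {a2, b3}" using that AB[of a b3] AB[of a2 b] by (auto simp: doubleton_eq_iff)
    then show ?thesis using S1[of a b] that unfolding lifted_edge_def S2_def by auto
  qed
  define t where "t i = [b1, b2, b3] ! i" for i
  have t: "t i \<in> {b1, b2, b3}" if "i < 3" for i
    using that by (auto simp: t_def less_Suc_eq numeral_3_eq_3)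
  have sgs: "\<sigma> a b = 1 \<or> \<sigma> a b = -1" if "a \<in> {a1, a2, a3, a4}" "b \<in> {b1, b2, b3, b4}" for a b
    using sg that A B by auto
  show False
  proof (rule D2.balanced_theta_spokes_False[of a1 a2 a4 t "\<lambda>i. \<sigma> a1 (t i)" "c a1 a2 b1"])
    fix i :: nat assume i: "i < 3"
    show "lifted_edge S2 P (\<sigma> a1 (t i)) a1 (t i)" using S2[of a1 "t i"] t[OF i] da by auto
    show "t i \<noteq> a1 \<and> t i \<noteq> a2 \<and> t i \<noteq> a4" using AB[of a1 "t i"] AB[of a2 "t i"] AB[of a4 "t i"] t[OF i] by auto
    show "{a1, t i} \<in> insert {a2, b3} F2 \<and> {a2, t i} \<in> insert {a2, b3} F2 \<and> {a4, t i} \<in> insert {a2, b3} F2"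
      using t[OF i] unfolding F2_def by blast
    consider "t i = b1" | "t i = b2" | "t i = b3" using t[OF i] by blast
    then show "lifted_edge S2 P (c a1 a2 b1 * \<sigma> a1 (t i)) a2 (t i)"
    proof cases
      case 1
      have "\<sigma> a2 b1 = c a1 a2 b1 * \<sigma> a1 b1" using sgs[of a1 b1] by (auto simp: c_def)
      then show ?thesis using S2[of a2 b1] 1 db by simp
    next
      case 2
      have "\<sigma> a2 b2 = c a1 a2 b1 * \<sigma> a1 b2" using sgs[of a1 b2] c12(1) by (auto simp: c_def)
      then show ?thesis using S2[of a2 b2] 2 db by simp
    next
      case 3
      \<comment> \<open>By \<open>ne\<close>, \<open>\<sigma> a3 b4 * \<sigma> a3 b3\<close> is
        minus \<open>\<sigma> a1 b4 * \<sigma> a1 b3\<close>, and minus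
        \<open>\<sigma> a1 b4 * \<sigma> a2 b4\<close> is \<open>c a1 a2 b1\<close>. So the detour
        flips the sign at \<open>b3\<close> to the one shared by \<open>b1\<close> and
        \<open>b2\<close>.\<close>
      have "c a1 a3 b3 * c a1 a3 b4 = -1"
        using ne c[of a1 a3 b3] c[of a1 a3 b4] A B by auto
      moreover have "c a1 a2 b1 = - (\<sigma> a1 b4 * \<sigma> a2 b4)" using c12(3) by (simp add: c_def)
      ultimately have "\<sigma> a2 b4 * (\<sigma> a3 b4 * \<sigma> a3 b3) = c a1 a2 b1 * \<sigma> a1 b3"
        using sgs[of a1 b3] sgs[of a1 b4] sgs[of a2 b4] sgs[of a3 b3] sgs[of a3 b4] by (auto simp: c_def)
      then show ?thesis using L2 3 by simp
    qed
  next
    fix i j :: nat assume "i < 3" "j < 3" "i \<noteq> j"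
    then show "t i \<noteq> t j" using db unfolding t_def by (auto simp: nth_eq_iff_index_eq less_Suc_eq numeral_3_eq_3)
  qed (use da in auto)
qed

end

section \<open>Lifting drawings from the projective plane\<close>

definition simple_graph :: "'a ugraph \<Rightarrow> bool" where
  "simple_graph = (\<lambda>(V, E). \<forall>e\<in>E. \<exists>u v. e = {u, v} \<and> u \<noteq> v \<and> u \<in> V \<and> v \<in> V)"

lemma embedded_edges_meet:
  assumes emb: "is_embedding (V, E) X p \<gamma>" and V: "\<And>e. e \<in> E \<Longrightarrow> e \<subseteq> V"
    and e: "e \<in> E" "f \<in> E" "e \<noteq> f" and x: "x \<in> \<gamma> e ` {0..1}" "x \<in> \<gamma> f ` {0..1}"
  shows "x \<in> p ` (e \<inter> f)"
proof -
  have I: "\<gamma> g ` {0..1} = p ` g \<union> \<gamma> g ` {0<..<1}" if "g \<in> E" for g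
  proof -
    have "{0..1::real} = {0, 1} \<union> {0<..<1}" by auto
    then have "\<gamma> g ` {0..1} = {\<gamma> g 0, \<gamma> g 1} \<union> \<gamma> g ` {0<..<1}" by (simp only: image_Un image_insert image_empty)
    moreover have "{\<gamma> g 0, \<gamma> g 1} = p ` g" using emb that by (simp add: is_embedding_def)
    ultimately show ?thesis by simp
  qed
  have ni: "\<gamma> g ` {0<..<1} \<inter> p ` V = {}" if "g \<in> E" for g
    using emb that by (simp add: is_embedding_def)
  have "\<gamma> e ` {0<..<1} \<inter> \<gamma> f ` {0<..<1} = {}"
    using emb e by (simp add: is_embedding_def)
  moreover have "p ` e \<subseteq> p ` V" "p ` f \<subseteq> p ` V" using V e by auto
  moreover have "x \<in> A \<inter> B" if "x \<in> A \<union> I" "x \<in> B \<union> J" "I \<inter> C = {}" "J \<inter> C = {}" "I \<inter> J = {}"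
    "A \<subseteq> C" "B \<subseteq> C" for A B C I J using that by blast
  ultimately have "x \<in> p ` e \<inter> p ` f"
    using x ni[OF e(1)] ni[OF e(2)] unfolding I[OF e(1)] I[OF e(2)] by presburger
  moreover have "inj_on p (e \<union> f)"
    using emb V[OF e(1)] V[OF e(2)] by (auto simp: is_embedding_def intro: inj_on_subset)
  ultimately show ?thesis by (metis inj_on_image_Int sup_ge1 sup_ge2)
qed

text \<open>An edge is a set, so its arc may run in either direction; reversal covers the second
  case.\<close>

lemma embedded_edge_oriented:
  assumes emb: "is_embedding (V, E) X p \<gamma>" and e: "{u, v} \<in> E"
  obtains g where "pathin X g" "inj_on g {0..1}" "g 0 = p u" "g 1 = p v" "g ` {0..1} = \<gamma> {u, v} ` {0..1}"
proof -
  let ?g = "\<gamma> {u, v}"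
  have g: "pathin X ?g" "inj_on ?g {0..1}" "{?g 0, ?g 1} = {p u, p v}"
    using emb e by (auto simp: is_embedding_def)
  show ?thesis
  proof (cases "?g 0 = p u \<and> ?g 1 = p v")
    case True
    then show ?thesis using that g by blast
  next
    case False
    then have *: "?g 0 = p v" "?g 1 = p u" using g(3) by (auto simp: doubleton_eq_iff)
    let ?r = "\<lambda>t::real. 1 - t"
    have im: "?r ` {0..1} = {0..1}" by (auto simp: image_iff intro!: bexI[of _ "1 - _"])
    have "continuous_map (top_of_set {0..1}) (top_of_set {0..1}) ?r"
      by (auto simp: continuous_map_in_subtopology intro!: continuous_intros)
    then have "pathin X (?g \<circ> ?r)"
      using g(1) unfolding pathin_def by (rule continuous_map_compose)
    moreover have "inj_on (?g \<circ> ?r) {0..1}"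
      by (rule comp_inj_on) (use g(2) im in \<open>auto simp: inj_on_def\<close>)
    moreover have "(?g \<circ> ?r) ` {0..1} = ?g ` {0..1}" by (simp only: image_comp[symmetric] im)
    ultimately show ?thesis using that[of "?g \<circ> ?r"] * by simp
  qed
qed

text \<open>A continuous injection keeps arcs simple, so edges in an abstract topology can be moved
  to a space where \<open>arc\<close> is defined.\<close>

lemma embedded_edge_arc:
  fixes \<phi> :: "'b \<Rightarrow> 'c::topological_space"
  assumes emb: "is_embedding (V, E) X p \<gamma>" and e: "{u, v} \<in> E"
    and \<phi>: "continuous_map X euclidean \<phi>" "inj_on \<phi> (topspace X)"
  obtains g where "arc g" "pathstart g = \<phi> (p u)" "pathfinish g = \<phi> (p v)"
    "path_image g = \<phi> ` \<gamma> {u, v} ` {0..1}"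
proof -
  obtain g where g: "pathin X g" "inj_on g {0..1}" "g 0 = p u" "g 1 = p v" "g ` {0..1} = \<gamma> {u, v} ` {0..1}"
    by (rule embedded_edge_oriented[OF emb e])
  have "continuous_map (top_of_set {0..1}) euclidean (\<phi> \<circ> g)"
    using g(1) \<phi>(1) unfolding pathin_def by (rule continuous_map_compose)
  moreover have "g ` {0..1} \<subseteq> topspace X"
    using g(1) continuous_map_image_subset_topspace unfolding pathin_def by force
  then have "inj_on (\<phi> \<circ> g) {0..1}"
    using g(2) \<phi>(2) by (metis comp_inj_on inj_on_subset)
  ultimately have "arc (\<phi> \<circ> g)" by (simp add: arc_def path_def)
  moreover have "path_image (\<phi> \<circ> g) = \<phi> ` \<gamma> {u, v} ` {0..1}"
    unfolding path_image_def image_comp[symmetric] g(5) ..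
  ultimately show ?thesis using that g(3,4) by (simp add: pathstart_def pathfinish_def)
qed

section \<open>The projective plane as a set of rank-one matrices\<close>

text \<open>For a unit vector this is the orthogonal projection onto its line. It identifies
  precisely antipodal unit vectors, and so places the projective plane in a Euclidean space, where
  coverings and path lifting are at hand.\<close>

definition outer :: "real^3 \<Rightarrow> real^3^3" where
  "outer x = (\<chi> i j. x $ i * x $ j)"

lemma outer_mult: "outer x *v y = (x \<bullet> y) *\<^sub>R x"
  by (simp add: outer_def matrix_vector_mult_def vec_eq_iff inner_vec_def sum_distrib_left ac_simps)

lemma outer_eq_iff:
  assumes "norm x = 1" "norm y = 1"
  shows "outer x = outer y \<longleftrightarrow> x = y \<or> x = - y"
proof
  assume "outer x = outer y"
  then have "(x \<bullet> x) *\<^sub>R x = (y \<bullet> x) *\<^sub>R y" by (metis outer_mult)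
  then have x: "x = (y \<bullet> x) *\<^sub>R y" using assms by (simp add: norm_eq_1)
  then have "\<bar>y \<bullet> x\<bar> = 1" using assms by (metis mult.right_neutral norm_scaleR)
  then have "y \<bullet> x = 1 \<or> y \<bullet> x = -1" by linarith
  then show "x = y \<or> x = - y" using x by (metis scaleR_minus1_left scaleR_one)
qed (auto simp: outer_def)

lemma continuous_on_outer: "continuous_on A outer"
  unfolding outer_def by (intro continuous_intros)

text \<open>Over the matrices \<open>N\<close> with \<open>a \<bullet> (N *v a) > 0\<close> the two
  sheets are the open hemispheres around \<open>a\<close> and \<open>- a\<close>. Since
  \<open>outer x *v a\<close> is a multiple of \<open>x\<close>, normalising \<open>N *v a\<close>,
  with the sign of the sheet, recovers \<open>x\<close>.\<close>

lemma covering_space_outer: "covering_space (sphere 0 1) outer (outer ` sphere 0 1)"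
  unfolding covering_space_def
proof (intro conjI ballI)
  show "continuous_on (sphere 0 1) outer" by (rule continuous_on_outer)
  fix M assume "M \<in> outer ` sphere 0 1"
  then obtain a where a: "norm a = 1" "M = outer a" by auto
  let ?T = "outer ` sphere 0 1 \<inter> {N. a \<bullet> (N *v a) > 0}"
  have val: "a \<bullet> (outer x *v a) = (x \<bullet> a)\<^sup>2" for x
    by (simp add: outer_mult power2_eq_square inner_commute)
  have cont: "continuous_on A (\<lambda>N::real^3^3. N *v a)" for A
    unfolding matrix_vector_mult_def by (intro continuous_intros)
  have "open {N::real^3^3. a \<bullet> (N *v a) > 0}"
    by (intro open_Collect_less continuous_intros cont)
  then have opT: "openin (top_of_set (outer ` sphere 0 1)) ?T" by (rule openin_open_Int)
  define U where "U = (\<lambda>s. {x \<in> sphere 0 1. s * (x \<bullet> a) > 0})"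
  have opU: "openin (top_of_set (sphere 0 1)) (U s)" for s
  proof -
    have "open {x. s * (x \<bullet> a) > 0}" by (intro open_Collect_less continuous_intros)
    then show ?thesis unfolding U_def Collect_conj_eq Collect_mem_eq by (rule openin_open_Int)
  qed
  have hom: "homeomorphism (U s) ?T outer (\<lambda>N. (s / norm (N *v a)) *\<^sub>R (N *v a))" if "s = 1 \<or> s = -1" for s
  proof -
    have inv: "(s / norm (outer x *v a)) *\<^sub>R (outer x *v a) = x" if "x \<in> U s" for x
    proof -
      have "s * (x \<bullet> a) = \<bar>x \<bullet> a\<bar>" "x \<bullet> a \<noteq> 0" "norm x = 1"
        using \<open>s = 1 \<or> s = -1\<close> that by (auto simp: U_def)
      then show ?thesis by (simp add: outer_mult field_simps)
    qed
    have im: "outer ` U s = ?T"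
    proof
      show "outer ` U s \<subseteq> ?T" by (auto simp: U_def val)
      show "?T \<subseteq> outer ` U s"
      proof
        fix N assume "N \<in> ?T"
        then obtain x where x: "N = outer x" "norm x = 1" "x \<bullet> a \<noteq> 0" using val by auto
        have "outer (- x) = outer x" by (simp add: outer_def)
        moreover have "x \<in> U s \<or> - x \<in> U s"
          using x that by (auto simp: U_def linorder_neq_iff)
        ultimately show "N \<in> outer ` U s" using x(1) by (metis imageI)
      qed
    qed
    have "norm (N *v a) \<noteq> 0" if "N \<in> ?T" for N using that by auto
    then have "continuous_on ?T (\<lambda>N. (s / norm (N *v a)) *\<^sub>R (N *v a))"
      by (intro continuous_intros cont) auto
    then show ?thesis
    proof (intro homeomorphismI continuous_on_outer)
      fix N assume "N \<in> ?T"
      then obtain x where x: "x \<in> U s" "N = outer x" using im by blast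
      then show "outer ((s / norm (N *v a)) *\<^sub>R (N *v a)) = N" using inv by simp
    next
      show "(\<lambda>N. (s / norm (N *v a)) *\<^sub>R (N *v a)) ` ?T \<subseteq> U s"
        unfolding im[symmetric] using inv by (simp add: image_subset_iff)
    qed (use inv im in auto)
  qed
  have "\<Union>{U 1, U (-1)} = sphere 0 1 \<inter> outer -` ?T"
    by (auto simp: U_def val linorder_neq_iff)
  moreover have "pairwise disjnt {U 1, U (-1)}"
    by (auto simp: pairwise_insert disjnt_def U_def)
  ultimately have "\<exists>v. \<Union>v = sphere 0 1 \<inter> outer -` ?T \<and> (\<forall>u\<in>v. openin (top_of_set (sphere 0 1)) u) \<and>
      pairwise disjnt v \<and> (\<forall>u\<in>v. \<exists>q. homeomorphism u ?T outer q)"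
    using opU hom by (intro exI[of _ "{U 1, U (-1)}"]) blast
  moreover have "M \<in> ?T" using a by (simp add: val norm_eq_1)
  ultimately show "\<exists>T. M \<in> T \<and> openin (top_of_set (outer ` sphere 0 1)) T \<and>
      (\<exists>v. \<Union>v = sphere 0 1 \<inter> outer -` T \<and> (\<forall>u\<in>v. openin (top_of_set (sphere 0 1)) u) \<and>
      pairwise disjnt v \<and> (\<forall>u\<in>v. \<exists>q. homeomorphism u T outer q))"
    using opT by (intro exI[of _ ?T] conjI)
qed simp

text \<open>The single cap is a hemisphere because its height is cos (pi / 2) = 0; what remains is a
  closed hemisphere.\<close>

lemma holed_sphere_1: "holed_sphere (Suc 0) = {x \<in> sphere 0 1. x \<bullet> cap_centre 1 0 \<le> 0}"
  by (simp add: holed_sphere_def cap_height_def)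

lemma crosscap_rel_1:
  "(x, y) \<in> crosscap_rel (Suc 0) \<longleftrightarrow> x \<in> holed_sphere (Suc 0) \<and> y \<in> holed_sphere (Suc 0) \<and>
     (x = y \<or> x \<bullet> cap_centre 1 0 = 0 \<and> y = - x)"
  by (simp add: crosscap_rel_def cap_height_def)

lemma topspace_crosscap_surface: "topspace (crosscap_surface k) = holed_sphere k // crosscap_rel k"
  by (simp add: crosscap_surface_def)

lemma quotient_map_crosscap_surface:
  "quotient_map (top_of_set (holed_sphere k)) (crosscap_surface k) (\<lambda>x. crosscap_rel k `` {x})"
  unfolding crosscap_surface_def by (rule quotient_map_quotient_topology)

text \<open>\<open>outer\<close> is constant on classes and so descends to the quotient. It
  separates classes: both points of an antipodal pair lie in the closed hemisphere only on the
  boundary circle, where they are identified.\<close>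

lemma projective_plane_outer:
  obtains \<phi> :: "(real^3) set \<Rightarrow> real^3^3" where
    "continuous_map (crosscap_surface 1) euclidean \<phi>" "inj_on \<phi> (topspace (crosscap_surface 1))"
    "\<phi> ` topspace (crosscap_surface 1) \<subseteq> outer ` sphere 0 1"
proof -
  let ?cl = "\<lambda>x. crosscap_rel 1 `` {x}"
  define \<phi> where "\<phi> C = outer (SOME x. x \<in> C)" for C :: "(real^3) set"
  have \<phi>: "\<phi> (?cl x) = outer x" if "x \<in> holed_sphere 1" for x
  proof -
    have "x \<in> ?cl x" using that by (simp add: crosscap_rel_1)
    then have "(SOME y. y \<in> ?cl x) \<in> ?cl x" by (rule someI)
    then show ?thesis
      using that by (auto simp: \<phi>_def crosscap_rel_1 outer_def)
  qed
  have sph: "norm x = 1" if "x \<in> holed_sphere 1" for x using that by (simp add: holed_sphere_1)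
  show ?thesis
  proof
    have "continuous_map (top_of_set (holed_sphere 1)) euclidean (\<phi> \<circ> ?cl)"
      by (rule continuous_map_eq[where f = outer]) (use \<phi> continuous_on_outer in auto)
    then show "continuous_map (crosscap_surface 1) euclidean \<phi>"
      by (rule continuous_compose_quotient_map[OF quotient_map_crosscap_surface])
    show "inj_on \<phi> (topspace (crosscap_surface 1))"
      unfolding topspace_crosscap_surface
    proof (rule inj_onI)
      fix C D assume "C \<in> holed_sphere 1 // crosscap_rel 1" "D \<in> holed_sphere 1 // crosscap_rel 1"
        and "\<phi> C = \<phi> D"
      moreover from calculation obtain x y where x: "x \<in> holed_sphere 1" "C = ?cl x" and y: "y \<in> holed_sphere 1" "D = ?cl y"
        unfolding quotient_def by blast
      ultimately have eq: "\<phi> (?cl x) = \<phi> (?cl y)" by simp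
      have "x = y \<or> x = - y" using eq \<phi> outer_eq_iff[of x y] sph x(1) y(1) by simp
      then have "(x, y) \<in> crosscap_rel 1" using x(1) y(1) by (auto simp: crosscap_rel_1 holed_sphere_1)
      then show "C = D" unfolding x(2) y(2) by (rule equiv_class_eq[OF equiv_crosscap_rel])
    qed
    show "\<phi> ` topspace (crosscap_surface 1) \<subseteq> outer ` sphere 0 1"
      unfolding topspace_crosscap_surface using \<phi> sph by (auto simp: quotient_def)
  qed
qed

text \<open>\<open>S e\<close> is the preimage of the drawn edge under the double cover, and path
  lifting yields one lift \<open>h\<close> of its arc. This lift avoids its antipode:
  \<open>h r = - h t\<close> would give two parameters with the same image, so \<open>r = t\<close>
  and \<open>h t = 0\<close>.\<close>

lemma projective_embedding_lifts:
  assumes emb: "embeddable_in (V, E) (crosscap_surface 1)" and G: "simple_graph (V, E)"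
  obtains P S where "antipodal_drawing E P S"
proof -
  obtain p \<gamma> where emb: "is_embedding (V, E) (crosscap_surface 1) p \<gamma>"
    using emb by (auto simp: embeddable_in_def)
  let ?X = "crosscap_surface 1"
  obtain \<phi> :: "(real^3) set \<Rightarrow> real^3^3" where \<phi>: "continuous_map ?X euclidean \<phi>" "inj_on \<phi> (topspace ?X)"
    "\<phi> ` topspace ?X \<subseteq> outer ` sphere 0 1" by (rule projective_plane_outer)
  have V: "e \<subseteq> V" if "e \<in> E" for e using G that by (auto simp: simple_graph_def)
  have p: "p ` V \<subseteq> topspace ?X" using emb by (simp add: is_embedding_def)
  then have "\<forall>v\<in>V. \<exists>x. x \<in> sphere 0 1 \<and> \<phi> (p v) = outer x" using \<phi>(3) by blast
  then obtain P where P: "\<And>v. v \<in> V \<Longrightarrow> P v \<in> sphere 0 1" "\<And>v. v \<in> V \<Longrightarrow> \<phi> (p v) = outer (P v)"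
    unfolding bchoice_iff by blast
  define S where "S e = {x \<in> sphere 0 1. outer x \<in> \<phi> ` \<gamma> e ` {0..1}}" for e
  have top: "\<gamma> e ` {0..1} \<subseteq> topspace ?X" if "e \<in> E" for e
  proof -
    have "pathin ?X (\<gamma> e)" using emb that by (simp add: is_embedding_def)
    then show ?thesis unfolding pathin_def using continuous_map_image_subset_topspace by force
  qed
  have "antipodal_drawing E P S"
  proof
    show "S e \<subseteq> sphere 0 1" for e by (auto simp: S_def)
    show "- x \<in> S e" if "x \<in> S e" for x e using that by (simp add: S_def outer_def)
    fix e f x assume e: "e \<in> E" "f \<in> E" "e \<noteq> f" and x: "x \<in> S e" "x \<in> S f"
    then have "outer x \<in> \<phi> ` \<gamma> e ` {0..1}" "outer x \<in> \<phi> ` \<gamma> f ` {0..1}"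
      by (simp_all add: S_def)
    then obtain r s where rs: "r \<in> \<gamma> e ` {0..1}" "outer x = \<phi> r" "s \<in> \<gamma> f ` {0..1}" "outer x = \<phi> s"
      by blast
    then have "r = s" using inj_onD[OF \<phi>(2), of r s] top[OF e(1)] top[OF e(2)] by auto
    then have "r \<in> p ` (e \<inter> f)" using embedded_edges_meet[OF emb V e] rs by blast
    then obtain w where w: "w \<in> e \<inter> f" "r = p w" by blast
    then have "w \<in> V" using V e by blast
    then have "outer x = outer (P w)" using P(2) rs w by simp
    then have "x = P w \<or> x = - P w"
      using outer_eq_iff[of x "P w"] P(1)[OF \<open>w \<in> V\<close>] x by (simp add: S_def)
    then show "\<exists>w\<in>e \<inter> f. x = P w \<or> x = - P w" using w by blast
  next
    fix u v assume e: "{u, v} \<in> E" "u \<noteq> v"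
    have uv: "u \<in> V" "v \<in> V" using V[OF e(1)] by auto
    obtain g where g: "arc g" "pathstart g = \<phi> (p u)" "pathfinish g = \<phi> (p v)"
      and im: "path_image g = \<phi> ` \<gamma> {u, v} ` {0..1}"
      by (rule embedded_edge_arc[OF emb e(1) \<phi>(1,2)])
    from im have sub: "path_image g \<subseteq> outer ` sphere 0 1"
      using top[OF e(1)] \<phi>(3) by blast
    have "pathstart g = outer (P u)" using g(2) P(2)[OF uv(1)] by simp
    then obtain h where h: "path h" "path_image h \<subseteq> sphere 0 1" "pathstart h = P u"
      "\<And>t. t \<in> {0..1} \<Longrightarrow> outer (h t) = g t"
      using covering_space_lift_path_strong[OF covering_space_outer P(1)[OF uv(1)] arc_imp_path[OF g(1)] sub] by blast
    have hn: "norm (h t) = 1" if "t \<in> {0..1}" for t using h(2) that unfolding path_image_def by fastforce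
    have key: "r = t" if "r \<in> {0..1}" "t \<in> {0..1}" "outer (h r) = outer (h t)" for r t
      using inj_onD[OF arc_imp_inj_on[OF g(1)] _ that(1,2)] h(4)[OF that(1)] h(4)[OF that(2)] that(3) by simp
    have "inj_on h {0..1}" using key by (auto simp: inj_on_def)
    then have "arc h" using h(1) by (simp add: arc_def)
    moreover have "path_image h \<subseteq> S {u, v}"
    proof
      fix x assume "x \<in> path_image h"
      then obtain t where t: "t \<in> {0..1}" "x = h t" by (auto simp: path_image_def)
      then have "outer x \<in> path_image g" using h(4)[OF t(1)] by (simp add: path_image_def)
      then show "x \<in> S {u, v}" unfolding im S_def using hn t by simp
    qed
    moreover have "path_image h \<inter> uminus ` path_image h = {}"
    proof (rule ccontr)
      assume "path_image h \<inter> uminus ` path_image h \<noteq> {}"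
      then obtain r t where rt: "r \<in> {0..1}" "t \<in> {0..1}" "h r = - h t" unfolding path_image_def by blast
      have "outer (h r) = outer (h t)" unfolding rt(3) by (simp add: outer_def)
      then have "r = t" using key rt by blast
      then have "h t = 0" using rt(3) by (simp add: vec_eq_iff)
      then show False using hn[OF rt(2)] by simp
    qed
    moreover have "pathfinish h = P v \<or> pathfinish h = - P v"
    proof -
      have "outer (h 1) = outer (P v)" using h(4)[of 1] g(3) P(2)[OF uv(2)] by (simp add: pathfinish_def)
      then show ?thesis using outer_eq_iff[of "h 1" "P v"] hn[of 1] P(1)[OF uv(2)] by (simp add: pathfinish_def)
    qed
    ultimately have "lifted_edge S P 1 u v \<or> lifted_edge S P (-1) u v"
      unfolding lifted_edge_def lifted_arc_def using h(3) by (metis scaleR_minus1_left scaleR_one)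
    then show "\<exists>s. lifted_edge S P s u v" by blast
  qed
  then show ?thesis by (rule that)
qed

section \<open>Nonplanarity of K(3,3)\<close>

text \<open>Without caps every class is a singleton, so \<open>the_elem\<close> is the
  identification with the sphere.\<close>

lemma sphere_surface_elem:
  obtains \<phi> :: "(real^3) set \<Rightarrow> real^3" where
    "continuous_map (crosscap_surface 0) euclidean \<phi>" "inj_on \<phi> (topspace (crosscap_surface 0))"
    "\<phi> ` topspace (crosscap_surface 0) \<subseteq> sphere 0 1"
proof
  have hs: "holed_sphere 0 = sphere 0 1" by (auto simp: holed_sphere_def)
  have cl: "crosscap_rel 0 `` {x} = {x}" if "x \<in> holed_sphere 0" for x
    using that by (auto simp: crosscap_rel_def)
  have "continuous_map (top_of_set (holed_sphere 0)) euclidean (the_elem \<circ> (\<lambda>x. crosscap_rel 0 `` {x}))"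
    by (rule continuous_map_eq[where f = id]) (auto simp: cl)
  then show "continuous_map (crosscap_surface 0) euclidean the_elem"
    by (rule continuous_compose_quotient_map[OF quotient_map_crosscap_surface])
  show "inj_on the_elem (topspace (crosscap_surface 0))"
    unfolding topspace_crosscap_surface
  proof (rule inj_onI)
    fix C D assume "C \<in> holed_sphere 0 // crosscap_rel 0" "D \<in> holed_sphere 0 // crosscap_rel 0"
      and eq: "the_elem C = the_elem D"
    then obtain x y where "x \<in> holed_sphere 0" "C = {x}" "y \<in> holed_sphere 0" "D = {y}"
      using cl unfolding quotient_def by blast
    then show "C = D" using eq by simp
  qed
  show "the_elem ` topspace (crosscap_surface 0) \<subseteq> sphere 0 1"
  proof
    fix x assume "x \<in> the_elem ` topspace (crosscap_surface 0)"
    then obtain y where "y \<in> holed_sphere 0" "x = the_elem (crosscap_rel 0 `` {y})"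
      unfolding topspace_crosscap_surface quotient_def by blast
    then show "x \<in> sphere 0 1" using cl hs by simp
  qed
qed

lemma K33_not_in_sphere:
  assumes emb: "embeddable_in (V, E) (crosscap_surface 0)" and G: "simple_graph (V, E)"
    and AB: "card A = 3" "card B = 3" "A \<inter> B = {}" "\<And>a b. \<lbrakk>a \<in> A; b \<in> B\<rbrakk> \<Longrightarrow> {a, b} \<in> E"
  shows False
proof -
  obtain p \<gamma> where emb: "is_embedding (V, E) (crosscap_surface 0) p \<gamma>"
    using emb by (auto simp: embeddable_in_def)
  let ?X = "crosscap_surface 0"
  obtain \<phi> :: "(real^3) set \<Rightarrow> real^3" where \<phi>: "continuous_map ?X euclidean \<phi>" "inj_on \<phi> (topspace ?X)"
    "\<phi> ` topspace ?X \<subseteq> sphere 0 1" by (rule sphere_surface_elem)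
  have V: "e \<subseteq> V" if "e \<in> E" for e using G that by (auto simp: simple_graph_def)
  define P where "P v = \<phi> (p v)" for v
  have top: "\<gamma> e ` {0..1} \<subseteq> topspace ?X" if "e \<in> E" for e
  proof -
    have "pathin ?X (\<gamma> e)" using emb that by (simp add: is_embedding_def)
    then show ?thesis unfolding pathin_def using continuous_map_image_subset_topspace by force
  qed
  have "\<exists>h. arc h \<and> path_image h = \<phi> ` \<gamma> {u, v} ` {0..1} \<and> pathstart h = P u \<and> pathfinish h = P v" if e: "{u, v} \<in> E" for u v
    by (rule embedded_edge_arc[OF emb e \<phi>(1,2)]) (auto simp: P_def)
  then obtain H where H: "arc (H u v)" "path_image (H u v) = \<phi> ` \<gamma> {u, v} ` {0..1}"
      "pathstart (H u v) = P u" "pathfinish (H u v) = P v" if "{u, v} \<in> E" for u v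
    by metis
  have ends: "P u \<in> path_image (H u v)" "P v \<in> path_image (H u v)" if "{u, v} \<in> E" for u v
    using H(3,4)[OF that] pathstart_in_path_image pathfinish_in_path_image by metis+
  have sph: "path_image (H u v) \<subseteq> sphere 0 1" if "{u, v} \<in> E" for u v
    using H(2)[OF that] top[OF that] \<phi>(3) by blast
  have meet: "path_image (H u v) \<inter> path_image (H a b) \<subseteq> P ` ({u, v} \<inter> {a, b})"
    if e: "{u, v} \<in> E" "{a, b} \<in> E" "{u, v} \<noteq> {a, b}" for u v a b
  proof
    fix x assume x: "x \<in> path_image (H u v) \<inter> path_image (H a b)"
    then obtain r s where rs: "r \<in> \<gamma> {u, v} ` {0..1}" "x = \<phi> r" "s \<in> \<gamma> {a, b} ` {0..1}" "x = \<phi> s"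
      using H(2)[OF e(1)] H(2)[OF e(2)] by blast
    then have "r = s" using inj_onD[OF \<phi>(2), of r s] top[OF e(1)] top[OF e(2)] by auto
    then have "r \<in> p ` ({u, v} \<inter> {a, b})"
      using embedded_edges_meet[OF emb V e, of r] rs by simp
    then show "x \<in> P ` ({u, v} \<inter> {a, b})" unfolding rs(2) P_def by blast
  qed
  obtain x y z where xyz: "A = {x, y, z}" "x \<noteq> y" "y \<noteq> z" "x \<noteq> z" using AB(1) by (auto simp: card_3_iff)
  have "finite B" using AB(2) card.infinite by fastforce
  then obtain t where t: "bij_betw t {0..<3::nat} B" using ex_bij_betw_nat_finite AB(2) by metis
  have tB: "t i \<in> B" if "i < 3" for i using bij_betwE[OF t] that by auto
  have inj: "t i \<noteq> t j" if "i < 3" "j < 3" "i \<noteq> j" for i j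
    using bij_betw_imp_inj_on[OF t] that by (auto simp: inj_on_def)
  have E: "{a, t i} \<in> E" if "a \<in> {x, y, z}" "i < 3" for a i using AB(4) tB that xyz(1) by blast
  have nA: "t i \<noteq> x" "t i \<noteq> y" "t i \<noteq> z" if "i < 3" for i using tB[OF that] AB(3) xyz(1) by auto
  have 1: "path_image (H a (t i)) \<inter> path_image (H b (t i)) = {P (t i)}"
    if "a \<in> {x, y, z}" "b \<in> {x, y, z}" "a \<noteq> b" "i < 3" for a b i
  proof -
    have "{a, t i} \<inter> {b, t i} = {t i}" "{a, t i} \<noteq> {b, t i}" using that nA[OF that(4)] by (auto simp: doubleton_eq_iff)
    then show ?thesis using meet[OF E[OF that(1,4)] E[OF that(2,4)]] ends[OF E[OF that(1,4)]] ends[OF E[OF that(2,4)]] by auto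
  qed
  have 2: "path_image (H a (t i)) \<inter> path_image (H b (t j)) = {}"
    if "a \<in> {x, y, z}" "b \<in> {x, y, z}" "a \<noteq> b" "i < 3" "j < 3" "i \<noteq> j" for a b i j
  proof -
    have "{a, t i} \<inter> {b, t j} = {}" using that nA[OF that(4)] nA[OF that(5)] inj[OF that(4-6)] by auto
    then show ?thesis using meet[OF E[OF that(1,4)] E[OF that(2,5)]] by auto
  qed
  have 3: "path_image (H a (t i)) \<inter> path_image (H a (t j)) = {P a}"
    if "a \<in> {x, y, z}" "i < 3" "j < 3" "i \<noteq> j" for a i j
  proof -
    have "{a, t i} \<inter> {a, t j} = {a}" "{a, t i} \<noteq> {a, t j}" using that inj[OF that(2-4)] by (auto simp: doubleton_eq_iff)
    then show ?thesis using meet[OF E[OF that(1,2)] E[OF that(1,3)]] ends[OF E[OF that(1,2)]] ends[OF E[OF that(1,3)]] by auto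
  qed
  have 4: "path_image (H z (t i)) \<inter> (\<Union>i<3. path_image (H x (t i)) \<union> path_image (H y (t i))) \<subseteq> {P (t i)}" if i: "i < 3" for i
  proof -
    have "path_image (H z (t i)) \<inter> (path_image (H x (t j)) \<union> path_image (H y (t j))) \<subseteq> {P (t i)}" if "j < 3" for j
      using 1[of z x i] 1[of z y i] 2[of z x i j] 2[of z y i j] xyz that i by (cases "i = j") auto
    then show ?thesis by blast
  qed
  have arcs: "arc (H a (t i)) \<and> path_image (H a (t i)) \<subseteq> sphere 0 1 \<and> pathstart (H a (t i)) = P a \<and>
      pathfinish (H a (t i)) = P (t i)" if "a \<in> {x, y, z}" "i < 3" for a i
    using H[OF E[OF that]] sph[OF E[OF that]] by blast
  interpret theta_arcs "\<lambda>i. H x (t i)" "\<lambda>i. H y (t i)" "P x" "P y" "\<lambda>i. P (t i)"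
  proof
    fix i :: nat assume i: "i < 3"
    show "arc (H x (t i)) \<and> path_image (H x (t i)) \<subseteq> sphere 0 1 \<and> pathstart (H x (t i)) = P x \<and>
        pathfinish (H x (t i)) = P (t i)"
      "arc (H y (t i)) \<and> path_image (H y (t i)) \<subseteq> sphere 0 1 \<and> pathstart (H y (t i)) = P y \<and>
        pathfinish (H y (t i)) = P (t i)"
      using i by (simp_all only: arcs insertI1 insertI2 simp_thms)
    show "path_image (H x (t i)) \<inter> path_image (H y (t i)) = {P (t i)}"
      using 1[of x y i] xyz i by simp
    fix j :: nat assume j: "j < 3" "i \<noteq> j"
    show "path_image (H x (t i)) \<inter> path_image (H x (t j)) = {P x} \<and>
        path_image (H y (t i)) \<inter> path_image (H y (t j)) = {P y} \<and> path_image (H x (t i)) \<inter> path_image (H y (t j)) = {}"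
      using 3[of x i j] 3[of y i j] 2[of x y i j] xyz i j by simp
  qed
  show False
    by (rule no_K33_sphere[of "\<lambda>i. H z (t i)" "P z"]) (use arcs[of z] 4 in \<open>simp_all add: theta_image_def\<close>)
qed

section \<open>Straight drawings\<close>

lemma embeddable_in_subgraph:
  assumes emb: "embeddable_in (V, E) X" and f: "inj_on f V'" "f ` V' \<subseteq> V"
    and E': "\<And>e. e \<in> E' \<Longrightarrow> e \<subseteq> V' \<and> f ` e \<in> E"
  shows "embeddable_in (V', E') X"
proof -
  obtain p \<gamma> where emb: "is_embedding (V, E) X p \<gamma>" using emb by (auto simp: embeddable_in_def)
  then have p: "inj_on p V" "p ` V \<subseteq> topspace X"
    and \<gamma>: "\<And>e. e \<in> E \<Longrightarrow> pathin X (\<gamma> e) \<and> inj_on (\<gamma> e) {0..1} \<and> {\<gamma> e 0, \<gamma> e 1} = p ` e \<and>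
        \<gamma> e ` {0<..<1} \<inter> p ` V = {}"
    and d: "\<And>e e'. \<lbrakk>e \<in> E; e' \<in> E; e \<noteq> e'\<rbrakk> \<Longrightarrow> \<gamma> e ` {0<..<1} \<inter> \<gamma> e' ` {0<..<1} = {}"
    by (simp_all add: is_embedding_def)
  have "is_embedding (V', E') X (p \<circ> f) (\<lambda>e. \<gamma> (f ` e))"
    unfolding is_embedding_def split_conv
  proof (intro conjI ballI impI)
    show "inj_on (p \<circ> f) V'" using f p(1) by (metis comp_inj_on inj_on_subset)
    show "(p \<circ> f) ` V' \<subseteq> topspace X" using f p(2) by (auto simp: subset_iff)
  next
    fix e assume e: "e \<in> E'"
    note e' = \<gamma>[OF conjunct2[OF E'[OF e]]]
    show "pathin X (\<gamma> (f ` e))" "inj_on (\<gamma> (f ` e)) {0..1}" using e' by auto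
    show "{\<gamma> (f ` e) 0, \<gamma> (f ` e) 1} = (p \<circ> f) ` e" using e' by (simp add: image_comp)
    have "(p \<circ> f) ` V' \<subseteq> p ` V" using f(2) by auto
    moreover have "\<gamma> (f ` e) ` {0<..<1} \<inter> p ` V = {}" using e' by simp
    ultimately show "\<gamma> (f ` e) ` {0<..<1} \<inter> (p \<circ> f) ` V' = {}" by blast
    fix g assume g: "g \<in> E'" "e \<noteq> g"
    have "f ` e \<noteq> f ` g" using f(1) E'[OF e] E'[OF g(1)] g(2) inj_on_image_eq_iff by metis
    then show "\<gamma> (f ` e) ` {0<..<1} \<inter> \<gamma> (f ` g) ` {0<..<1} = {}"
      using d E'[OF e] E'[OF g(1)] by blast
  qed
  then show ?thesis by (auto simp: embeddable_in_def)
qed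

text \<open>Disjointness of two relatively open cones, which are the preimages of open segments
  under radial projection. With \<open>a = b\<close> the cone is a ray, so a vertex is handled as a
  degenerate edge.\<close>

definition cones_disjoint :: "real^3 \<Rightarrow> real^3 \<Rightarrow> real^3 \<Rightarrow> real^3 \<Rightarrow> bool" where
  "cones_disjoint a b c d \<longleftrightarrow>
     (\<forall>\<alpha> \<beta> \<gamma> \<delta>. \<alpha> > 0 \<longrightarrow> \<beta> > 0 \<longrightarrow> \<gamma> > 0 \<longrightarrow> \<delta> > 0 \<longrightarrow> \<alpha> *\<^sub>R a + \<beta> *\<^sub>R b \<noteq> \<gamma> *\<^sub>R c + \<delta> *\<^sub>R d)"

text \<open>A vertex i is drawn at \<open>pt i\<close>, and (i, j, s) is the edge that is the radial projection of the
  segment from \<open>pt i\<close> to \<open>s *\<^sub>R pt j\<close>. The target is the sphere for \<open>\<Sigma> = {1}\<close>, and the projective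
  plane for \<open>\<Sigma> = {1, -1}\<close>.\<close>

locale straight_position =
  fixes \<Sigma> :: "real set" and pt :: "nat \<Rightarrow> real^3" and n :: nat and es :: "(nat \<times> nat \<times> real) list"
  assumes es: "\<forall>(i, j, s)\<in>set es. i < n \<and> j < n \<and> s \<in> \<Sigma>"
    and pt: "\<forall>i\<in>set [0..<n]. pt i \<noteq> 0"
    and indep: "\<forall>(i, j, s)\<in>set es. \<forall>\<alpha> \<beta>. \<alpha> *\<^sub>R pt i + (\<beta> * s) *\<^sub>R pt j = 0 \<longrightarrow> \<alpha> = 0 \<and> \<beta> = 0"
    and vv: "sorted_wrt (\<lambda>i j. \<forall>\<sigma>\<in>\<Sigma>. cones_disjoint (pt i) (pt i) (\<sigma> *\<^sub>R pt j) (\<sigma> *\<^sub>R pt j)) [0..<n]"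
    and ve: "\<forall>k\<in>set [0..<n]. \<forall>(i, j, s)\<in>set es. \<forall>\<sigma>\<in>\<Sigma>. cones_disjoint (pt k) (pt k) (\<sigma> *\<^sub>R pt i) ((\<sigma> * s) *\<^sub>R pt j)"
    and ee: "sorted_wrt (\<lambda>(i, j, s) (k, m, r). \<forall>\<sigma>\<in>\<Sigma>.
        cones_disjoint (pt i) (s *\<^sub>R pt j) (\<sigma> *\<^sub>R pt k) ((\<sigma> * r) *\<^sub>R pt m)) es"

text \<open>Two vectors have the same image iff they are on one ray up to a factor from
  \<open>\<Sigma>\<close>; hence a crossing of two projected segments is a common point of their
  cones after one is scaled by some \<open>\<sigma>\<close>. With \<open>sorted_wrt\<close> each
  unordered pair is tested in one order only; the conclusion is symmetric.\<close>

lemma (in straight_position) drawing: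
  fixes \<rho> :: "real^3 \<Rightarrow> 'b"
  assumes \<rho>: "continuous_map (top_of_set (- {0})) X \<rho>"
    and \<rho>_eq: "\<And>x y. \<lbrakk>x \<noteq> 0; y \<noteq> 0\<rbrakk> \<Longrightarrow> \<rho> x = \<rho> y \<longleftrightarrow> (\<exists>\<sigma>\<in>\<Sigma>. \<exists>l>0. x = (\<sigma> * l) *\<^sub>R y)"
    and \<Sigma>: "\<Sigma> \<subseteq> {1, -1}"
  shows "embeddable_in ({..<n}, (\<lambda>(i, j, s). {i, j}) ` set es) X"
proof -
  have pt: "\<forall>i<n. pt i \<noteq> 0" using pt by simp
  \<comment> \<open>An edge of the graph is just a set of ends, so a list entry that realises it has
    to be selected.\<close>
  define ed where "ed e = (SOME x. x \<in> set es \<and> (\<lambda>(i, j, s). {i, j}) x = e)" for e :: "nat set"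
  have ed: "ed e \<in> set es \<and> (\<lambda>(i, j, s). {i, j}) (ed e) = e" if "e \<in> (\<lambda>(i, j, s). {i, j}) ` set es" for e
    unfolding ed_def by (rule someI_ex) (use that in blast)
  define a b where "a x = pt (fst x)" and "b x = snd (snd x) *\<^sub>R pt (fst (snd x))" for x :: "nat \<times> nat \<times> real"
  define seg where "seg x t = (1 - t) *\<^sub>R a x + t *\<^sub>R b x" for x t
  have sq: "\<sigma> * \<sigma> = 1" if "\<sigma> \<in> \<Sigma>" for \<sigma> using \<Sigma> that by auto
  have ind: "\<alpha> = 0 \<and> \<beta> = 0" if "x \<in> set es" "\<alpha> *\<^sub>R a x + \<beta> *\<^sub>R b x = 0" for x \<alpha> \<beta>
    using bspec[OF indep that(1)] that(2) by (auto simp: a_def b_def split_beta)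
  have seg0: "seg x t \<noteq> 0" if "x \<in> set es" for x t
    using ind[OF that, of "1 - t" t] by (auto simp: seg_def)
  have sep: "\<rho> (\<alpha> *\<^sub>R u + \<beta> *\<^sub>R v) \<noteq> \<rho> (\<gamma> *\<^sub>R w + \<delta> *\<^sub>R z)"
    if cd: "\<forall>\<sigma>\<in>\<Sigma>. cones_disjoint u v (\<sigma> *\<^sub>R w) (\<sigma> *\<^sub>R z)" and pos: "\<alpha> > 0" "\<beta> > 0" "\<gamma> > 0" "\<delta> > 0"
      and nz: "\<alpha> *\<^sub>R u + \<beta> *\<^sub>R v \<noteq> 0" "\<gamma> *\<^sub>R w + \<delta> *\<^sub>R z \<noteq> 0" for u v w z \<alpha> \<beta> \<gamma> \<delta>
  proof
    assume "\<rho> (\<alpha> *\<^sub>R u + \<beta> *\<^sub>R v) = \<rho> (\<gamma> *\<^sub>R w + \<delta> *\<^sub>R z)"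
    then obtain \<sigma> l where l: "\<sigma> \<in> \<Sigma>" "l > 0" "\<alpha> *\<^sub>R u + \<beta> *\<^sub>R v = (\<sigma> * l) *\<^sub>R (\<gamma> *\<^sub>R w + \<delta> *\<^sub>R z)"
      using \<rho>_eq[OF nz] by blast
    then have "\<alpha> *\<^sub>R u + \<beta> *\<^sub>R v = (l * \<gamma>) *\<^sub>R (\<sigma> *\<^sub>R w) + (l * \<delta>) *\<^sub>R (\<sigma> *\<^sub>R z)"
      by (simp add: scaleR_add_right mult_ac)
    then show False using cd l(1,2) pos unfolding cones_disjoint_def by (meson mult_pos_pos)
  qed
  have sw: "R x y \<or> R y x" if "sorted_wrt R xs" "x \<in> set xs" "y \<in> set xs" "x \<noteq> y"
    for R :: "'c \<Rightarrow> 'c \<Rightarrow> bool" and xs x y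
    using that by (induction xs) auto
  \<comment> \<open>Presents a vertex as an element of its own degenerate cone.\<close>
  have half: "(1/2) *\<^sub>R y + (1/2) *\<^sub>R y = y" for y :: "real^3"
    by (simp flip: scaleR_add_left)
  have inj: "inj_on (\<rho> \<circ> pt) {..<n}"
  proof (rule inj_onI, rule ccontr)
    fix i j assume ij: "i \<in> {..<n}" "j \<in> {..<n}" "(\<rho> \<circ> pt) i = (\<rho> \<circ> pt) j" "i \<noteq> j"
    have *: "\<rho> (pt i) \<noteq> \<rho> (pt j)" if "\<forall>\<sigma>\<in>\<Sigma>. cones_disjoint (pt i) (pt i) (\<sigma> *\<^sub>R pt j) (\<sigma> *\<^sub>R pt j)" "i < n" "j < n" for i j
      using sep[OF that(1), of "1/2" "1/2" "1/2" "1/2"] pt that(2,3) unfolding half by simp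
    show False using sw[OF vv, of i j] ij *[of i j] *[of j i] by auto
  qed
  have ve': "\<rho> (seg x t) \<noteq> \<rho> (pt k)" if "x \<in> set es" "t \<in> {0<..<1}" "k < n" for x t k
  proof -
    have "\<forall>\<sigma>\<in>\<Sigma>. cones_disjoint (pt k) (pt k) (\<sigma> *\<^sub>R a x) (\<sigma> *\<^sub>R b x)"
      using bspec[OF bspec[OF ve, of k] that(1)] that(3) by (simp add: a_def b_def split_beta)
    then show ?thesis
      using sep[of "pt k" "pt k" "a x" "b x" "1/2" "1/2" "1 - t" t] seg0[OF that(1), of t] pt that(2,3)
      unfolding half seg_def by auto
  qed
  have ee': "\<rho> (seg x t) \<noteq> \<rho> (seg y r)" if "x \<in> set es" "y \<in> set es" "x \<noteq> y" "t \<in> {0<..<1}" "r \<in> {0<..<1}" for x y t r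
  proof -
    have *: "\<rho> (seg x t) \<noteq> \<rho> (seg y r)" if "\<forall>\<sigma>\<in>\<Sigma>. cones_disjoint (a x) (b x) (\<sigma> *\<^sub>R a y) (\<sigma> *\<^sub>R b y)"
      "x \<in> set es" "y \<in> set es" "t \<in> {0<..<1}" "r \<in> {0<..<1}" for x y t r
      using sep[OF that(1), of "1 - t" t "1 - r" r] seg0[OF that(2), of t] seg0[OF that(3), of r] that(4,5)
      unfolding seg_def by auto
    have "(\<forall>\<sigma>\<in>\<Sigma>. cones_disjoint (a x) (b x) (\<sigma> *\<^sub>R a y) (\<sigma> *\<^sub>R b y)) \<or>
          (\<forall>\<sigma>\<in>\<Sigma>. cones_disjoint (a y) (b y) (\<sigma> *\<^sub>R a x) (\<sigma> *\<^sub>R b x))"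
      using sw[OF ee that(1-3)] by (simp add: a_def b_def split_beta)
    then show ?thesis using *[of x y t r] *[of y x r t] that by auto
  qed
  have top: "\<rho> x \<in> topspace X" if "x \<noteq> 0" for x
    using continuous_map_image_subset_topspace[OF \<rho>] that by auto
  have "is_embedding ({..<n}, (\<lambda>(i, j, s). {i, j}) ` set es) X (\<rho> \<circ> pt) (\<lambda>e. \<rho> \<circ> seg (ed e))"
    unfolding is_embedding_def split_conv
  proof (intro conjI ballI impI)
    show "inj_on (\<rho> \<circ> pt) {..<n}" by (rule inj)
    show "(\<rho> \<circ> pt) ` {..<n} \<subseteq> topspace X" using top pt by auto
  next
    fix e assume "e \<in> (\<lambda>(i, j, s). {i, j}) ` set es"
    note e = ed[OF this]
    obtain i j s where x: "ed e = (i, j, s)" by (cases "ed e") auto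
    have xs: "i < n" "j < n" "s \<in> \<Sigma>" "e = {i, j}" "ed e \<in> set es" using e es x by auto
    have ab: "a (ed e) = pt i" "b (ed e) = s *\<^sub>R pt j" by (simp_all add: x a_def b_def)
    have "continuous_map (top_of_set {0..1}) (top_of_set (- {0})) (seg (ed e))"
      using seg0[OF xs(5)] unfolding seg_def
      by (auto simp: continuous_map_in_subtopology intro!: continuous_intros)
    then show "pathin X (\<rho> \<circ> seg (ed e))"
      using \<rho> unfolding pathin_def by (rule continuous_map_compose)
    show "inj_on (\<rho> \<circ> seg (ed e)) {0..1}"
    proof (rule inj_onI)
      fix t r assume "(\<rho> \<circ> seg (ed e)) t = (\<rho> \<circ> seg (ed e)) r"
      then obtain l where l: "seg (ed e) t = l *\<^sub>R seg (ed e) r"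
        using \<rho>_eq[OF seg0[OF xs(5)] seg0[OF xs(5)]] by auto
      \<comment> \<open>As the two ends are independent, both coefficients agree, and their sum
        gives \<open>l = 1\<close>.\<close>
      have "((1 - t) - l * (1 - r)) *\<^sub>R a (ed e) + (t - l * r) *\<^sub>R b (ed e) = 0"
        using l by (simp add: seg_def algebra_simps)
      then have "1 - t - l * (1 - r) = 0 \<and> t - l * r = 0" by (rule ind[OF xs(5)])
      then have "1 - t = l * (1 - r)" "t = l * r" by auto
      moreover from this have "l = 1" by (simp add: algebra_simps)
      ultimately show "t = r" by simp
    qed
    have "s *\<^sub>R pt j \<noteq> 0" "pt j \<noteq> 0" using sq[OF xs(3)] pt xs(2) by auto
    moreover have "\<exists>\<sigma>\<in>\<Sigma>. \<exists>l>0. s *\<^sub>R pt j = (\<sigma> * l) *\<^sub>R pt j"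
      using xs(3) by (intro bexI[of _ s] exI[of _ 1]) auto
    ultimately have "\<rho> (s *\<^sub>R pt j) = \<rho> (pt j)" using \<rho>_eq by blast
    then show "{(\<rho> \<circ> seg (ed e)) 0, (\<rho> \<circ> seg (ed e)) 1} = (\<rho> \<circ> pt) ` e"
      unfolding comp_def seg_def ab using xs(4) by simp
    show "(\<rho> \<circ> seg (ed e)) ` {0<..<1} \<inter> (\<rho> \<circ> pt) ` {..<n} = {}"
      using ve'[OF xs(5)] by auto
    fix f assume "f \<in> (\<lambda>(i, j, s). {i, j}) ` set es" "e \<noteq> f"
    note f = ed[OF this(1)] this(2)
    have "ed e \<noteq> ed f" using e f by metis
    then show "(\<rho> \<circ> seg (ed e)) ` {0<..<1} \<inter> (\<rho> \<circ> seg (ed f)) ` {0<..<1} = {}"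
      using ee'[OF xs(5) conjunct1[OF f(1)]] by auto
  qed
  then show ?thesis by (auto simp: embeddable_in_def)
qed

section \<open>Radial projection and the three drawn patterns\<close>

text \<open>For nonzero \<open>x\<close> this picks the unit vector on the line of \<open>x\<close>
  that survives the removal of the caps: always \<open>sgn x\<close> for k = 0, and for k = 1 one of
  the two antipodes, which have the same class when both survive.\<close>

definition radial_projection :: "nat \<Rightarrow> real^3 \<Rightarrow> (real^3) set" where
  "radial_projection k x = crosscap_rel k `` {if sgn x \<in> holed_sphere k then sgn x else - sgn x}"

lemma sgn_eq_sgn_iff:
  fixes x y :: "'a::real_normed_vector"
  assumes "x \<noteq> 0" "y \<noteq> 0"
  shows "sgn x = sgn y \<longleftrightarrow> (\<exists>l>0. x = l *\<^sub>R y)"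
proof
  assume "sgn x = sgn y"
  then have "x = (norm x / norm y) *\<^sub>R y"
    using assms by (simp add: sgn_div_norm divide_inverse flip: scaleR_scaleR) (metis norm_eq_zero right_inverse scaleR_one scaleR_scaleR)
  then show "\<exists>l>0. x = l *\<^sub>R y" using assms by (metis divide_pos_pos zero_less_norm_iff)
qed (auto simp: sgn_scaleR)

lemma continuous_on_sgn_vec:
  "continuous_on (- {0}) (sgn :: 'a::real_normed_vector \<Rightarrow> 'a)"
  unfolding sgn_div_norm by (intro continuous_intros) auto

lemma crosscap_class_eq_iff:
  assumes "x \<in> holed_sphere k" "y \<in> holed_sphere k"
  shows "crosscap_rel k `` {x} = crosscap_rel k `` {y} \<longleftrightarrow> (x, y) \<in> crosscap_rel k"
  using eq_equiv_class_iff[OF equiv_crosscap_rel assms] .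

lemma continuous_map_crosscap_class:
  assumes "continuous_on A f" "f ` A \<subseteq> holed_sphere k"
  shows "continuous_map (top_of_set A) (crosscap_surface k) (\<lambda>x. crosscap_rel k `` {f x})"
proof -
  have "continuous_map (top_of_set A) (top_of_set (holed_sphere k)) f"
    using assms by (auto simp: continuous_map_in_subtopology)
  from continuous_map_compose[OF this quotient_imp_continuous_map[OF quotient_map_crosscap_surface]]
  show ?thesis by (simp add: comp_def)
qed

lemma radial_projection_sphere:
  shows "continuous_map (top_of_set (- {0})) (crosscap_surface 0) (radial_projection 0)"
    and "\<lbrakk>x \<noteq> 0; y \<noteq> 0\<rbrakk> \<Longrightarrow> radial_projection 0 x = radial_projection 0 y \<longleftrightarrow> (\<exists>\<sigma>\<in>{1}. \<exists>l>0. x = (\<sigma> * l) *\<^sub>R y)"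
proof -
  have hs: "sgn x \<in> holed_sphere 0" if "x \<noteq> 0" for x using that by (simp add: holed_sphere_def norm_sgn)
  have "continuous_map (top_of_set (- {0})) (crosscap_surface 0) (\<lambda>x. crosscap_rel 0 `` {sgn x})"
    by (rule continuous_map_crosscap_class[OF continuous_on_sgn_vec]) (use hs in auto)
  then show "continuous_map (top_of_set (- {0})) (crosscap_surface 0) (radial_projection 0)"
    by (rule continuous_map_eq) (auto simp: radial_projection_def hs)
  assume xy: "x \<noteq> 0" "y \<noteq> 0"
  then show "radial_projection 0 x = radial_projection 0 y \<longleftrightarrow> (\<exists>\<sigma>\<in>{1}. \<exists>l>0. x = (\<sigma> * l) *\<^sub>R y)"
    using sgn_eq_sgn_iff[OF xy] crosscap_class_eq_iff[OF hs hs, of x y]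
    by (auto simp: radial_projection_def hs crosscap_rel_def)
qed

text \<open>Continuity comes from pasting two closed half-spaces: on the common plane the vectors
  \<open>sgn x\<close> and \<open>- sgn x\<close> lie on the boundary circle and are
  identified.\<close>

lemma radial_projection_projective:
  shows "continuous_map (top_of_set (- {0})) (crosscap_surface 1) (radial_projection 1)"
    and "\<lbrakk>x \<noteq> 0; y \<noteq> 0\<rbrakk> \<Longrightarrow> radial_projection 1 x = radial_projection 1 y \<longleftrightarrow> (\<exists>\<sigma>\<in>{1, -1}. \<exists>l>0. x = (\<sigma> * l) *\<^sub>R y)"
proof -
  let ?c = "cap_centre 1 0"
  have hs: "sgn x \<in> holed_sphere 1 \<longleftrightarrow> x \<bullet> ?c \<le> 0" "- sgn x \<in> holed_sphere 1 \<longleftrightarrow> 0 \<le> x \<bullet> ?c" if "x \<noteq> 0" for x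
    using that by (auto simp: holed_sphere_1 norm_sgn sgn_div_norm mult_le_0_iff zero_le_mult_iff)
  have cl: "crosscap_rel 1 `` {sgn x} = crosscap_rel 1 `` {- sgn x}" if "x \<noteq> 0" "x \<bullet> ?c = 0" for x
  proof -
    have "(sgn x, - sgn x) \<in> crosscap_rel 1"
      using hs[OF that(1)] that by (simp add: crosscap_rel_1 sgn_div_norm)
    then show ?thesis by (rule equiv_class_eq[OF equiv_crosscap_rel])
  qed
  let ?f = "\<lambda>x. if x \<bullet> ?c \<le> 0 then crosscap_rel 1 `` {sgn x} else crosscap_rel 1 `` {- sgn x}"
  have "continuous_map (top_of_set (- {0})) (crosscap_surface 1) ?f"
  proof (rule continuous_map_cases_le)
    show "continuous_map (top_of_set (- {0})) euclideanreal (\<lambda>x. x \<bullet> ?c)"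
      "continuous_map (top_of_set (- {0::real^3})) euclideanreal (\<lambda>x. 0)"
      by (auto intro!: continuous_intros)
    have "continuous_map (top_of_set {x. x \<noteq> 0 \<and> x \<bullet> ?c \<le> 0}) (crosscap_surface 1) (\<lambda>x. crosscap_rel 1 `` {sgn x})"
      by (rule continuous_map_crosscap_class[OF continuous_on_subset[OF continuous_on_sgn_vec]]) (use hs in auto)
    moreover have "- {0} \<inter> {x \<in> topspace (top_of_set (- {0})). x \<bullet> ?c \<le> 0} = {x. x \<noteq> 0 \<and> x \<bullet> ?c \<le> 0}" by auto
    ultimately show "continuous_map (subtopology (top_of_set (- {0})) {x \<in> topspace (top_of_set (- {0})). x \<bullet> ?c \<le> 0})
        (crosscap_surface 1) (\<lambda>x. crosscap_rel 1 `` {sgn x})"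
      unfolding subtopology_subtopology by (rule back_subst[of "\<lambda>A. continuous_map (top_of_set A) _ _", OF _ sym])
    have "continuous_map (top_of_set {x. x \<noteq> 0 \<and> 0 \<le> x \<bullet> ?c}) (crosscap_surface 1) (\<lambda>x. crosscap_rel 1 `` {- sgn x})"
      by (rule continuous_map_crosscap_class[OF continuous_on_minus[OF continuous_on_subset[OF continuous_on_sgn_vec]]]) (use hs in auto)
    moreover have "- {0} \<inter> {x \<in> topspace (top_of_set (- {0})). 0 \<le> x \<bullet> ?c} = {x. x \<noteq> 0 \<and> 0 \<le> x \<bullet> ?c}" by auto
    ultimately show "continuous_map (subtopology (top_of_set (- {0})) {x \<in> topspace (top_of_set (- {0})). 0 \<le> x \<bullet> ?c})
        (crosscap_surface 1) (\<lambda>x. crosscap_rel 1 `` {- sgn x})"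
      unfolding subtopology_subtopology by (rule back_subst[of "\<lambda>A. continuous_map (top_of_set A) _ _", OF _ sym])
  qed (use cl in auto)
  then show "continuous_map (top_of_set (- {0})) (crosscap_surface 1) (radial_projection 1)"
    by (rule continuous_map_eq) (use hs in \<open>auto simp: radial_projection_def\<close>)
  assume xy: "x \<noteq> 0" "y \<noteq> 0"
  define u v where "u = (if sgn x \<in> holed_sphere 1 then sgn x else - sgn x)"
    and "v = (if sgn y \<in> holed_sphere 1 then sgn y else - sgn y)"
  have uv: "u \<in> holed_sphere 1" "v \<in> holed_sphere 1"
    using hs[OF xy(1)] hs[OF xy(2)] by (auto simp: u_def v_def)
  have "(u, v) \<in> crosscap_rel 1 \<longleftrightarrow> u = v \<or> u = - v"
    using uv by (auto simp: crosscap_rel_1 holed_sphere_1)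
  also have "\<dots> \<longleftrightarrow> sgn x = sgn y \<or> sgn x = sgn (- y)"
    using minus_equation_iff[of "sgn x" "sgn y"] by (auto simp: u_def v_def sgn_minus)
  also have "\<dots> \<longleftrightarrow> (\<exists>\<sigma>\<in>{1, -1}. \<exists>l>0. x = (\<sigma> * l) *\<^sub>R y)"
    using sgn_eq_sgn_iff[OF xy] sgn_eq_sgn_iff[of x "- y"] xy by auto
  finally show "radial_projection 1 x = radial_projection 1 y \<longleftrightarrow> (\<exists>\<sigma>\<in>{1, -1}. \<exists>l>0. x = (\<sigma> * l) *\<^sub>R y)"
    using crosscap_class_eq_iff[OF uv] unfolding radial_projection_def u_def v_def by blast
qed

text \<open>The vertices 0, 1, 2, 3 are the vertices of a cube up to antipodes, and 4, 5, 6 the centres of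
  its faces.\<close>

definition cube_point :: "nat \<Rightarrow> real^3" where
  "cube_point i = [vector [1, 1, 1], vector [-1, 1, 1], vector [1, -1, 1], vector [1, 1, -1],
     vector [1, 0, 0], vector [0, 1, 0], vector [0, 0, 1]] ! i"

text \<open>The sign is -1 where the neighbour on the cube is the antipode of the listed point. All
  pairs occur except those among 4, 5, 6, so the graph is K(7) minus a triangle.\<close>

definition cube_edges :: "(nat \<times> nat \<times> real) list" where
  "cube_edges = [(0, 1, 1), (0, 2, 1), (0, 3, 1), (1, 2, -1), (1, 3, -1), (2, 3, -1),
     (0, 4, 1), (0, 5, 1), (0, 6, 1), (1, 4, -1), (1, 5, 1), (1, 6, 1),
     (2, 4, 1), (2, 5, -1), (2, 6, 1), (3, 4, 1), (3, 5, 1), (3, 6, -1)]"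

lemmas drawing_simps = cones_disjoint_def vec_eq_iff forall_3 vector_3

lemma cube_drawing:
  "embeddable_in ({..<7}, (\<lambda>(i, j, s). {i, j}) ` set cube_edges) (crosscap_surface 1)"
proof -
  interpret straight_position "{1, -1}" cube_point 7 cube_edges
    by unfold_locales (simp_all add: upt_rec cube_edges_def cube_point_def drawing_simps)
  show ?thesis by (rule drawing[OF radial_projection_projective]) simp_all
qed

text \<open>Points 2 k and 2 k + 1 are opposite; these are the only non-adjacent pairs, so the graph
  is K(2,2,2).\<close>

definition octahedron_point :: "nat \<Rightarrow> real^3" where
  "octahedron_point i = [vector [1, 0, 0], vector [-1, 0, 0], vector [0, 1, 0], vector [0, -1, 0],
     vector [0, 0, 1], vector [0, 0, -1]] ! i"

definition octahedron_edges :: "(nat \<times> nat \<times> real) list" where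
  "octahedron_edges = [(0, 2, 1), (0, 3, 1), (0, 4, 1), (0, 5, 1), (1, 2, 1), (1, 3, 1), (1, 4, 1), (1, 5, 1),
     (2, 4, 1), (2, 5, 1), (3, 4, 1), (3, 5, 1)]"

lemma octahedron_drawing:
  "embeddable_in ({..<6}, (\<lambda>(i, j, s). {i, j}) ` set octahedron_edges) (crosscap_surface 0)"
proof -
  interpret straight_position "{1}" octahedron_point 6 octahedron_edges
    by unfold_locales (simp_all add: upt_rec octahedron_edges_def octahedron_point_def drawing_simps)
  show ?thesis by (rule drawing[OF radial_projection_sphere]) simp_all
qed

text \<open>Two apexes 0 and 1 above and below a triangle that surrounds the origin: K(5) minus the
  edge between the apexes.\<close>

definition bipyramid_point :: "nat \<Rightarrow> real^3" where
  "bipyramid_point i = [vector [0, 0, 1], vector [0, 0, -1], vector [1, 0, 0], vector [-1, 1, 0], vector [-1, -1, 0]] ! i"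

definition bipyramid_edges :: "(nat \<times> nat \<times> real) list" where
  "bipyramid_edges = [(0, 2, 1), (0, 3, 1), (0, 4, 1), (1, 2, 1), (1, 3, 1), (1, 4, 1), (2, 3, 1), (2, 4, 1), (3, 4, 1)]"

lemma bipyramid_drawing:
  "embeddable_in ({..<5}, (\<lambda>(i, j, s). {i, j}) ` set bipyramid_edges) (crosscap_surface 0)"
proof -
  interpret straight_position "{1}" bipyramid_point 5 bipyramid_edges
    by unfold_locales (simp_all add: upt_rec bipyramid_edges_def bipyramid_point_def drawing_simps)
  show ?thesis by (rule drawing[OF radial_projection_sphere]) simp_all
qed

section \<open>Cyclic pairs of elements\<close>

abbreviation cyclic_pair :: "('a, 'b) monoid_scheme \<Rightarrow> 'a \<Rightarrow> 'a \<Rightarrow> bool" where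
  "cyclic_pair G x y \<equiv> cyclic_group (subgroup_generated G {x, y})"

context group
begin

lemma cyclic_pair_generator:
  assumes "cyclic_pair G x y" "x \<in> carrier G" "y \<in> carrier G"
  obtains h where "h \<in> carrier G" "generate G {x, y} \<subseteq> generate G {h}"
proof -
  let ?H = "subgroup_generated G {x, y}"
  obtain h where h: "h \<in> carrier ?H" "carrier ?H = range (\<lambda>n::int. h [^]\<^bsub>?H\<^esub> n)"
    using assms(1) group.cyclic_group[OF group_subgroup_generated] by blast
  have hG: "h \<in> carrier G" using h(1) carrier_subgroup_generated_subset by blast
  have "carrier ?H = range (\<lambda>n::int. h [^] n)"
    using h int_pow_subgroup_generated[OF h(1)] by simp
  then have "carrier ?H \<subseteq> generate G {h}" using generate_pow[OF hG] by auto
  then show ?thesis using that[OF hG] assms by (simp add: carrier_subgroup_generated Int_absorb1)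
qed

lemma cyclic_pair_commute: "cyclic_pair G x y \<longleftrightarrow> cyclic_pair G y x"
  by (simp add: insert_commute)

lemma cyclic_pairI:
  assumes "x \<in> carrier G" "y \<in> generate G {x}"
  shows "cyclic_pair G x y"
proof -
  have y: "y \<in> carrier G" using assms generate_incl[of "{x}"] by blast
  have "generate G {x, y} \<subseteq> generate G {x}"
    using assms by (intro generate_subgroup_incl) (auto simp: generate.incl generate_is_subgroup)
  moreover have "generate G {x} \<subseteq> generate G {x, y}" by (rule mono_generate) auto
  ultimately have "subgroup_generated G {x, y} = subgroup_generated G {x}"
    using assms y by (simp add: subgroup_generated_def Int_absorb1)
  then show ?thesis using cyclic_group_generated by simp
qed

text \<open>If \<open>h [^] k\<close> is an involution, then 2 k is an odd multiple of the order of
  \<open>h\<close>, so the involution is the power of \<open>h\<close> with half the order as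
  exponent.\<close>

lemma involution_in_cyclic_unique:
  assumes h: "h \<in> carrier G" and s: "s \<in> generate G {h}" "s \<otimes> s = \<one>" "s \<noteq> \<one>"
    and t: "t \<in> generate G {h}" "t \<otimes> t = \<one>" "t \<noteq> \<one>" and fin: "finite (carrier G)"
  shows "s = t"
proof -
  have "x = h [^] (ord h div 2)" if x: "x \<in> generate G {h}" "x \<otimes> x = \<one>" "x \<noteq> \<one>" for x
  proof -
    obtain k :: nat where k: "x = h [^] k" using x(1) generate_pow_on_finite_carrier[OF fin h] by blast
    have "h [^] (2 * k) = \<one>" using x(2) h by (simp add: k nat_pow_mult mult_2)
    then have "ord h dvd 2 * k" using h by (simp add: pow_eq_id)
    moreover have "\<not> ord h dvd k" using x(3) h by (simp add: k pow_eq_id)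
    moreover from calculation(1) obtain q where q: "2 * k = ord h * q" by (rule dvdE)
    ultimately have "odd q" by (auto elim!: evenE)
    then obtain j where "q = 2 * j + 1" by (metis oddE)
    moreover have "even (ord h)" using q \<open>odd q\<close> by (metis dvd_triv_left even_mult_iff)
    ultimately have kj: "k = ord h * j + ord h div 2" using q by (auto elim!: evenE simp: algebra_simps)
    have "x = h [^] (ord h * j) \<otimes> h [^] (ord h div 2)"
      unfolding k kj using h by (simp only: nat_pow_mult)
    moreover have "h [^] (ord h * j) = \<one>" using h by (simp add: pow_eq_id)
    ultimately show ?thesis using h by simp
  qed
  then show ?thesis using s t by metis
qed

text \<open>Two different involutions certify that a pair is not cyclic. This supplies the edges
  that do not come from maximal cyclic subgroups.\<close>

lemma not_cyclic_pairI:
  assumes "finite (carrier G)" "x \<in> carrier G" "y \<in> carrier G"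
    and "s \<in> generate G {x, y}" "s \<otimes> s = \<one>" "s \<noteq> \<one>"
    and "t \<in> generate G {x, y}" "t \<otimes> t = \<one>" "t \<noteq> \<one>" and "s \<noteq> t"
  shows "\<not> cyclic_pair G x y"
proof
  assume "cyclic_pair G x y"
  then obtain h where "h \<in> carrier G" "generate G {x, y} \<subseteq> generate G {h}"
    using cyclic_pair_generator assms(2,3) by blast
  then show False using involution_in_cyclic_unique[of h s t] assms by blast
qed

lemma generate_eq_if_ord_le:
  assumes "finite (carrier G)" "h \<in> carrier G" "y \<in> generate G {h}" "ord h \<le> ord y"
  shows "generate G {y} = generate G {h}"
proof -
  have y: "y \<in> carrier G" using assms(2,3) generate_incl[of "{h}"] by blast
  have "generate G {y} \<subseteq> generate G {h}"
    using assms by (intro generate_subgroup_incl generate_is_subgroup) auto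
  moreover have "finite (generate G {h})" using assms(1,2) generate_incl[of "{h}"] finite_subset by blast
  ultimately show ?thesis
    using assms(2,4) y generate_pow_card by (metis card_seteq)
qed

text \<open>A cyclic group <h> with \<open>z\<close> and \<open>w\<close> in it contains
  \<open>y\<close>, so by maximality it equals <y>, which omits \<open>w\<close>. Here
  \<open>z\<close> is meant to range over the generators of <y>.\<close>

lemma maximal_cyclic_not_cyclic_pair:
  assumes fin: "finite (carrier G)" and y: "y \<in> carrier G"
    and max: "\<And>h. \<lbrakk>h \<in> carrier G; y \<in> generate G {h}\<rbrakk> \<Longrightarrow> ord h \<le> ord y"
    and z: "z \<in> carrier G" "y \<in> generate G {z}" and w: "w \<in> carrier G" "w \<notin> generate G {y}"
  shows "\<not> cyclic_pair G z w"
proof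
  assume "cyclic_pair G z w"
  then obtain h where h: "h \<in> carrier G" "generate G {z, w} \<subseteq> generate G {h}"
    using cyclic_pair_generator z w by blast
  have "w \<in> generate G {h}" "z \<in> generate G {h}" using h(2) generate.incl by (metis insertI1 insertI2 subsetD)+
  moreover from this have "generate G {z} \<subseteq> generate G {h}"
    using h(1) by (intro generate_subgroup_incl generate_is_subgroup) auto
  ultimately have "y \<in> generate G {h}" using z(2) by blast
  then have "generate G {y} = generate G {h}"
    using generate_eq_if_ord_le[OF fin h(1)] max[OF h(1)] by blast
  then show False using \<open>w \<in> generate G {h}\<close> w(2) by blast
qed

lemma generator_inv:
  assumes "y \<in> carrier G"
  shows "y \<in> generate G {inv y}" "generate G {inv y} = generate G {y}"
proof -
  have "inv y \<in> generate G {y}" if "y \<in> carrier G" for y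
    using generate.inv[of y "{y}" G] by simp
  then have *: "y \<in> generate G {inv y}" "inv y \<in> generate G {y}" using assms inv_closed inv_inv by metis+
  then show "y \<in> generate G {inv y}" by simp
  show "generate G {inv y} = generate G {y}"
    using * assms by (intro subset_antisym generate_subgroup_incl generate_is_subgroup) auto
qed

lemma inv_neq_self:
  assumes "y \<in> carrier G" "3 \<le> ord y"
  shows "inv y \<noteq> y"
proof
  assume "inv y = y"
  then have "y \<otimes> y = \<one>" using r_inv[OF assms(1)] by simp
  then have "y [^] (2::nat) = \<one>" using assms(1) by (simp add: numeral_2_eq_2)
  then have "ord y dvd 2" using assms by (simp add: pow_eq_id)
  then show False using assms(2) dvd_imp_le[of "ord y" 2] by simp
qed

lemma generator_pow_coprime:
  assumes "finite (carrier G)" "y \<in> carrier G" "coprime k (ord y)" "k \<noteq> 0"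
  shows "y \<in> generate G {y [^] k}"
proof -
  have "ord (y [^] k) = ord y"
    using assms by (simp add: ord_pow_gen coprime_commute)
  moreover have "y [^] k \<in> generate G {y}"
    using generate_pow_on_finite_carrier[OF assms(1,2)] by blast
  ultimately have "generate G {y [^] k} = generate G {y}"
    using assms by (intro generate_eq_if_ord_le) auto
  then show ?thesis using generate.incl[of y "{y}" G] by simp
qed

text \<open>Euler's function is at least 3 for these orders m. The exponents are 1, m - 1 and a
  third unit: 2 if m is odd, and for m = 2 n whichever of n + 1 and n + 2 is odd. For m = 6 the
  third one would be m - 1 again.\<close>

lemma three_generators:
  assumes fin: "finite (carrier G)" and g: "g \<in> carrier G" "5 \<le> ord g" "ord g \<noteq> 6"
  obtains A where "card A = 3" "A \<subseteq> carrier G" "\<forall>a\<in>A. g \<in> generate G {a}"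
proof -
  define m where "m = ord g"
  have m: "5 \<le> m" "m \<noteq> 6" using g by (auto simp: m_def)
  obtain k where k: "coprime k m" "1 < k" "k < m - 1"
  proof (cases "odd m")
    case True
    then show ?thesis using that[of 2] m by simp
  next
    case False
    then obtain n where n: "m = 2 * n" by blast
    show ?thesis
    proof (cases "odd n")
      case True
      have "gcd (n + 2) n = gcd 2 n" by (metis add.commute gcd_add1)
      then have "coprime (n + 2) n" using True by (metis coprime_iff_gcd_eq_1 coprime_left_2_iff_odd)
      moreover have "coprime (n + 2) 2" using True by simp
      ultimately have "coprime (n + 2) (2 * n)" by simp
      then show ?thesis using that[of "n + 2"] m n by auto
    next
      case False
      have "coprime (n + 1) (2 * n)" using False by simp
      then show ?thesis using that[of "n + 1"] m n by auto
    qed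
  qed
  have inj: "inj_on (\<lambda>x. g [^] x) {0..m - 1}" unfolding m_def by (rule ord_inj[OF g(1)])
  have sub: "{1, k, m - 1} \<subseteq> {0..m - 1}" using k by auto
  have cop: "coprime (m - 1) m" using m by (metis coprime_diff_one_left_nat less_le_trans zero_less_numeral)
  let ?A = "(\<lambda>x. g [^] x) ` {1, k, m - 1}"
  show ?thesis
  proof (rule that[of ?A])
    show "card ?A = 3" using k m by (subst card_image[OF inj_on_subset[OF inj sub]]) auto
    show "?A \<subseteq> carrier G" using g by auto
    show "\<forall>a\<in>?A. g \<in> generate G {a}"
    proof
      fix a assume a: "a \<in> ?A"
      obtain j where "j \<in> {1, k, m - 1}" "a = g [^] j" using a by blast
      moreover from this have "coprime j (ord g)" "j \<noteq> 0" using k cop m unfolding m_def[symmetric] by auto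
      ultimately show "g \<in> generate G {a}" using generator_pow_coprime[OF fin g(1)] by blast
    qed
  qed
qed

text \<open>By counting, the complement of \<open>M\<close> is the coset of \<open>inv x\<close>, so
  \<open>y\<close> is \<open>inv x\<close> times an element of \<open>M\<close>.\<close>

lemma index_two_mult:
  assumes fin: "finite (carrier G)" and M: "subgroup M G" "card (carrier G) = 2 * card M"
    and xy: "x \<in> carrier G - M" "y \<in> carrier G - M"
  shows "x \<otimes> y \<in> M"
proof -
  let ?C = "(\<lambda>z. inv x \<otimes> z) ` M"
  have MG: "M \<subseteq> carrier G" using M(1) subgroup.subset by blast
  have "inj_on (\<lambda>z. inv x \<otimes> z) M" using xy MG by (auto simp: inj_on_def subset_iff)
  then have card: "card ?C = card M" by (rule card_image)
  have "inv x \<otimes> z \<notin> M" if z: "z \<in> M" for z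
  proof
    assume *: "inv x \<otimes> z \<in> M"
    have "x = z \<otimes> inv (inv x \<otimes> z)"
      using xy z MG by (simp add: subset_iff inv_mult_group m_assoc[symmetric])
    then show False using xy * z M(1) by (metis DiffD2 subgroup.m_closed subgroup.m_inv_closed)
  qed
  then have dis: "M \<inter> ?C = {}" by auto
  have "M \<union> ?C \<subseteq> carrier G" using MG xy by auto
  moreover have "card (M \<union> ?C) = card (carrier G)"
    using card dis M(2) fin MG finite_subset by (subst card_Un_disjoint) auto
  ultimately have "M \<union> ?C = carrier G" using fin card_subset_eq by blast
  then obtain z where "z \<in> M" "y = inv x \<otimes> z" using xy by blast
  then have "x \<otimes> y = z" using xy MG by (auto simp: subset_iff m_assoc[symmetric])
  then show ?thesis using \<open>z \<in> M\<close> by simp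
qed

end

text \<open>Neither end of a non-cyclic pair is in the cyclicizer, and the two ends differ, so
  removing the cyclicizer loses no edges.\<close>

lemma noncyclic_graph_edges:
  assumes "group G"
  shows "snd (noncyclic_graph G) = {{x, y} |x y. x \<in> carrier G \<and> y \<in> carrier G \<and> \<not> cyclic_pair G x y}"
    and "simple_graph (noncyclic_graph G)"
proof -
  interpret group G by fact
  have *: "x \<notin> cyclicizer G" "y \<notin> cyclicizer G" "x \<noteq> y"
    if "x \<in> carrier G" "y \<in> carrier G" "\<not> cyclic_pair G x y" for x y
  proof -
    show "x \<notin> cyclicizer G" using that by (auto simp: cyclicizer_def)
    show "y \<notin> cyclicizer G" using that cyclic_pair_commute[of x y] by (auto simp: cyclicizer_def)
    show "x \<noteq> y" using that cyclic_group_generated[of x] by auto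
  qed
  show "snd (noncyclic_graph G) = {{x, y} |x y. x \<in> carrier G \<and> y \<in> carrier G \<and> \<not> cyclic_pair G x y}"
  proof (intro subset_antisym subsetI)
    fix e assume "e \<in> {{x, y} |x y. x \<in> carrier G \<and> y \<in> carrier G \<and> \<not> cyclic_pair G x y}"
    then obtain x y where "e = {x, y}" "x \<in> carrier G" "y \<in> carrier G" "\<not> cyclic_pair G x y" by blast
    then show "e \<in> snd (noncyclic_graph G)"
      using *[of x y] unfolding noncyclic_graph_def Let_def snd_conv by (intro CollectI exI[of _ x] exI[of _ y]) simp
  qed (auto simp: noncyclic_graph_def Let_def)
  show "simple_graph (noncyclic_graph G)"
    unfolding noncyclic_graph_def Let_def simple_graph_def split_conv by blast
qed

lemma noncyclic_graph_drawing:
  assumes "group G" "embeddable_in (noncyclic_graph G) (crosscap_surface 1)"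
  obtains P S where "antipodal_drawing (snd (noncyclic_graph G)) P S"
  using projective_embedding_lifts[of "fst (noncyclic_graph G)" "snd (noncyclic_graph G)"] assms
    noncyclic_graph_edges(2)[OF assms(1)] by auto

context group
begin

lemma noncyclic_edgeI:
  assumes "x \<in> carrier G" "y \<in> carrier G" "\<not> cyclic_pair G x y"
  shows "{x, y} \<in> snd (noncyclic_graph G)"
  using noncyclic_graph_edges(1)[OF group_axioms] assms by blast

lemma projective_no_K35:
  assumes emb: "embeddable_in (noncyclic_graph G) (crosscap_surface 1)"
    and AB: "A \<subseteq> carrier G" "B \<subseteq> carrier G" "3 \<le> card A" "5 \<le> card B"
    and adj: "\<And>a b. \<lbrakk>a \<in> A; b \<in> B\<rbrakk> \<Longrightarrow> \<not> cyclic_pair G a b"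
  shows False
proof -
  obtain P S where "antipodal_drawing (snd (noncyclic_graph G)) P S"
    using noncyclic_graph_drawing[OF group_axioms emb] .
  then interpret antipodal_drawing "snd (noncyclic_graph G)" P S .
  have "A \<inter> B = {}" using adj cyclic_group_generated by fastforce
  then show False
    using no_K35[OF AB(3,4)] noncyclic_edgeI adj AB(1,2) by (metis subsetD)
qed

lemma projective_no_K44:
  assumes emb: "embeddable_in (noncyclic_graph G) (crosscap_surface 1)"
    and AB: "A \<subseteq> carrier G" "B \<subseteq> carrier G" "card A = 4" "4 \<le> card B"
    and adj: "\<And>a b. \<lbrakk>a \<in> A; b \<in> B\<rbrakk> \<Longrightarrow> \<not> cyclic_pair G a b"
  shows False
proof -
  obtain P S where "antipodal_drawing (snd (noncyclic_graph G)) P S"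
    using noncyclic_graph_drawing[OF group_axioms emb] .
  then interpret antipodal_drawing "snd (noncyclic_graph G)" P S .
  have "A \<inter> B = {}" using adj cyclic_group_generated by fastforce
  moreover obtain B' where "B' \<subseteq> B" "card B' = 4" using AB(4) by (rule obtain_subset_with_card_n)
  ultimately show False
    using AB adj by (intro no_K44[of A B'] noncyclic_edgeI) blast+
qed

lemma projective_no_K7:
  assumes emb: "embeddable_in (noncyclic_graph G) (crosscap_surface 1)"
    and A: "A \<subseteq> carrier G" "7 \<le> card A"
    and adj: "\<And>a b. \<lbrakk>a \<in> A; b \<in> A; a \<noteq> b\<rbrakk> \<Longrightarrow> \<not> cyclic_pair G a b"
  shows False
proof -
  obtain P S where "antipodal_drawing (snd (noncyclic_graph G)) P S"
    using noncyclic_graph_drawing[OF group_axioms emb] .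
  then interpret antipodal_drawing "snd (noncyclic_graph G)" P S .
  show False
    using A adj by (intro no_K7[of A] noncyclic_edgeI) blast+
qed

end

section \<open>Groups whose graph is projective\<close>

context group
begin

lemma max_ord_outside:
  assumes "finite (carrier G)" "S \<subseteq> carrier G" "S \<noteq> {}"
  obtains y where "y \<in> S" "\<And>h. h \<in> S \<Longrightarrow> ord h \<le> ord y"
proof -
  have fin: "finite (ord ` S)" using assms finite_subset by blast
  have "Max (ord ` S) \<in> ord ` S" using fin assms(3) by (intro Max_in) auto
  then obtain y where "y \<in> S" "ord y = Max (ord ` S)" by force
  then show ?thesis using that[of y] fin by simp
qed

text \<open>The two subgroups share at least the identity, hence the + 1.\<close>

lemma card_cyclic_union:
  assumes fin: "finite (carrier G)" and "g \<in> carrier G" "y \<in> carrier G"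
  shows "card (carrier G) + 1 \<le> card (carrier G - (generate G {g} \<union> generate G {y})) + ord g + ord y"
proof -
  let ?M = "generate G {g}" and ?N = "generate G {y}"
  have sub: "?M \<subseteq> carrier G" "?N \<subseteq> carrier G" using assms generate_incl by auto
  then have finMN: "finite ?M" "finite ?N" using fin finite_subset by blast+
  have "card (?M \<union> ?N) + card (?M \<inter> ?N) = ord g + ord y"
    using card_Un_Int[OF finMN] assms generate_pow_card by simp
  moreover have "1 \<le> card (?M \<inter> ?N)"
    using finMN generate.one[of G] by (metis IntI One_nat_def Suc_leI card_gt_0_iff empty_iff finite_Int)
  moreover have "card (carrier G - (?M \<union> ?N)) = card (carrier G) - card (?M \<union> ?N)"
    using sub finMN by (intro card_Diff_subset) auto
  ultimately show ?thesis by linarith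
qed

text \<open>If y of order 4 lies outside the cyclic subgroup of order 6, then y^2 lies inside; otherwise
  the elements outside have order 2 or 6, and none of their powers is the involution inside.\<close>

lemma order_12_not_projective:
  assumes fin: "finite (carrier G)" and emb: "embeddable_in (noncyclic_graph G) (crosscap_surface 1)"
    and card: "card (carrier G) = 12" and g: "g \<in> carrier G" "ord g = 6"
    and max: "\<And>h. h \<in> carrier G \<Longrightarrow> ord h \<le> ord g"
  shows False
proof -
  define M where "M = generate G {g}"
  have M: "subgroup M G" "card M = 6"
    using g generate_is_subgroup[of "{g}"] generate_pow_card[OF g(1)] by (auto simp: M_def)
  have MG: "M \<subseteq> carrier G" using M(1) subgroup.subset by blast
  have finM: "finite M" using MG fin finite_subset by blast
  have gM: "g \<in> M" "inv g \<in> M" unfolding M_def by (auto intro: generate.incl generate.inv)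
  have adjM: "\<not> cyclic_pair G a w" if "a \<in> {g, inv g}" "w \<in> carrier G - M" for a w
    using maximal_cyclic_not_cyclic_pair[OF fin g(1) max, of a w] that g generator_inv(1)[OF g(1)]
      generate.incl[of g "{g}" G] by (auto simp: M_def)
  have ig: "inv g \<noteq> g" using inv_neq_self g by simp
  have sq: "x \<otimes> y \<in> M" if "x \<in> carrier G - M" "y \<in> carrier G - M" for x y
    using index_two_mult[OF fin M(1) _ that] M(2) card by simp
  show False
  proof (cases "\<exists>y\<in>carrier G - M. ord y = 4")
    case True
    then obtain y where y: "y \<in> carrier G" "y \<notin> M" "ord y = 4" by auto
    let ?N = "generate G {y}"
    \<comment> \<open>A cyclic group containing \<open>y\<close> has order divisible by 4 and at
      most 6. So <y> is maximal cyclic although \<open>g\<close> has larger order.\<close>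
    have maxy: "ord h \<le> ord y" if h: "h \<in> carrier G" "y \<in> generate G {h}" for h
    proof -
      obtain k :: nat where "y = h [^] k" using h(2) unfolding generate_pow_on_finite_carrier[OF fin h(1)] by blast
      then have "y [^] ord h = \<one>" using h(1) by (simp add: nat_pow_pow pow_eq_id)
      then have "4 dvd ord h" using y by (simp add: pow_eq_id)
      moreover have "ord h \<le> 6" "1 \<le> ord h" using max[OF h(1)] g ord_ge_1[OF fin h(1)] by auto
      ultimately have "ord h = 4" by (auto elim!: dvdE)
      then show ?thesis using y by simp
    qed
    have adjN: "\<not> cyclic_pair G a w" if "a \<in> {y, inv y}" "w \<in> carrier G - ?N" for a w
      using maximal_cyclic_not_cyclic_pair[OF fin y(1) maxy, of a w] that y generator_inv(1)[OF y(1)]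
        generate.incl[of y "{y}" G] by auto
    have NG: "?N \<subseteq> carrier G" using y generate_incl by auto
    then have finN: "finite ?N" using fin finite_subset by blast
    have cardN: "card ?N = 4" using generate_pow_card y by simp
    have y2: "y \<otimes> y \<in> M \<inter> ?N" "y \<otimes> y \<noteq> \<one>"
    proof -
      show "y \<otimes> y \<in> M \<inter> ?N" using sq y by (auto intro: generate.intros)
      have "y [^] (2::nat) \<noteq> \<one>" using y by (simp add: pow_eq_id)
      then show "y \<otimes> y \<noteq> \<one>" using y(1) by (simp add: numeral_2_eq_2)
    qed
    \<comment> \<open>With two common elements the union has at most 6 + 4 - 2 = 8 elements, which
      leaves four for K(4,4).\<close>
    have "{\<one>, y \<otimes> y} \<subseteq> M \<inter> ?N" using y2 M(1) generate.one subgroup.one_closed by fastforce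
    then have "2 \<le> card (M \<inter> ?N)" using y2(2) card_mono[of "M \<inter> ?N" "{\<one>, y \<otimes> y}"] finN by simp
    then have "card (M \<union> ?N) \<le> 8" using card_Un_Int[OF finM finN] cardN M(2) by simp
    moreover have "card (carrier G - (M \<union> ?N)) = card (carrier G) - card (M \<union> ?N)"
      using MG NG finM finN by (intro card_Diff_subset) auto
    ultimately have B: "4 \<le> card (carrier G - (M \<union> ?N))" using card by simp
    have iy: "inv y \<noteq> y" using inv_neq_self y by simp
    have "inv y \<notin> M" using y M(1) by (metis inv_inv subgroup.m_inv_closed)
    then have "g \<noteq> y" "inv g \<noteq> y" "g \<noteq> inv y" "inv g \<noteq> inv y" using gM y(1,2) g(1) by auto
    then have "card {g, inv g, y, inv y} = 4" using ig iy by auto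
    moreover have "\<not> cyclic_pair G a b" if "a \<in> {g, inv g, y, inv y}" "b \<in> carrier G - (M \<union> ?N)" for a b
      using that adjM[of a b] adjN[of a b] by auto
    ultimately show False
      using projective_no_K44[OF emb, of "{g, inv g, y, inv y}" "carrier G - (M \<union> ?N)"] B g y by auto
  next
    case False
    \<comment> \<open>The involution of \<open>M\<close>, to be the third vertex of K(3,5) beside
      \<open>g\<close> and its inverse.\<close>
    define s where "s = g [^] (3::nat)"
    have s: "s \<in> M" "s \<in> carrier G" "s \<otimes> s = \<one>" "s \<noteq> \<one>"
    proof -
      show "s \<in> M" unfolding s_def M_def using generate_pow_on_finite_carrier[OF fin g(1)] by blast
      then show "s \<in> carrier G" using MG by blast
      show "s \<otimes> s = \<one>" unfolding s_def using g by (simp add: nat_pow_mult pow_eq_id)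
      show "s \<noteq> \<one>" unfolding s_def using g by (simp add: pow_eq_id)
    qed
    \<comment> \<open>Squares lie in \<open>M\<close> by index two, so an odd power stays in the
      coset of \<open>y\<close>.\<close>
    have odd: "y [^] k \<in> carrier G - M" if yk: "y \<in> carrier G - M" "odd k" for y and k :: nat
    proof -
      obtain j where "k = 2 * j + 1" using yk(2) by (metis oddE)
      moreover have "y \<otimes> y = y [^] (2::nat)" using yk(1) by (simp add: numeral_2_eq_2)
      ultimately have "y [^] k = (y \<otimes> y) [^] j \<otimes> y"
        using yk(1) by (simp add: nat_pow_pow)
      moreover have yy: "(y \<otimes> y) [^] j \<in> M"
        by (induction j) (use M(1) sq yk(1) in \<open>auto intro: subgroup.m_closed simp: subgroup.one_closed\<close>)
      moreover have "(y \<otimes> y) [^] j \<otimes> y \<notin> M"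
      proof
        assume *: "(y \<otimes> y) [^] j \<otimes> y \<in> M"
        have "y = inv ((y \<otimes> y) [^] j) \<otimes> ((y \<otimes> y) [^] j \<otimes> y)"
          using yk(1) by (simp add: m_assoc[symmetric])
        then show False using * yy M(1) yk(1) by (metis DiffD2 subgroup.m_closed subgroup.m_inv_closed)
      qed
      ultimately show ?thesis using yk(1) by simp
    qed
    have adjs: "\<not> cyclic_pair G s y" if y: "y \<in> carrier G - M" for y
    proof -
      have "ord y \<le> 6" "1 \<le> ord y" "ord y \<noteq> 4" using max[of y] y g ord_ge_1[OF fin, of y] False by auto
      moreover have "even (ord y)"
      proof (rule ccontr)
        assume "odd (ord y)"
        then have "\<one> \<in> carrier G - M" using odd[OF y] y by fastforce
        then show False using M(1) subgroup.one_closed by auto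
      qed
      \<comment> \<open>In both cases the order is twice an odd number k, so \<open>y [^] k\<close>
        is an involution outside \<open>M\<close>, different from \<open>s\<close>.\<close>
      ultimately have "ord y = 2 \<or> ord y = 6" by (auto elim!: evenE)
      then obtain k where k: "odd k" "ord y = 2 * k" by force
      let ?t = "y [^] k"
      have t: "?t \<in> carrier G - M" using odd[OF y k(1)] .
      have "?t \<otimes> ?t = \<one>" using y k(2) by (simp add: nat_pow_mult pow_eq_id mult_2)
      moreover have "?t \<noteq> \<one>" using t subgroup.one_closed[OF M(1)] by auto
      moreover have "generate G {y} \<subseteq> generate G {s, y}" by (rule mono_generate) auto
      then have "?t \<in> generate G {s, y}"
        using generate_pow_on_finite_carrier[OF fin, of y] y by blast
      moreover have "s \<in> generate G {s, y}" by (auto intro: generate.incl)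
      ultimately show ?thesis using not_cyclic_pairI[OF fin s(2), of y s ?t] s t y by blast
    qed
    have "g [^] (2::nat) \<noteq> \<one>" using g by (simp add: pow_eq_id)
    then have "g \<noteq> s" using s(3) g(1) by (auto simp: numeral_2_eq_2)
    moreover have "inv s = s" using s by (simp add: inv_equality)
    then have "inv g \<noteq> s" using calculation g(1) inv_inv by metis
    ultimately have "card {g, inv g, s} = 3" using ig by auto
    moreover have "card (carrier G - M) = 6"
      using card M(2) MG finM by (simp add: card_Diff_subset)
    ultimately show False
      using projective_no_K35[OF emb, of "{g, inv g, s}" "carrier G - M"] adjM adjs g s by fastforce
  qed
qed

text \<open>With \<open>g\<close> of maximal order in the group and \<open>y\<close> of maximal
  order outside <g>, both generate maximal cyclic subgroups. The order is n = q *
  \<open>ord g\<close> with q at least 2. From order 3 on, large q falls to K(3,5) and leaves few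
  small cases.\<close>

lemma projective_order_cases:
  assumes fin: "finite (carrier G)" and noncyc: "\<not> cyclic_group G"
    and emb: "embeddable_in (noncyclic_graph G) (crosscap_surface 1)"
  obtains g where "g \<in> carrier G" "\<And>h. h \<in> carrier G \<Longrightarrow> ord h \<le> ord g"
    "ord g = 2 \<and> card (carrier G) = 4 \<or> ord g = 3 \<and> card (carrier G) = 6 \<or> ord g = 4 \<and> card (carrier G) = 8"
proof -
  obtain g where g: "g \<in> carrier G" and max: "\<And>h. h \<in> carrier G \<Longrightarrow> ord h \<le> ord g"
    using max_ord_outside[OF fin subset_refl] by blast
  define M where "M = generate G {g}"
  define n where "n = card (carrier G)"
  have M: "subgroup M G" "card M = ord g"
    using g generate_is_subgroup[of "{g}"] generate_pow_card[OF g] by (auto simp: M_def)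
  have MG: "M \<subseteq> carrier G" using M(1) subgroup.subset by blast
  have finM: "finite M" using MG fin finite_subset by blast
  have "M \<noteq> carrier G"
    using noncyc g unfolding cyclic_group M_def generate_pow[OF g] by (auto simp: image_def)
  then have "card M < n" unfolding n_def using MG fin by (intro psubset_card_mono) auto
  then have ne: "ord g < n" using M(2) by simp
  obtain q where q: "n = ord g * q" using ord_dvd_group_order[OF g] by (auto simp: Coset.order_def n_def)
  have m1: "1 \<le> ord g" using ord_ge_1[OF fin g] .
  have q2: "2 \<le> q" using q ne by (cases q rule: nat.exhaust; cases "q - 1") auto
  have one: "\<one> \<in> M" using M(1) subgroup.one_closed by blast
  have cB: "card (carrier G - M) = n - ord g" using M(2) MG finM by (simp add: card_Diff_subset n_def)
  have adjM: "\<not> cyclic_pair G a w" if "a \<in> carrier G" "g \<in> generate G {a}" "w \<in> carrier G - M" for a w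
    using maximal_cyclic_not_cyclic_pair[OF fin g max, of a w] that by (auto simp: M_def)
  obtain y where y: "y \<in> carrier G - M" and ymax: "\<And>h. h \<in> carrier G - M \<Longrightarrow> ord h \<le> ord y"
    using max_ord_outside[OF fin, of "carrier G - M"] \<open>M \<noteq> carrier G\<close> MG by blast
  define N where "N = generate G {y}"
  have yG: "y \<in> carrier G" using y by blast
  \<comment> \<open>An element whose powers include \<open>y\<close> is itself outside
    \<open>M\<close>, where \<open>y\<close> has maximal order.\<close>
  have maxy: "ord h \<le> ord y" if "h \<in> carrier G" "y \<in> generate G {h}" for h
  proof -
    have "h \<notin> M"
    proof
      assume "h \<in> M"
      then have "generate G {h} \<subseteq> M" using M(1) by (intro generate_subgroup_incl) auto
      then show False using that y by blast
    qed
    then show ?thesis using ymax that by blast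
  qed
  have adjN: "\<not> cyclic_pair G a w" if "a \<in> carrier G" "y \<in> generate G {a}" "w \<in> carrier G - N" for a w
    using maximal_cyclic_not_cyclic_pair[OF fin yG maxy, of a w] that by (auto simp: N_def)
  have gen: "g \<in> generate G {g}" "y \<in> generate G {y}" by (auto intro: generate.incl)
  note gi = generator_inv(1)[OF g] generator_inv(1)[OF yG]
  have gM: "g \<in> M" "inv g \<in> M" unfolding M_def by (auto intro: generate.incl generate.inv)
  have ord_y: "ord y \<le> ord g" using max yG by blast
  have cMN: "n + 1 \<le> card (carrier G - (M \<union> N)) + ord g + ord y"
    using card_cyclic_union[OF fin g yG] by (simp add: n_def M_def N_def)
  \<comment> \<open>The bound leaves five elements outside <g> and <y>, all adjacent to
    \<open>g\<close>, its inverse and \<open>y\<close>.\<close>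
  have K35: False if "3 \<le> ord g" "ord g + ord y + 4 \<le> n"
  proof -
    have "g \<noteq> y" "inv g \<noteq> y" using gM y by auto
    then have "card {g, inv g, y} = 3" using inv_neq_self[OF g that(1)] by auto
    moreover have "5 \<le> card (carrier G - (M \<union> N))" using cMN that by linarith
    moreover have "\<not> cyclic_pair G a b" if "a \<in> {g, inv g, y}" "b \<in> carrier G - (M \<union> N)" for a b
      using that adjM[of g b] adjM[of "inv g" b] adjN[of y b] gen gi g yG by auto
    ultimately show False
      using projective_no_K35[OF emb, of "{g, inv g, y}" "carrier G - (M \<union> N)"] g yG by auto
  qed
  consider "5 \<le> ord g" "ord g \<noteq> 6" | "ord g = 1" | "ord g = 2" | "ord g = 3" | "ord g = 4" | "ord g = 6"
    using m1 by linarith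
  then show ?thesis
  proof cases
    case 1
    obtain A where A: "card A = 3" "A \<subseteq> carrier G" "\<forall>a\<in>A. g \<in> generate G {a}"
      by (rule three_generators[OF fin g 1])
    have "ord g * 2 \<le> n" using q q2 by simp
    then have "5 \<le> card (carrier G - M)" using cB 1 by linarith
    moreover have "\<not> cyclic_pair G a b" if "a \<in> A" "b \<in> carrier G - M" for a b
      using adjM[of a b] that A by blast
    ultimately have False using projective_no_K35[OF emb A(2), of "carrier G - M"] A(1) by simp
    then show ?thesis ..
  next
    case 2
    have "y = \<one>" using ord_eq_1[OF yG] ord_ge_1[OF fin yG] ord_y 2 by simp
    then show ?thesis using y one by blast
  next
    case 3
    have xx: "x \<otimes> x = \<one>" if "x \<in> carrier G" for x
    proof -
      have "ord x = 1 \<or> ord x = 2" using max[OF that] ord_ge_1[OF fin that] 3 by linarith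
      then have "ord x dvd 2" by auto
      then have "x [^] (2::nat) = \<one>" using that by (simp add: pow_eq_id)
      then show ?thesis using that by (simp add: numeral_2_eq_2)
    qed
    have inv_id: "inv x = x" if "x \<in> carrier G" for x using xx that by (simp add: inv_equality)
    have comm: "x \<otimes> z = z \<otimes> x" if "x \<in> carrier G" "z \<in> carrier G" for x z
      using that inv_mult_group[of x z] inv_id[of "x \<otimes> z"] inv_id by simp
    have lc: "x \<otimes> (x \<otimes> z) = z" if "x \<in> carrier G" "z \<in> carrier G" for x z
      using that xx by (simp add: m_assoc[symmetric])
    have lc2: "x \<otimes> (z \<otimes> x) = z" "x \<otimes> z \<otimes> x = z" if "x \<in> carrier G" "z \<in> carrier G" for x z
      using that lc[of x z] comm[of z x] comm[of "x \<otimes> z" x] by simp_all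
    \<comment> \<open>All elements square to the identity. This Klein four-group shows that 4
      divides n, and from n = 8 on the non-identity elements, pairwise adjacent, contain
      K(7).\<close>
    let ?H = "{\<one>, g, y, g \<otimes> y}"
    have "subgroup ?H G"
    proof (rule subgroupI)
      fix a assume "a \<in> ?H" then show "inv a \<in> ?H" using inv_id g yG by auto
    next
      fix a b assume "a \<in> ?H" "b \<in> ?H"
      then show "a \<otimes> b \<in> ?H"
        using g yG by (auto simp: xx lc lc2 comm[of y g] m_assoc)
    qed (use g yG in auto)
    then have "card ?H dvd n" using lagrange[of ?H] by (metis dvd_triv_right n_def Coset.order_def)
    moreover have "card ?H = 4"
    proof -
      have ng: "g \<noteq> \<one>" "y \<noteq> \<one>" "y \<noteq> g" using 3 y gM one by auto
      moreover have "g \<otimes> y \<noteq> \<one>" "g \<otimes> y \<noteq> g" using lc[OF g yG] g ng by (auto simp: xx)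
      moreover have "g \<otimes> y \<noteq> y"
      proof
        assume "g \<otimes> y = y"
        then have "g \<otimes> y \<otimes> y = \<one>" using xx yG by simp
        then show False using g yG ng by (simp add: m_assoc xx)
      qed
      ultimately show ?thesis by (auto simp: card_insert_if)
    qed
    ultimately have "4 dvd n" by simp
    then have "n = 4 \<or> 8 \<le> n" using ne by (auto elim!: dvdE)
    moreover have False if "8 \<le> n"
    proof (rule projective_no_K7[OF emb, of "carrier G - {\<one>}"])
      show "7 \<le> card (carrier G - {\<one>})" using that fin by (simp add: n_def card_Diff_subset)
      fix a b assume ab: "a \<in> carrier G - {\<one>}" "b \<in> carrier G - {\<one>}" "a \<noteq> b"
      then show "\<not> cyclic_pair G a b"
        using not_cyclic_pairI[OF fin, of a b a b] xx by (auto intro: generate.incl)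
    qed auto
    ultimately show ?thesis using that g max 3 unfolding n_def by blast
  next
    case 4
    consider "q = 2" | "q = 3" | "4 \<le> q" using q2 by linarith
    then show ?thesis
    proof cases
      case 1
      then show ?thesis using that[OF g max] 4 q by (simp add: n_def)
    next
      case 2
      \<comment> \<open>Here the bound of \<open>K35\<close> is missed by one. But \<open>y\<close>
        has order 3 too, so its inverse joins the small part, and four elements remain outside <g>
        and <y>.\<close>
      have "n = 9" using q 4 2 by simp
      then have "ord y dvd 9" using ord_dvd_group_order[OF yG] by (simp add: Coset.order_def n_def)
      then have "ord y \<noteq> 2" by auto
      moreover have "ord y \<noteq> 1" using ord_eq_1[OF yG] y one by auto
      ultimately have oy: "ord y = 3" using ord_y 4 ord_ge_1[OF fin yG] by linarith
      have "inv y \<notin> M" using y M(1) by (metis DiffD1 DiffD2 inv_inv subgroup.m_inv_closed)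
      then have "g \<noteq> y" "inv g \<noteq> y" "g \<noteq> inv y" "inv g \<noteq> inv y" using gM y g yG by auto
      then have "card {g, inv g, y, inv y} = 4"
        using inv_neq_self[OF g] inv_neq_self[OF yG] 4 oy by auto
      moreover have "4 \<le> card (carrier G - (M \<union> N))" 
        using cMN 4 oy \<open>n = 9\<close> by linarith
      moreover have "\<not> cyclic_pair G a b" if "a \<in> {g, inv g, y, inv y}" "b \<in> carrier G - (M \<union> N)" for a b
        using that adjM[of g b] adjM[of "inv g" b] adjN[of y b] adjN[of "inv y" b] gen gi g yG by auto
      ultimately have False
        using projective_no_K44[OF emb, of "{g, inv g, y, inv y}" "carrier G - (M \<union> N)"] g yG by auto
      then show ?thesis ..
    next
      case 3
      then show ?thesis using K35 4 ord_y q by auto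
    qed
  next
    case 5
    consider "q = 2" | "3 \<le> q" using q2 by linarith
    then show ?thesis
    proof cases
      case 1
      then show ?thesis using that[OF g max] 5 q by (simp add: n_def)
    next
      case 2
      then show ?thesis using K35 5 ord_y q by auto
    qed
  next
    case 6
    consider "q = 2" | "3 \<le> q" using q2 by linarith
    then show ?thesis
    proof cases
      case 1
      then show ?thesis using order_12_not_projective[OF fin emb _ g 6 max] 6 q by (simp add: n_def)
    next
      case 2
      then show ?thesis using K35 6 ord_y q by auto
    qed
  qed
qed

end

section \<open>Fitting noncyclic graphs into the drawn patterns\<close>

text \<open>The blocks \<open>B k\<close> may overlap: each element is assigned to one block that
  contains it and then sent injectively to the slots of that block. Disjoint slot sets make the
  union of these maps injective.\<close>

lemma block_injection:
  fixes B :: "nat \<Rightarrow> 'a set" and S :: "nat \<Rightarrow> 'b set"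
  assumes fin: "\<And>k. k \<in> K \<Longrightarrow> finite (B k) \<and> finite (S k) \<and> card (B k) \<le> card (S k)"
    and dis: "\<And>k l. \<lbrakk>k \<in> K; l \<in> K; k \<noteq> l\<rbrakk> \<Longrightarrow> S k \<inter> S l = {}"
  obtains f where "inj_on f (\<Union>k\<in>K. B k)" "\<And>x. x \<in> (\<Union>k\<in>K. B k) \<Longrightarrow> \<exists>k\<in>K. x \<in> B k \<and> f x \<in> S k"
proof -
  have "\<forall>k\<in>K. \<exists>f. f ` B k \<subseteq> S k \<and> inj_on f (B k)" using fin card_le_inj by blast
  then obtain F where F: "\<And>k. k \<in> K \<Longrightarrow> F k ` B k \<subseteq> S k \<and> inj_on (F k) (B k)"
    unfolding bchoice_iff by blast
  have "\<forall>x\<in>(\<Union>k\<in>K. B k). \<exists>k. k \<in> K \<and> x \<in> B k" by blast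
  then obtain i where i: "\<And>x. x \<in> (\<Union>k\<in>K. B k) \<Longrightarrow> i x \<in> K \<and> x \<in> B (i x)"
    unfolding bchoice_iff by blast
  let ?f = "\<lambda>x. F (i x) x"
  have fS: "?f x \<in> S (i x)" if "x \<in> (\<Union>k\<in>K. B k)" for x using F i[OF that] by blast
  show ?thesis
  proof (rule that[of ?f])
    show "inj_on ?f (\<Union>k\<in>K. B k)"
    proof (rule inj_onI)
      fix x y assume x: "x \<in> (\<Union>k\<in>K. B k)" and y: "y \<in> (\<Union>k\<in>K. B k)" and eq: "?f x = ?f y"
      have "i x = i y" using fS[OF x] fS[OF y] eq dis i[OF x] i[OF y] by (metis disjoint_iff)
      then show "x = y" using eq F[of "i x"] i[OF x] i[OF y] by (metis inj_onD)
    qed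
  qed (use i fS in blast)
qed

text \<open>The pattern may lack edges only inside slot sets \<open>S k\<close> with
  \<open>k \<in> K'\<close>. No edge of the graph falls there, as elements of such a block form
  cyclic pairs. The other blocks only limit how many elements there are.\<close>

lemma noncyclic_graph_embeds:
  fixes G (structure) and S :: "nat \<Rightarrow> nat set"
  assumes "group G"
    and pattern: "embeddable_in ({..<n}, (\<lambda>(i, j, s). {i, j}) ` set es) X"
    and S: "\<And>k. k \<in> K \<Longrightarrow> S k \<subseteq> {..<n}" "\<And>k l. \<lbrakk>k \<in> K; l \<in> K; k \<noteq> l\<rbrakk> \<Longrightarrow> S k \<inter> S l = {}"
    and adj: "\<And>i j. \<lbrakk>i < j; j < n; \<not> (\<exists>k\<in>K'. i \<in> S k \<and> j \<in> S k)\<rbrakk> \<Longrightarrow> \<exists>s. (i, j, s) \<in> set es"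
    and K': "K' \<subseteq> K"
    and B: "\<And>k. k \<in> K \<Longrightarrow> finite (B k) \<and> card (B k) \<le> card (S k)"
    and cover: "carrier G - cyclicizer G \<subseteq> (\<Union>k\<in>K. B k)"
    and indep: "\<And>k x y. \<lbrakk>k \<in> K'; x \<in> B k; y \<in> B k\<rbrakk> \<Longrightarrow> cyclic_pair G x y"
  shows "embeddable_in (noncyclic_graph G) X"
proof -
  interpret group G by fact
  have "finite (S k)" if "k \<in> K" for k using S(1)[OF that] finite_subset by blast
  then obtain f where f: "inj_on f (\<Union>k\<in>K. B k)" "\<And>x. x \<in> (\<Union>k\<in>K. B k) \<Longrightarrow> \<exists>k\<in>K. x \<in> B k \<and> f x \<in> S k"
    using block_injection[of K B S] B S(2) by metis
  obtain V E where VE: "noncyclic_graph G = (V, E)" by fastforce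
  have V: "V = carrier G - cyclicizer G" using VE by (simp add: noncyclic_graph_def Let_def)
  show ?thesis
    unfolding VE
  proof (rule embeddable_in_subgraph[OF pattern])
    show "inj_on f V" using f(1) cover V inj_on_subset by blast
    show "f ` V \<subseteq> {..<n}"
    proof
      fix i assume "i \<in> f ` V"
      then obtain x where "x \<in> V" "i = f x" by blast
      moreover from this have "x \<in> (\<Union>k\<in>K. B k)" using cover V by blast
      ultimately obtain k where "k \<in> K" "i \<in> S k" using f(2)[of x] by blast
      then show "i \<in> {..<n}" using S(1)[of k] by blast
    qed
    fix e assume e: "e \<in> E"
    then obtain x y where xy: "e = {x, y}" "\<not> cyclic_pair G x y" "x \<in> V" "y \<in> V" "x \<noteq> y"
      using VE unfolding noncyclic_graph_def Let_def by blast
    have xB: "x \<in> (\<Union>k\<in>K. B k)" "y \<in> (\<Union>k\<in>K. B k)" using xy cover V by auto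
    obtain k l where k: "k \<in> K" "x \<in> B k" "f x \<in> S k" and l: "l \<in> K" "y \<in> B l" "f y \<in> S l"
      using f(2)[OF xB(1)] f(2)[OF xB(2)] by blast
    have "\<not> (\<exists>j\<in>K'. f x \<in> S j \<and> f y \<in> S j)"
    proof
      assume "\<exists>j\<in>K'. f x \<in> S j \<and> f y \<in> S j"
      then obtain j where j: "j \<in> K'" "f x \<in> S j" "f y \<in> S j" by blast
      then have "j = k" "j = l" using S(2) k l K' by blast+
      then show False using indep[OF j(1), of x y] k l xy by blast
    qed
    moreover have "f x \<noteq> f y" using f(1) xB xy(5) by (auto dest: inj_onD)
    moreover have "f x < n" "f y < n" using k l S(1) by blast+
    ultimately have "(\<exists>s. (f x, f y, s) \<in> set es) \<or> (\<exists>s. (f y, f x, s) \<in> set es)"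
      using adj[of "f x" "f y"] adj[of "f y" "f x"] by (metis linorder_neqE_nat)
    then have "{f x, f y} \<in> (\<lambda>(i, j, s). {i, j}) ` set es" by (force simp: image_iff insert_commute)
    then show "e \<subseteq> V \<and> f ` e \<in> (\<lambda>(i, j, s). {i, j}) ` set es" using xy by auto
  qed
qed

lemma bipyramid_adjacent:
  assumes "i < j" "j < 5" "\<not> (i \<in> {0, 1} \<and> j \<in> {0, 1})"
  shows "\<exists>s. (i, j, s) \<in> set bipyramid_edges"
proof -
  have "i = 0 \<or> i = 1 \<or> i = 2 \<or> i = 3 \<or> i = 4" "j = 0 \<or> j = 1 \<or> j = 2 \<or> j = 3 \<or> j = 4"
    using assms by presburger+
  then show ?thesis using assms(1,3) by (elim disjE) (simp_all add: bipyramid_edges_def)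
qed

lemma cube_adjacent:
  assumes "i < j" "j < 7" "\<not> (i \<in> {4, 5, 6} \<and> j \<in> {4, 5, 6})"
  shows "\<exists>s. (i, j, s) \<in> set cube_edges"
proof -
  have "i = 0 \<or> i = 1 \<or> i = 2 \<or> i = 3 \<or> i = 4 \<or> i = 5 \<or> i = 6" "j = 0 \<or> j = 1 \<or> j = 2 \<or> j = 3 \<or> j = 4 \<or> j = 5 \<or> j = 6"
    using assms by presburger+
  then show ?thesis using assms(1,3) by (elim disjE) (simp_all add: cube_edges_def)
qed

lemma octahedron_adjacent:
  assumes "i < j" "j < 6" "\<not> (\<exists>k\<in>{0, 1, 2}. i \<in> {2 * k, 2 * k + 1} \<and> j \<in> {2 * k, 2 * k + 1})"
  shows "\<exists>s. (i, j, s) \<in> set octahedron_edges"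
proof -
  have "i = 0 \<or> i = 1 \<or> i = 2 \<or> i = 3 \<or> i = 4 \<or> i = 5" "j = 0 \<or> j = 1 \<or> j = 2 \<or> j = 3 \<or> j = 4 \<or> j = 5"
    using assms by presburger+
  then show ?thesis using assms(1,3) by (elim disjE) (simp_all add: octahedron_edges_def)
qed

context group
begin

lemma one_in_cyclicizer: "\<one> \<in> cyclicizer G"
proof -
  have "cyclic_pair G \<one> b" if "b \<in> carrier G" for b
    using cyclic_pairI[OF that, of \<one>] generate.one cyclic_pair_commute by metis
  then show ?thesis by (simp add: cyclicizer_def)
qed

text \<open>The pairwise cyclic elements are put at the apexes of the bipyramid, the others on the
  triangle.\<close>

lemma planar_if_two_blocks:
  assumes "carrier G - {\<one>} \<subseteq> U \<union> W" "finite U" "finite W" "card U \<le> 2" "card W \<le> 3"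
    and "\<And>x y. \<lbrakk>x \<in> U; y \<in> U\<rbrakk> \<Longrightarrow> cyclic_pair G x y"
  shows "embeddable_in (noncyclic_graph G) (crosscap_surface 0)"
proof (rule noncyclic_graph_embeds[OF group_axioms bipyramid_drawing, where K = "{0, 1}" and K' = "{0}"
      and S = "\<lambda>k. if k = 0 then {0, 1} else {2, 3, 4}" and B = "\<lambda>k. if k = 0 then U else W"])
  show "\<exists>s. (i, j, s) \<in> set bipyramid_edges"
    if "i < j" "j < 5" "\<not> (\<exists>k\<in>{0::nat}. i \<in> (if k = 0 then {0, 1} else {2, 3, 4}) \<and>
      j \<in> (if k = 0 then {0, 1} else {2, 3, 4}))" for i j
    using bipyramid_adjacent[of i j] that by simp
qed (use assms one_in_cyclicizer in \<open>auto split: if_splits\<close>)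

text \<open>The pairwise cyclic elements are put at the face centres of the cube, the others at its
  vertices.\<close>

lemma projective_if_two_blocks:
  assumes "carrier G - {\<one>} \<subseteq> U \<union> W" "finite U" "finite W" "card U \<le> 3" "card W \<le> 4"
    and "\<And>x y. \<lbrakk>x \<in> U; y \<in> U\<rbrakk> \<Longrightarrow> cyclic_pair G x y"
  shows "embeddable_in (noncyclic_graph G) (crosscap_surface 1)"
proof (rule noncyclic_graph_embeds[OF group_axioms cube_drawing, where K = "{0, 1}" and K' = "{0}"
      and S = "\<lambda>k. if k = 0 then {4, 5, 6} else {0, 1, 2, 3}" and B = "\<lambda>k. if k = 0 then U else W"])
  show "\<exists>s. (i, j, s) \<in> set cube_edges"
    if "i < j" "j < 7" "\<not> (\<exists>k\<in>{0::nat}. i \<in> (if k = 0 then {4, 5, 6} else {0, 1, 2, 3}) \<and>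
      j \<in> (if k = 0 then {4, 5, 6} else {0, 1, 2, 3}))" for i j
    using cube_adjacent[of i j] that by simp
qed (use assms one_in_cyclicizer in \<open>auto split: if_splits\<close>)

text \<open>An element and its inverse occupy opposite vertices of the octahedron.\<close>

lemma planar_if_three_pairs:
  assumes "carrier G - cyclicizer G \<subseteq> {a, inv a} \<union> {b, inv b} \<union> {c, inv c}"
    and abc: "a \<in> carrier G" "b \<in> carrier G" "c \<in> carrier G"
  shows "embeddable_in (noncyclic_graph G) (crosscap_surface 0)"
proof (rule noncyclic_graph_embeds[OF group_axioms octahedron_drawing, where K = "{0, 1, 2}" and K' = "{0, 1, 2}"
      and S = "\<lambda>k. {2 * k, 2 * k + 1}" and B = "\<lambda>k. if k = 0 then {a, inv a} else if k = 1 then {b, inv b} else {c, inv c}"])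
  show "\<exists>s. (i, j, s) \<in> set octahedron_edges"
    if "i < j" "j < 6" "\<not> (\<exists>k\<in>{0, 1, 2}. i \<in> {2 * k, 2 * k + 1} \<and> j \<in> {2 * k, 2 * k + 1})" for i j
    using octahedron_adjacent[OF that] .
  have "cyclic_pair G x y" if "z \<in> carrier G" "x \<in> {z, inv z}" "y \<in> {z, inv z}" for x y z
  proof -
    have "y \<in> generate G {x}"
      using that generator_inv(1)[OF that(1)] by (auto intro: generate.incl generate.inv)
    then show ?thesis using cyclic_pairI[of x y] that by auto
  qed
  then show "cyclic_pair G x y" if "k \<in> {0, 1, 2}" "x \<in> (if k = 0 then {a, inv a} else if k = 1 then {b, inv b} else {c, inv c})"
     "y \<in> (if k = 0 then {a, inv a} else if k = 1 then {b, inv b} else {c, inv c})" for k :: nat and x y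
    using that abc by (auto split: if_splits)
  show "finite (if k = 0 then {a, inv a} else if k = 1 then {b, inv b} else {c, inv c}) \<and>
    card (if k = 0 then {a, inv a} else if k = 1 then {b, inv b} else {c, inv c}) \<le> card {2 * k, 2 * k + 1}" for k :: nat
    by (auto simp: card_insert_if)
  show "carrier G - cyclicizer G \<subseteq> (\<Union>k\<in>{0, 1, 2::nat}. if k = 0 then {a, inv a} else if k = 1 then {b, inv b} else {c, inv c})"
    using assms(1) by auto
qed auto

section \<open>Elements of order 4 and groups of order 8\<close>

lemma powers_of_order_4:
  assumes fin: "finite (carrier G)" and g: "g \<in> carrier G" "ord g = 4"
  shows "generate G {g} = {\<one>, g, g \<otimes> g, inv g}" "g \<otimes> g \<noteq> \<one>" "g \<otimes> g \<otimes> (g \<otimes> g) = \<one>" "g \<otimes> (g \<otimes> g) = inv g"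
proof -
  have p: "g [^] (2::nat) = g \<otimes> g" "g [^] (3::nat) = g \<otimes> (g \<otimes> g)" "g [^] (4::nat) = g \<otimes> g \<otimes> (g \<otimes> g)"
    using g by (simp_all add: numeral_eq_Suc m_assoc)
  show "g \<otimes> g \<noteq> \<one>" "g \<otimes> g \<otimes> (g \<otimes> g) = \<one>"
    using g pow_eq_id[OF g(1), of 2] pow_eq_id[OF g(1), of 4] by (simp_all add: p)
  then show i: "g \<otimes> (g \<otimes> g) = inv g" using g by (metis inv_equality m_assoc m_closed)
  have "{0..ord g - 1} = {0, 1, 2, 3}" using g by auto
  then have "generate G {g} = (\<lambda>k. g [^] k) ` {0, 1, 2, 3::nat}"
    unfolding generate_pow_on_finite_carrier[OF fin g(1)] ord_elems[OF fin g(1)] by (simp only: setcompr_eq_image Collect_mem_eq)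
  then show "generate G {g} = {\<one>, g, g \<otimes> g, inv g}" using p i g by simp
qed

lemma ord_4I:
  assumes "g \<in> carrier G" "g \<otimes> g \<noteq> \<one>" "g \<otimes> g \<otimes> (g \<otimes> g) = \<one>"
  shows "ord g = 4"
proof -
  have "g [^] (4::nat) = \<one>" "g [^] (2::nat) \<noteq> \<one>" using assms by (simp_all add: numeral_eq_Suc m_assoc)
  then have d: "ord g dvd 4" "\<not> ord g dvd 2" using assms(1) by (simp_all add: pow_eq_id)
  have "ord g \<le> 4" using dvd_imp_le[OF d(1)] by simp
  moreover have "ord g \<noteq> 0" using d(1) by (metis dvd_0_left_iff zero_neq_numeral)
  ultimately have "ord g = 1 \<or> ord g = 2 \<or> ord g = 3 \<or> ord g = 4" by linarith
  then show ?thesis using d by auto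
qed

text \<open>The non-identity powers of \<open>g\<close> are three pairwise cyclic elements, and four
  elements lie outside <g>.\<close>

lemma projective_order_8:
  assumes fin: "finite (carrier G)" and card: "card (carrier G) = 8" and g: "g \<in> carrier G" "ord g = 4"
  shows "embeddable_in (noncyclic_graph G) (crosscap_surface 1)"
proof -
  note p = powers_of_order_4[OF fin g]
  let ?M = "generate G {g}"
  have MG: "?M \<subseteq> carrier G" using g generate_incl by auto
  have finM: "finite ?M" using p(1) by simp
  have cM: "card ?M = 4" using generate_pow_card g by simp
  show ?thesis
  proof (rule projective_if_two_blocks[of "{g, g \<otimes> g, inv g}" "carrier G - ?M"])
    show "carrier G - {\<one>} \<subseteq> {g, g \<otimes> g, inv g} \<union> (carrier G - ?M)" using p(1) by auto
    show "card {g, g \<otimes> g, inv g} \<le> 3" by (simp add: card_insert_if)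
    show "card (carrier G - ?M) \<le> 4" using card cM MG finM by (simp add: card_Diff_subset)
    have gen: "y \<in> generate G {x}" if "x \<in> {g, inv g}" "y \<in> ?M" for x y
      using that generator_inv(2)[OF g(1)] by auto
    show "cyclic_pair G x y" if xy: "x \<in> {g, g \<otimes> g, inv g}" "y \<in> {g, g \<otimes> g, inv g}" for x y
    proof -
      have "x \<in> ?M" "y \<in> ?M" "x \<in> carrier G" "y \<in> carrier G" using xy p(1) g by auto
      then show ?thesis
        using cyclic_pairI[of x y] cyclic_pairI[of y x] cyclic_pair_commute[of x y] gen[of x y] gen[of y x] xy
          cyclic_group_generated[of x] by fastforce
    qed
  qed (use fin in auto)
qed

text \<open>K(3,3) has the parts \<open>g\<close>, \<open>inv g\<close>, \<open>t\<close> and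
  \<open>t \<otimes> g\<close>, \<open>t \<otimes> inv g\<close>,
  \<open>t \<otimes> (g \<otimes> g)\<close>. Two elements from different parts generate both
  \<open>t\<close> and \<open>g \<otimes> g\<close>, which are different involutions.\<close>

lemma order_8_not_planar:
  assumes fin: "finite (carrier G)" and g: "g \<in> carrier G" "g \<otimes> g \<noteq> \<one>" "g \<otimes> g \<otimes> (g \<otimes> g) = \<one>"
    and t: "t \<in> carrier G" "t \<otimes> t = \<one>" "t \<noteq> \<one>" "t \<noteq> g \<otimes> g"
  shows "\<not> embeddable_in (noncyclic_graph G) (crosscap_surface 0)"
proof
  assume emb: "embeddable_in (noncyclic_graph G) (crosscap_surface 0)"
  note p = powers_of_order_4[OF fin g(1) ord_4I[OF g]]
  let ?A = "{g, inv g, t}" and ?X = "{g, inv g, g \<otimes> g}"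
  let ?B = "(\<lambda>x. t \<otimes> x) ` ?X"
  have G: "?A \<subseteq> carrier G" "?X \<subseteq> carrier G" "?B \<subseteq> carrier G" using g t by auto
  have adj: "\<not> cyclic_pair G a b" if a: "a \<in> ?A" and b: "b \<in> ?B" for a b
  proof -
    obtain x where x: "x \<in> ?X" "b = t \<otimes> x" using b by blast
    have ab: "a \<in> carrier G" "b \<in> carrier G" "x \<in> carrier G" using a b x G by auto
    let ?H = "generate G {a, b}"
    interpret H: subgroup ?H G using ab by (intro generate_is_subgroup) auto
    have H: "a \<in> ?H" "b \<in> ?H" by (auto intro: generate.incl)
    have "t \<in> ?H \<and> g \<otimes> g \<in> ?H"
    proof (cases "a = t")
      case True
      have "t \<otimes> b = x" using x(2) t ab by (simp add: m_assoc[symmetric])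
      then have xH: "x \<in> ?H" using H True H.m_closed by metis
      have "g \<in> ?H \<or> g \<otimes> g \<in> ?H" using xH x(1) H.m_inv_closed[OF xH] inv_inv[OF g(1)] by (metis empty_iff insert_iff)
      then show ?thesis using H True H.m_closed by blast
    next
      case False
      then have gH: "g \<in> ?H" using a H(1) H.m_inv_closed[OF H(1)] inv_inv[OF g(1)] by (metis empty_iff insert_iff)
      then have "x \<in> ?H" using x(1) H.m_closed H.m_inv_closed by blast
      moreover have "t = b \<otimes> inv x" using x(2) t ab by (simp add: m_assoc)
      ultimately show ?thesis using H gH H.m_closed H.m_inv_closed by metis
    qed
    then show ?thesis using not_cyclic_pairI[OF fin ab(1,2), of t "g \<otimes> g"] t g by blast
  qed
  have dA: "g \<noteq> inv g" "t \<noteq> g" "t \<noteq> inv g"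
  proof -
    show "g \<noteq> inv g" using g r_inv by metis
    show "t \<noteq> g" using t g by auto
    then show "t \<noteq> inv g" using t g by (metis inv_equality inv_inv)
  qed
  have dX: "g \<noteq> g \<otimes> g" "inv g \<noteq> g \<otimes> g"
  proof -
    have g1: "g \<noteq> \<one>" using g by auto
    then show "g \<noteq> g \<otimes> g" using g(1) by simp
    show "inv g \<noteq> g \<otimes> g"
    proof
      assume "inv g = g \<otimes> g"
      then have "g \<otimes> (g \<otimes> g) = g \<otimes> g" using p(4) by simp
      then show False using g(1) g1 by simp
    qed
  qed
  have "card ?A = 3" using dA by auto
  moreover have "card ?B = 3"
  proof -
    have "inj_on (\<lambda>x. t \<otimes> x) ?X" using t(1) G(2) by (auto simp: inj_on_def subset_iff)
    then have "card ?B = card ?X" by (rule card_image)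
    then show ?thesis using dA dX by auto
  qed
  moreover have "?A \<inter> ?B = {}"
  proof -
    have "a \<noteq> b" if "a \<in> ?A" "b \<in> ?B" for a b
      using adj[OF that] cyclic_group_generated[of a] by auto
    then show ?thesis by blast
  qed
  moreover have "{a, b} \<in> snd (noncyclic_graph G)" if "a \<in> ?A" "b \<in> ?B" for a b
    using noncyclic_edgeI[of a b] adj[OF that] that G by blast
  ultimately show False
    using K33_not_in_sphere[of "fst (noncyclic_graph G)" "snd (noncyclic_graph G)" ?A ?B] emb
      noncyclic_graph_edges(2)[OF group_axioms] by simp
qed

lemma iso_if_injective_hom:
  assumes fin: "finite (carrier G)" and H: "group H" "finite (carrier H)" "card (carrier H) = card (carrier G)"
    and f: "\<And>x. x \<in> carrier H \<Longrightarrow> f x \<in> carrier G" "inj_on f (carrier H)"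
    "\<And>x y. \<lbrakk>x \<in> carrier H; y \<in> carrier H\<rbrakk> \<Longrightarrow> f (x \<otimes>\<^bsub>H\<^esub> y) = f x \<otimes> f y"
  shows "G \<cong> H"
proof -
  have "f ` carrier H = carrier G"
    using f(1,2) H fin by (intro card_subset_eq) (auto simp: card_image)
  then have "f \<in> iso H G" using f by (auto simp: iso_def hom_def bij_betw_def)
  then have "H \<cong> G" by (rule is_isoI)
  then show ?thesis by (rule group.iso_sym[OF H(1)])
qed

text \<open>Every element is uniquely a power of \<open>g\<close> with exponent below 4, possibly
  times \<open>t\<close>, and the relation between \<open>t\<close> and \<open>g\<close> determines
  all products: commuting gives the direct product, where the first coordinate counts
  \<open>t\<close>, and inverting gives the dihedral group.\<close>

lemma order_8_iso:
  assumes fin: "finite (carrier G)" and card: "card (carrier G) = 8" and g: "g \<in> carrier G" "ord g = 4"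
    and t: "t \<in> carrier G" "t \<notin> generate G {g}" "t \<otimes> t = \<one>" and conj: "t \<otimes> g = g \<otimes> t \<or> t \<otimes> g = inv g \<otimes> t"
  shows "G \<cong> integer_mod_group 2 \<times>\<times> integer_mod_group 4 \<or> G \<cong> dihedral_group 4"
proof -
  have pw: "g [^] (k mod 4) = g [^] k" for k :: int
    using g by (simp add: int_pow_eq)
  define f where "f i s = g [^] i \<otimes> (if s then t else \<one>)" for i :: int and s
  have fG: "f i s \<in> carrier G" for i s using g t by (simp add: f_def)
  have f_eq: "i = j \<and> s = r" if ij: "0 \<le> i" "i < 4" "0 \<le> j" "j < 4" and eq: "f i s = f j r" for i j s r
  proof -
    have gM: "g [^] k \<in> generate G {g}" for k :: int using generate_pow[OF g(1)] by blast
    have nt: "g [^] i \<otimes> t \<noteq> g [^] j" for i j :: int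
    proof
      assume "g [^] i \<otimes> t = g [^] j"
      then have "inv (g [^] i) \<otimes> g [^] j = inv (g [^] i) \<otimes> (g [^] i \<otimes> t)" by simp
      also have "\<dots> = t" using g t by (simp add: m_assoc[symmetric])
      finally have "t = inv (g [^] i) \<otimes> g [^] j" ..
      moreover have "subgroup (generate G {g}) G" using g by (intro generate_is_subgroup) auto
      ultimately have "t \<in> generate G {g}"
        using gM by (simp add: subgroup.m_closed subgroup.m_inv_closed)
      then show False using t(2) by simp
    qed
    have sr: "s = r" using eq nt[of i j] nt[of j i] g t by (cases s; cases r) (auto simp: f_def)
    then have "g [^] i = g [^] j" using eq g t by (cases r) (auto simp: f_def)
    then have "4 dvd j - i" using g by (simp add: int_pow_eq)
    then have "i = j" using ij by presburger
    then show ?thesis using sr by simp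
  qed
  have npow: "t \<otimes> g [^] n = x [^] n \<otimes> t" if x: "x \<in> carrier G" "t \<otimes> g = x \<otimes> t" for x and n :: nat
  proof (induction n)
    case (Suc n)
    have "t \<otimes> g [^] Suc n = x [^] n \<otimes> (t \<otimes> g)"
      using Suc g t x(1) by (simp add: m_assoc[symmetric])
    also have "\<dots> = x [^] Suc n \<otimes> t" using x g t by (simp add: m_assoc)
    finally show ?case .
  qed (use t in simp)
  show ?thesis
    using conj
  proof
    assume c: "t \<otimes> g = g \<otimes> t"
    have tp: "t \<otimes> g [^] j = g [^] j \<otimes> t" if "0 \<le> j" for j :: int
      using npow[OF g(1) c, of "nat j"] that int_pow_int[of G g "nat j"] by simp
    have f_mult: "f i s \<otimes> f j r = f ((i + j) mod 4) (s \<noteq> r)" if "0 \<le> j" for i j s r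
    proof -
      have "f i s \<otimes> f j r = g [^] i \<otimes> (g [^] j \<otimes> (if s then t else \<one>)) \<otimes> (if r then t else \<one>)"
        using tp[OF that] g t by (simp add: f_def m_assoc[symmetric]) (simp add: m_assoc)
      also have "\<dots> = g [^] (i + j) \<otimes> (if s \<noteq> r then t else \<one>)"
        using g t by (auto simp: int_pow_mult m_assoc)
      finally show ?thesis by (simp add: f_def pw)
    qed
    have "G \<cong> integer_mod_group 2 \<times>\<times> integer_mod_group 4"
    proof (rule iso_if_injective_hom[OF fin, where f = "\<lambda>(i, j). f j (i = 1)"])
      show "group (integer_mod_group 2 \<times>\<times> integer_mod_group 4)" by (simp add: DirProd_group)
      show "card (carrier (integer_mod_group 2 \<times>\<times> integer_mod_group 4)) = card (carrier G)"
        by (simp add: carrier_integer_mod_group card_cartesian_product card)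
      show "inj_on (\<lambda>(i, j). f j (i = 1)) (carrier (integer_mod_group 2 \<times>\<times> integer_mod_group 4))"
        by (auto simp: inj_on_def carrier_integer_mod_group dest!: f_eq[rotated 4])
      fix x y assume "x \<in> carrier (integer_mod_group 2 \<times>\<times> integer_mod_group 4)" "y \<in> carrier (integer_mod_group 2 \<times>\<times> integer_mod_group 4)"
      moreover obtain i j k l where x: "x = (i, j)" and y: "y = (k, l)" by (cases x, cases y)
      ultimately have "0 \<le> i \<and> i < 2" "0 \<le> k \<and> k < 2" and l: "0 \<le> l"
        by (auto simp: carrier_integer_mod_group)
      then have "i = 0 \<or> i = 1" "k = 0 \<or> k = 1" by presburger+
      then show "(\<lambda>(i, j). f j (i = 1)) (x \<otimes>\<^bsub>integer_mod_group 2 \<times>\<times> integer_mod_group 4\<^esub> y) =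
          (\<lambda>(i, j). f j (i = 1)) x \<otimes> (\<lambda>(i, j). f j (i = 1)) y"
        using f_mult[OF l, of j "i = 1" "k = 1"] x y by auto
    qed (use fG in \<open>auto simp: carrier_integer_mod_group\<close>)
    then show ?thesis ..
  next
    assume c: "t \<otimes> g = inv g \<otimes> t"
    have tp: "t \<otimes> g [^] j = g [^] (- j) \<otimes> t" if "0 \<le> j" for j :: int
      using npow[OF inv_closed[OF g(1)] c, of "nat j"] that int_pow_int[of G g "nat j"] g
      by (simp add: int_pow_neg int_pow_inv)
    have f_mult: "f i s \<otimes> f j r = f ((if s then i - j else i + j) mod 4) (s \<noteq> r)" if "0 \<le> j" for i j s r
    proof -
      have "f i s \<otimes> f j r = g [^] i \<otimes> (g [^] (if s then - j else j) \<otimes> (if s then t else \<one>)) \<otimes> (if r then t else \<one>)"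
        using tp[OF that] g t by (simp add: f_def m_assoc[symmetric]) (simp add: m_assoc)
      also have "\<dots> = g [^] (if s then i - j else i + j) \<otimes> (if s \<noteq> r then t else \<one>)"
        using g t by (auto simp: int_pow_mult[symmetric] m_assoc[symmetric]) (auto simp: m_assoc)
      finally show ?thesis by (simp add: f_def pw)
    qed
    have "G \<cong> dihedral_group 4"
    proof (rule iso_if_injective_hom[OF fin, where f = "\<lambda>(i, s). f i s"])
      show "group (dihedral_group 4)" by (rule group_dihedral_group) simp
      show "card (carrier (dihedral_group 4)) = card (carrier G)"
        using order_dihedral_group[of 4] card by (simp add: Coset.order_def)
      show "inj_on (\<lambda>(i, s). f i s) (carrier (dihedral_group 4))"
        by (auto simp: inj_on_def dihedral_group_def dest!: f_eq[rotated 4])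
      fix x y assume "x \<in> carrier (dihedral_group 4)" "y \<in> carrier (dihedral_group 4)"
      then obtain i s j r where x: "x = (i, s)" and y: "y = (j, r)" "0 \<le> j"
        by (auto simp: dihedral_group_def)
      then show "(\<lambda>(i, s). f i s) (x \<otimes>\<^bsub>dihedral_group 4\<^esub> y) = (\<lambda>(i, s). f i s) x \<otimes> (\<lambda>(i, s). f i s) y"
        using f_mult[OF y(2), of i s r] by (simp add: dihedral_group_def)
    qed (use fG in \<open>auto simp: dihedral_group_def\<close>)
    then show ?thesis ..
  qed
qed

text \<open>If no involution lies outside the cyclic subgroup of order 4, then G is the quaternion group,
  and its graph is the octahedron.\<close>

lemma order_8_cases:
  assumes fin: "finite (carrier G)" and card: "card (carrier G) = 8" and g: "g \<in> carrier G" "ord g = 4"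
    and max: "\<And>h. h \<in> carrier G \<Longrightarrow> ord h \<le> 4"
  shows "embeddable_in (noncyclic_graph G) (crosscap_surface 0) \<or>
    G \<cong> integer_mod_group 2 \<times>\<times> integer_mod_group 4 \<or> G \<cong> dihedral_group 4"
proof -
  note p = powers_of_order_4[OF fin g]
  define M where "M = generate G {g}"
  have M: "subgroup M G" "card M = 4"
    using g generate_is_subgroup[of "{g}"] generate_pow_card[OF g(1)] by (auto simp: M_def)
  interpret M: subgroup M G by (rule M(1))
  have finM: "finite M" using p(1) by (simp add: M_def)
  have cB: "card (carrier G - M) = 4" using card M M.subset finM by (simp add: card_Diff_subset)
  have sq: "x \<otimes> y \<in> M" if "x \<in> carrier G - M" "y \<in> carrier G - M" for x y
    using index_two_mult[OF fin M(1) _ that] M(2) card by simp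
  \<comment> \<open>The order of \<open>b\<close> divides 4, so its square is an element of
    \<open>M\<close> that squares to the identity; only two elements of \<open>M\<close> do.\<close>
  have sq_cases: "b \<otimes> b = \<one> \<or> b \<otimes> b = g \<otimes> g" if b: "b \<in> carrier G - M" for b
  proof -
    have "ord b dvd 8" "ord b \<le> 4" "ord b \<noteq> 0"
      using ord_dvd_group_order[of b] max[of b] ord_ge_1[OF fin, of b] b card by (auto simp: Coset.order_def)
    moreover from this have "ord b = 1 \<or> ord b = 2 \<or> ord b = 3 \<or> ord b = 4" by linarith
    ultimately have "ord b dvd 4" by (elim disjE) simp_all
    then have "b [^] (4::nat) = \<one>" using b by (simp add: pow_eq_id)
    then have b4: "b \<otimes> b \<otimes> (b \<otimes> b) = \<one>" using b by (simp add: numeral_eq_Suc m_assoc)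
    have "b \<otimes> b \<in> {\<one>, g, g \<otimes> g, inv g}" using sq[OF b b] p(1) by (simp add: M_def)
    moreover have "b \<otimes> b \<noteq> g" using b4 p(2) by auto
    moreover have "b \<otimes> b \<noteq> inv g"
    proof
      assume "b \<otimes> b = inv g"
      then have "inv g \<otimes> inv g = \<one>" using b4 by simp
      then have "g \<otimes> g = \<one>" using g by (metis inv_mult_group inv_one inv_inv m_closed)
      then show False using p(2) by simp
    qed
    ultimately show ?thesis by blast
  qed
  show ?thesis
  proof (cases "\<exists>t\<in>carrier G - M. t \<otimes> t = \<one>")
    case True
    then obtain t where t: "t \<in> carrier G" "t \<notin> M" "t \<otimes> t = \<one>" by auto
    have gM: "g \<in> M" by (auto simp: M_def intro: generate.incl)
    have "t \<otimes> g \<notin> M"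
    proof
      assume "t \<otimes> g \<in> M"
      then have "t \<otimes> g \<otimes> inv g \<in> M" using gM by blast
      then show False using t g by (simp add: m_assoc)
    qed
    \<comment> \<open>As \<open>t\<close> is its own inverse, this is a conjugate of
      \<open>g\<close>; it must be an element of order 4 in \<open>M\<close>, that is
      \<open>g\<close> or \<open>inv g\<close>.\<close>
    then have "t \<otimes> g \<otimes> t \<in> M" using sq[of "t \<otimes> g" t] t g by simp
    then have m: "t \<otimes> g \<otimes> t \<in> {\<one>, g, g \<otimes> g, inv g}" using p(1) by (simp add: M_def)
    have tg: "t \<otimes> g \<otimes> t \<otimes> t = t \<otimes> g" using t g by (simp add: m_assoc)
    have "t \<otimes> g \<otimes> t \<noteq> \<one>"
    proof
      assume "t \<otimes> g \<otimes> t = \<one>"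
      then have "t = t \<otimes> g" using tg t by simp
      moreover have "g \<noteq> \<one>" using p(2) by auto
      ultimately show False using t(1) g(1) by simp
    qed
    moreover have "t \<otimes> g \<otimes> t \<noteq> g \<otimes> g"
    proof
      assume eq: "t \<otimes> g \<otimes> t = g \<otimes> g"
      have "t \<otimes> g \<otimes> t \<otimes> (t \<otimes> g \<otimes> t) = t \<otimes> g \<otimes> (t \<otimes> t) \<otimes> g \<otimes> t" using t(1) g by (simp add: m_assoc)
      then have "t \<otimes> (g \<otimes> g) \<otimes> t = \<one>" using eq p(3) t g by (simp add: m_assoc)
      moreover have "t \<otimes> (g \<otimes> g) = t \<otimes> (g \<otimes> g) \<otimes> t \<otimes> t" using t g by (simp add: m_assoc)
      ultimately have "t \<otimes> (g \<otimes> g) = t" using t(1) by simp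
      then show False using t(1) g(1) p(2) by simp
    qed
    ultimately have "t \<otimes> g \<otimes> t = g \<or> t \<otimes> g \<otimes> t = inv g" using m by blast
    then have "t \<otimes> g = g \<otimes> t \<or> t \<otimes> g = inv g \<otimes> t" using tg by metis
    then show ?thesis using order_8_iso[OF fin card g t(1) _ t(3)] t(2) by (simp add: M_def)
  next
    case False
    \<comment> \<open>All elements outside \<open>M\<close> now have order 4, so they form two pairs
      of mutually inverse elements.\<close>
    then have sqz: "b \<otimes> b = g \<otimes> g" if "b \<in> carrier G - M" for b using sq_cases[OF that] that by blast
    have inv_out: "inv b \<in> carrier G - M" "inv b \<noteq> b" if b: "b \<in> carrier G - M" for b
    proof -
      show "inv b \<in> carrier G - M" using b M.m_inv_closed by fastforce
      show "inv b \<noteq> b" using sqz[OF b] p(2) b r_inv by (metis DiffD1)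
    qed
    obtain b where b: "b \<in> carrier G - M" using cB by (metis card.empty ex_in_conv zero_neq_numeral)
    have c2: "card (carrier G - M - {b, inv b}) = 2"
      using cB inv_out[OF b] b fin by (subst card_Diff_subset) auto
    then obtain c where c: "c \<in> carrier G - M - {b, inv b}" by (metis card.empty ex_in_conv zero_neq_numeral)
    have "{c, inv c} = carrier G - M - {b, inv b}"
    proof (rule card_subset_eq)
      show "{c, inv c} \<subseteq> carrier G - M - {b, inv b}"
        using c inv_out(1)[of c] b by auto
      show "card {c, inv c} = card (carrier G - M - {b, inv b})" using c2 inv_out(2)[of c] c by auto
    qed (use fin in simp)
    then have cover: "carrier G \<subseteq> {\<one>, g \<otimes> g} \<union> ({g, inv g} \<union> {b, inv b} \<union> {c, inv c})"
      using p(1) unfolding M_def by blast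
    \<comment> \<open>The unique involution is a power of every non-identity element. It thus
      belongs to the cyclicizer, which leaves three inverse pairs as vertices.\<close>
    have "cyclic_pair G (g \<otimes> g) y" if y: "y \<in> carrier G" for y
    proof (cases "y = \<one>")
      case True
      then show ?thesis using g by (auto intro!: cyclic_pairI generate.one)
    next
      case False
      have "g \<otimes> g \<in> generate G {y}"
      proof (cases "y \<in> M")
        case True
        then have "y \<in> {g, g \<otimes> g, inv g}" using False p(1) by (auto simp: M_def)
        moreover have "g \<otimes> g \<in> generate G {g}" by (auto intro: generate.intros)
        ultimately show ?thesis using generator_inv(2)[OF g(1)] by (auto intro: generate.incl)
      next
        case False
        then have "y \<otimes> y = g \<otimes> g" using sqz y by blast
        moreover have "y \<otimes> y \<in> generate G {y}" by (auto intro: generate.intros)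
        ultimately show ?thesis by simp
      qed
      then show ?thesis using cyclic_pairI[OF y] cyclic_pair_commute by blast
    qed
    then have "g \<otimes> g \<in> cyclicizer G" using g by (simp add: cyclicizer_def)
    then have "carrier G - cyclicizer G \<subseteq> {g, inv g} \<union> {b, inv b} \<union> {c, inv c}"
      using cover one_in_cyclicizer by blast
    then show ?thesis using planar_if_three_pairs g b c by blast
  qed
qed

end

section \<open>Genus one and the classification\<close>

text \<open>A non-empty set of extended naturals attains its infimum, and the infimum of the empty
  set is infinite.\<close>

lemma nonorientable_genus_eq_1_iff:
  "nonorientable_genus \<Gamma> = 1 \<longleftrightarrow>
     embeddable_in \<Gamma> (crosscap_surface 1) \<and> \<not> embeddable_in \<Gamma> (crosscap_surface 0)"
proof -
  let ?S = "{enat k |k. embeddable_in \<Gamma> (crosscap_surface k)}"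
  have mem: "enat k \<in> ?S \<longleftrightarrow> embeddable_in \<Gamma> (crosscap_surface k)" for k by auto
  have "Inf ?S = 1 \<longleftrightarrow> enat 1 \<in> ?S \<and> enat 0 \<notin> ?S"
  proof
    assume I: "Inf ?S = 1"
    have "?S \<noteq> {}"
    proof
      assume "?S = {}"
      then have "Inf ?S = \<infinity>" by (simp only: Inf_enat_def if_True simp_thms)
      then show False using I by (simp add: one_enat_def)
    qed
    then have "Inf ?S \<in> ?S" unfolding Inf_enat_def by (simp only: if_False) (meson LeastI ex_in_conv)
    moreover have "enat 0 \<notin> ?S"
      using Inf_lower[of "enat 0" ?S] I by (auto simp: one_enat_def)
    ultimately show "enat 1 \<in> ?S \<and> enat 0 \<notin> ?S" using I by (simp add: one_enat_def)
  next
    assume S: "enat 1 \<in> ?S \<and> enat 0 \<notin> ?S"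
    have "enat 1 \<le> x" if "x \<in> ?S" for x
      using that S by (cases x) (auto simp: Suc_le_eq intro: gr0I)
    then have "enat 1 \<le> Inf ?S" by (rule Inf_greatest)
    moreover have "Inf ?S \<le> enat 1" using S by (intro Inf_lower) blast
    ultimately show "Inf ?S = 1" by (simp add: one_enat_def)
  qed
  then show ?thesis unfolding nonorientable_genus_def mem .
qed

text \<open>An element \<open>r\<close> of order 4 and an involution \<open>t\<close> other than its
  square are carried over from the model group. The image of \<open>r\<close> gives the drawing in
  the projective plane; both images together give K(3,3).\<close>

lemma genus_1_if_iso:
  fixes G :: "('a, 'b) monoid_scheme" and H :: "('c, 'd) monoid_scheme"
  assumes "group G" "finite (carrier G)" "group H" "G \<cong> H" "card (carrier H) = 8"
    and r: "r \<in> carrier H" "r \<otimes>\<^bsub>H\<^esub> r \<noteq> \<one>\<^bsub>H\<^esub>" "r \<otimes>\<^bsub>H\<^esub> r \<otimes>\<^bsub>H\<^esub> (r \<otimes>\<^bsub>H\<^esub> r) = \<one>\<^bsub>H\<^esub>"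
    and t: "t \<in> carrier H" "t \<otimes>\<^bsub>H\<^esub> t = \<one>\<^bsub>H\<^esub>" "t \<noteq> \<one>\<^bsub>H\<^esub>" "t \<noteq> r \<otimes>\<^bsub>H\<^esub> r"
  shows "nonorientable_genus (noncyclic_graph G) = 1"
proof -
  interpret group G by fact
  interpret H: group H by fact
  obtain h where "h \<in> iso H G" using group.iso_sym[OF assms(1,4)] by (auto simp: is_iso_def)
  then have h: "h \<in> hom H G" "bij_betw h (carrier H) (carrier G)" by (simp_all add: iso_def)
  interpret h: group_hom H G h using h(1) by unfold_locales
  have inj: "inj_on h (carrier H)" using h(2) by (simp add: bij_betw_def)
  have m: "h (x \<otimes>\<^bsub>H\<^esub> y) = h x \<otimes>\<^bsub>G\<^esub> h y" if "x \<in> carrier H" "y \<in> carrier H" for x y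
    using that by simp
  have eq: "h x = h y \<longleftrightarrow> x = y" if "x \<in> carrier H" "y \<in> carrier H" for x y
    using inj that by (simp add: inj_on_eq_iff)
  have rr: "r \<otimes>\<^bsub>H\<^esub> r \<in> carrier H" using r(1) by simp
  have R: "h r \<in> carrier G" "h r \<otimes>\<^bsub>G\<^esub> h r \<noteq> \<one>\<^bsub>G\<^esub>"
    "h r \<otimes>\<^bsub>G\<^esub> h r \<otimes>\<^bsub>G\<^esub> (h r \<otimes>\<^bsub>G\<^esub> h r) = \<one>\<^bsub>G\<^esub>"
    using r(1) eq[OF rr H.one_closed] r(2) unfolding m[OF r(1) r(1)] h.hom_one
    by (simp_all add: r(3) m[OF r(1) r(1), symmetric] m[OF rr rr, symmetric] del: h.hom_mult)
  have T: "h t \<in> carrier G" "h t \<otimes>\<^bsub>G\<^esub> h t = \<one>\<^bsub>G\<^esub>" "h t \<noteq> \<one>\<^bsub>G\<^esub>" "h t \<noteq> h r \<otimes>\<^bsub>G\<^esub> h r"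
    using t(1) eq[OF t(1) H.one_closed] eq[OF t(1) rr] t(3,4) unfolding m[OF r(1) r(1)] h.hom_one
    by (simp_all add: t(2) m[OF t(1) t(1), symmetric] del: h.hom_mult)
  have "card (carrier G) = 8" using bij_betw_same_card[OF h(2)] assms(5) by simp
  then show ?thesis
    unfolding nonorientable_genus_eq_1_iff
    using projective_order_8[OF assms(2) _ R(1) ord_4I[OF R]] order_8_not_planar[OF assms(2) R T] by blast
qed

theorem theorem1p2:
  fixes G :: "('a, 'b) monoid_scheme"
  assumes "group G" and "finite (carrier G)" and "\<not> cyclic_group G"
  shows "nonorientable_genus (noncyclic_graph G) = 1 \<longleftrightarrow>
    G \<cong> integer_mod_group 2 \<times>\<times> integer_mod_group 4 \<or> G \<cong> dihedral_group 4"
proof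
  interpret group G by fact
  assume "nonorientable_genus (noncyclic_graph G) = 1"
  then have emb: "embeddable_in (noncyclic_graph G) (crosscap_surface 1)"
    and nplanar: "\<not> embeddable_in (noncyclic_graph G) (crosscap_surface 0)"
    by (simp_all add: nonorientable_genus_eq_1_iff)
  obtain g where g: "g \<in> carrier G" and max: "\<And>h. h \<in> carrier G \<Longrightarrow> ord h \<le> ord g"
    and cases: "ord g = 2 \<and> card (carrier G) = 4 \<or> ord g = 3 \<and> card (carrier G) = 6 \<or> ord g = 4 \<and> card (carrier G) = 8"
    using projective_order_cases[OF assms(2,3) emb] by blast
  show "G \<cong> integer_mod_group 2 \<times>\<times> integer_mod_group 4 \<or> G \<cong> dihedral_group 4"
    using cases
  proof (elim disjE conjE)
    \<comment> \<open>The at most three vertices go to the triangle of the bipyramid; the apexes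
      stay free.\<close>
    assume "card (carrier G) = 4"
    then have "embeddable_in (noncyclic_graph G) (crosscap_surface 0)"
      using assms(2) by (intro planar_if_two_blocks[of "{}" "carrier G - {\<one>\<^bsub>G\<^esub>}"]) (auto simp: card_Diff_subset)
    then show ?thesis using nplanar by blast
  next
    assume o: "ord g = 3" and c: "card (carrier G) = 6"
    have "inv\<^bsub>G\<^esub> g \<noteq> g" "g \<noteq> \<one>\<^bsub>G\<^esub>" using inv_neq_self[OF g] o by auto
    moreover from this have "\<one>\<^bsub>G\<^esub> \<noteq> inv\<^bsub>G\<^esub> g" using g by (metis inv_inv inv_one)
    ultimately have "card {\<one>\<^bsub>G\<^esub>, g, inv\<^bsub>G\<^esub> g} = 3" using g by (auto simp: card_insert_if)
    then have W: "card (carrier G - {\<one>\<^bsub>G\<^esub>, g, inv\<^bsub>G\<^esub> g}) = 3"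
      using c g by (subst card_Diff_subset) auto
    have "cyclic_pair G x y" if "x \<in> {g, inv\<^bsub>G\<^esub> g}" "y \<in> {g, inv\<^bsub>G\<^esub> g}" for x y
    proof -
      have "y \<in> generate G {x}"
        using that generator_inv(1)[OF g] by (auto intro: generate.incl generate.inv)
      then show ?thesis using cyclic_pairI[of x y] that g by auto
    qed
    \<comment> \<open>\<open>g\<close> and its inverse are the apexes, and the three elements
      outside <g> form the triangle.\<close>
    then have "embeddable_in (noncyclic_graph G) (crosscap_surface 0)"
      using W assms(2)
      by (intro planar_if_two_blocks[of "{g, inv\<^bsub>G\<^esub> g}" "carrier G - {\<one>\<^bsub>G\<^esub>, g, inv\<^bsub>G\<^esub> g}"])
         (auto simp: card_insert_if)
    then show ?thesis using nplanar by blast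
  next
    assume "ord g = 4" "card (carrier G) = 8"
    then show ?thesis using order_8_cases[OF assms(2) _ g] max nplanar by simp
  qed
next
  assume "G \<cong> integer_mod_group 2 \<times>\<times> integer_mod_group 4 \<or> G \<cong> dihedral_group 4"
  then show "nonorientable_genus (noncyclic_graph G) = 1"
  proof
    assume iso: "G \<cong> integer_mod_group 2 \<times>\<times> integer_mod_group 4"
    show ?thesis
      \<comment> \<open>A generator of the second factor and the involution of the first.\<close>
      by (rule genus_1_if_iso[OF assms(1,2) _ iso, of "(0, 1)" "(1, 0)"])
         (simp_all add: DirProd_group carrier_integer_mod_group card_cartesian_product)
  next
    assume iso: "G \<cong> dihedral_group 4"
    show ?thesis
      \<comment> \<open>A quarter turn and a reflection.\<close>
      by (rule genus_1_if_iso[OF assms(1,2) _ iso, of "(1, False)" "(0, True)"])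
         (use group_dihedral_group[of 4] order_dihedral_group[of 4] in \<open>simp_all add: dihedral_group_def Coset.order_def\<close>)
  qed
qed

end
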